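(* Let $(X,\mathrm{dist})$ be a distance space, let $P\subseteq X$ with $|P|=n$, let $0<r_1<r_2$, and let $\mathcal{H}$ be an $(r_1,r_2,p_1,p_2)$-sensitive family of hash functions on $X$. Let $\rho=\log(1/p_1)/\log(1/p_2)$. Then there exists a solution to the $(r_1,r_2)$-near neighbor problem for $P$ with the following properties: (i) the query complexity is dominated by $O(\log_{1/p_2}^{2}(n)/p_1)$ evaluations of functions from $\mathcal{H}$, $O(n^{\rho})$ distance computations, and $O(n^{\rho}/p_1)$ other word-RAM operations; (ii) the solution uses $O(n^{1+\rho}/p_1)$ words of space in addition to the space required to store the data and $O(\log_{1/p_2}^{2}(n)/p_1)$ functions from $\mathcal{H}$.
   Context: A distribution $\mathcal{H}$ over functions $h\colon X\to R$ is $(r_1,r_2,p_1,p_2)$-sensitive if for all $x,y\in X$ and $h\sim\mathcal{H}$: if $\mathrm{dist}(x,y)\le r_1$ then $\Pr[h(x)=h(y)]\ge p_1$, and if $\mathrm{dist}(x,y)\ge r_2$ then $\Pr[h(x)=h(y)]\le p_2$. A solution to the $(r_1,r_2)$-near neighbor problem for $P$ is a data structure supporting the query: given $q\in X$, if there exists $x\in P$ with $\mathrm{dist}(q,x)\le r_1$, then with probability at least $1/2$ return some $x'\in P$ with $\mathrm{dist}(q,x')<r_2$. The model is the word RAM with word length $\Theta(\log n)$, where during preprocessing one can sample independently from $\mathcal{H}$ and seed pairwise independent hash functions (e.g. via an instruction generating a uniformly random word in constant time). No assumptions are made on $p_1,p_2$ (they may depend on $n$) or on the cost of storing points, storing hash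 functions, or computing distances.
   Formalization: log_{1/p2}(n) is rounded up to an integer k; other operations are O(n^ρ/p1) plus O(1) per hash evaluation; the word length is at least a constant times log n and, if p1>p2, times log(1+k/p1); R is countable, p1>0, 0<p2<1, n≥1. *)

theory Defs
  imports "HOL-Probability.Probability"
begin

section \<open>Distance spaces and locality-sensitive hashing\<close>

definition distance_space :: "'x set \<Rightarrow> ('x \<Rightarrow> 'x \<Rightarrow> real) \<Rightarrow> bool" where
  "distance_space X dst \<longleftrightarrow>
     (\<forall>x\<in>X. \<forall>y\<in>X. 0 \<le> dst x y \<and> dst x y = dst y x) \<and> (\<forall>x\<in>X. dst x x = 0)"

text \<open>
  The range \<open>R\<close> of the hash functions is the countable type \<open>'r\<close> with the discrete
  \<open>\<sigma>\<close>-algebra, so that all collision events are measurable.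
\<close>

definition hash_family :: "'x set \<Rightarrow> ('x \<Rightarrow> 'r::countable) measure \<Rightarrow> bool" where
  "hash_family X H \<longleftrightarrow>
     prob_space H \<and> (\<forall>x\<in>X. (\<lambda>h. h x) \<in> H \<rightarrow>\<^sub>M count_space UNIV)"

definition sensitive ::
  "'x set \<Rightarrow> ('x \<Rightarrow> 'x \<Rightarrow> real) \<Rightarrow> real \<Rightarrow> real \<Rightarrow> real \<Rightarrow> real \<Rightarrow>
     ('x \<Rightarrow> 'r::countable) measure \<Rightarrow> bool" where
  "sensitive X dst r1 r2 p1 p2 H \<longleftrightarrow>
     (\<forall>x\<in>X. \<forall>y\<in>X.
        (dst x y \<le> r1 \<longrightarrow> measure H {h \<in> space H. h x = h y} \<ge> p1) \<and>
        (dst x y \<ge> r2 \<longrightarrow> measure H {h \<in> space H. h x = h y} \<le> p2))"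

definition pairwise_independent_hash :: "nat \<Rightarrow> ('r::countable \<Rightarrow> nat) measure \<Rightarrow> bool" where
  "pairwise_independent_hash w G \<longleftrightarrow>
     prob_space G \<and>
     (\<forall>r. (\<lambda>g. g r) \<in> G \<rightarrow>\<^sub>M count_space UNIV) \<and>
     (\<forall>g\<in>space G. \<forall>r. g r < 2 ^ w) \<and>
     (\<forall>r r'. \<forall>u<2 ^ w. \<forall>v<2 ^ w. r \<noteq> r' \<longrightarrow>
        measure G {g \<in> space G. g r = u \<and> g r' = v} = 1 / (2 ^ w * 2 ^ w))"


section \<open>Word RAM\<close>

text \<open>
  Words are natural numbers below \<open>2 ^ w\<close>. Query algorithms are structured programs over
  registers and a random-access memory. The query point is opaque: it is accessible only
  through \<open>HashEval\<close> (evaluate a stored hash function on it) and \<open>DistTest\<close> (compute its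
  distance to a stored data point and compare the result with the threshold \<open>r\<^sub>2\<close>).
\<close>

datatype binop =
  Plus | Minus | Times | Div | Mod | BitAnd | BitOr | BitXor | ShiftL | ShiftR | Equal | Less

fun binop_sem :: "nat \<Rightarrow> binop \<Rightarrow> nat \<Rightarrow> nat \<Rightarrow> nat" where
  "binop_sem w Plus a b = (a + b) mod 2 ^ w"
| "binop_sem w Minus a b = (a + 2 ^ w - b) mod 2 ^ w"
| "binop_sem w Times a b = (a * b) mod 2 ^ w"
| "binop_sem w Div a b = (a div b) mod 2 ^ w"
| "binop_sem w Mod a b = (a mod b) mod 2 ^ w"
| "binop_sem w BitAnd a b = (Bit_Operations.and a b) mod 2 ^ w"
| "binop_sem w BitOr a b = (Bit_Operations.or a b) mod 2 ^ w"
| "binop_sem w BitXor a b = (Bit_Operations.xor a b) mod 2 ^ w"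
| "binop_sem w ShiftL a b = push_bit b a mod 2 ^ w"
| "binop_sem w ShiftR a b = drop_bit b a mod 2 ^ w"
| "binop_sem w Equal a b = of_bool (a = b) mod 2 ^ w"
| "binop_sem w Less a b = of_bool (a < b) mod 2 ^ w"

datatype com =
    Skip
  | Const nat nat
  | Binop binop nat nat nat
  | Load nat nat
  | Store nat nat
  | HashEval nat nat
  | DistTest nat nat
  | Seq com com
  | Cond nat com com
  | While nat com

record machine =
  word_len :: nat
  mem_size :: nat
  num_hash :: nat
  num_points :: nat
  hash_word :: "nat \<Rightarrow> nat"
  dist_less :: "nat \<Rightarrow> bool"

type_synonym state = "(nat \<Rightarrow> nat) \<times> (nat \<Rightarrow> nat)"

text \<open>
  \<open>exec M c s e d t s'\<close>: started in the state \<open>s\<close> (registers, memory), \<open>c\<close> halts in \<open>s'\<close>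
  after \<open>e\<close> hash evaluations, \<open>d\<close> distance computations and \<open>t\<close> other operations. There
  is no rule for a memory address, hash function index or point index that is out of range,
  so the existence of an execution includes that none was used.
\<close>

inductive exec :: "machine \<Rightarrow> com \<Rightarrow> state \<Rightarrow> nat \<Rightarrow> nat \<Rightarrow> nat \<Rightarrow> state \<Rightarrow> bool"
  for M :: machine where
  Skip: "exec M Skip s 0 0 0 s"
| Const: "exec M (Const x c) (\<sigma>, \<mu>) 0 0 1 (\<sigma>(x := c mod 2 ^ word_len M), \<mu>)"
| Binop: "exec M (Binop f x y z) (\<sigma>, \<mu>) 0 0 1
            (\<sigma>(x := binop_sem (word_len M) f (\<sigma> y) (\<sigma> z)), \<mu>)"
| Load: "\<sigma> y < mem_size M \<Longrightarrow>
           exec M (Load x y) (\<sigma>, \<mu>) 0 0 1 (\<sigma>(x := \<mu> (\<sigma> y)), \<mu>)"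
| Store: "\<sigma> x < mem_size M \<Longrightarrow>
           exec M (Store x y) (\<sigma>, \<mu>) 0 0 1 (\<sigma>, \<mu>(\<sigma> x := \<sigma> y))"
| HashEval: "\<sigma> y < num_hash M \<Longrightarrow>
           exec M (HashEval x y) (\<sigma>, \<mu>) 1 0 0 (\<sigma>(x := hash_word M (\<sigma> y)), \<mu>)"
| DistTest: "\<sigma> y < num_points M \<Longrightarrow>
           exec M (DistTest x y) (\<sigma>, \<mu>) 0 1 0
             (\<sigma>(x := of_bool (dist_less M (\<sigma> y)) mod 2 ^ word_len M), \<mu>)"
| Seq: "exec M c1 s e1 d1 t1 s' \<Longrightarrow> exec M c2 s' e2 d2 t2 s'' \<Longrightarrow>
           exec M (Seq c1 c2) s (e1 + e2) (d1 + d2) (t1 + t2) s''"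
| CondT: "\<sigma> x \<noteq> 0 \<Longrightarrow> exec M c1 (\<sigma>, \<mu>) e d t s' \<Longrightarrow>
           exec M (Cond x c1 c2) (\<sigma>, \<mu>) e d (Suc t) s'"
| CondF: "\<sigma> x = 0 \<Longrightarrow> exec M c2 (\<sigma>, \<mu>) e d t s' \<Longrightarrow>
           exec M (Cond x c1 c2) (\<sigma>, \<mu>) e d (Suc t) s'"
| WhileF: "\<sigma> x = 0 \<Longrightarrow> exec M (While x c) (\<sigma>, \<mu>) 0 0 1 (\<sigma>, \<mu>)"
| WhileT: "\<sigma> x \<noteq> 0 \<Longrightarrow> exec M c (\<sigma>, \<mu>) e1 d1 t1 s' \<Longrightarrow>
           exec M (While x c) s' e2 d2 t2 s'' \<Longrightarrow>
           exec M (While x c) (\<sigma>, \<mu>) (e1 + e2) (d1 + d2) (Suc (t1 + t2)) s''"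

inductive_cases exec_elims:
  "exec M Skip s e d t s'"
  "exec M (Const x k) s e d t s'"
  "exec M (Binop f x y z) s e d t s'"
  "exec M (Load x y) s e d t s'"
  "exec M (Store x y) s e d t s'"
  "exec M (HashEval x y) s e d t s'"
  "exec M (DistTest x y) s e d t s'"
  "exec M (Seq c1 c2) s e d t s'"
  "exec M (Cond x c1 c2) s e d t s'"
  "exec M (While x c) s e d t s'"

lemma exec_deterministic:
  assumes "exec M c s e d t s'" "exec M c s e' d' t' s''"
  shows "e' = e \<and> d' = d \<and> t' = t \<and> s'' = s'"
  using assms
proof (induction arbitrary: e' d' t' s'' rule: exec.induct)
  case (Seq c1 s e1 d1 t1 s1 c2 e2 d2 t2 s2)
  from Seq.prems obtain f1 g1 u1 r1 f2 g2 u2 where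
    1: "exec M c1 s f1 g1 u1 r1" "exec M c2 r1 f2 g2 u2 s''"
    and 2: "e' = f1 + f2" "d' = g1 + g2" "t' = u1 + u2"
    by (rule exec_elims(8))
  from Seq.IH(1)[OF 1(1)] 1(2) have "exec M c2 s1 f2 g2 u2 s''" by simp
  from Seq.IH(1)[OF 1(1)] Seq.IH(2)[OF this] 2 show ?case by simp
next
  case (CondT \<sigma> x c1 \<mu> e d t s' c2)
  from CondT.prems CondT.hyps(1) obtain u where "exec M c1 (\<sigma>, \<mu>) e' d' u s''" "t' = Suc u"
    by (auto elim: exec_elims(9))
  with CondT.IH show ?case by blast
next
  case (CondF \<sigma> x c2 \<mu> e d t s' c1)
  from CondF.prems CondF.hyps(1) obtain u where "exec M c2 (\<sigma>, \<mu>) e' d' u s''" "t' = Suc u"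
    by (auto elim: exec_elims(9))
  with CondF.IH show ?case by blast
next
  case (WhileF \<sigma> x c \<mu>)
  from WhileF.prems show ?case by (rule exec_elims(10)) (use WhileF.hyps in auto)
next
  case (WhileT \<sigma> x c \<mu> e1 d1 t1 s1 e2 d2 t2 s2)
  from WhileT.prems obtain f1 g1 u1 r1 f2 g2 u2 where
    1: "exec M c (\<sigma>, \<mu>) f1 g1 u1 r1" "exec M (While x c) r1 f2 g2 u2 s''"
    and 2: "e' = f1 + f2" "d' = g1 + g2" "t' = Suc (u1 + u2)"
    by (rule exec_elims(10)) (use WhileT.hyps(1) in auto)
  from WhileT.IH(1)[OF 1(1)] 1(2) have "exec M (While x c) s1 f2 g2 u2 s''" by simp
  from WhileT.IH(1)[OF 1(1)] WhileT.IH(2)[OF this] 2 show ?case by simp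
qed (auto elim: exec_elims(1-7))


section \<open>Data structures for the near neighbor problem\<close>

text \<open>
  A data structure consists of an enumeration of the data, the number of functions sampled
  from \<open>H\<close> (each together with a freshly seeded pairwise independent function that maps its
  values to words), the number of uniformly random words drawn during preprocessing, the
  number of memory words, and the map that computes the initial memory contents from the
  hash words of the data points and the random words.
\<close>

record 'x nn_structure =
  points :: "nat \<Rightarrow> 'x"
  hash_count :: nat
  random_count :: nat
  space_words :: nat
  preprocess :: "(nat \<Rightarrow> nat \<Rightarrow> nat) \<Rightarrow> (nat \<Rightarrow> nat) \<Rightarrow> (nat \<Rightarrow> nat)"

type_synonym ('x, 'r) seed = "(nat \<Rightarrow> ('x \<Rightarrow> 'r) \<times> ('r \<Rightarrow> nat)) \<times> (nat \<Rightarrow> nat)"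

definition seed_space ::
  "nat \<Rightarrow> ('x \<Rightarrow> 'r) measure \<Rightarrow> ('r \<Rightarrow> nat) measure \<Rightarrow> 'x nn_structure \<Rightarrow> ('x, 'r) seed measure" where
  "seed_space w H G D =
     (\<Pi>\<^sub>M i\<in>{..<hash_count D}. H \<Otimes>\<^sub>M G) \<Otimes>\<^sub>M
     (\<Pi>\<^sub>M i\<in>{..<random_count D}. uniform_count_measure {..<2 ^ w})"

definition sampled_hash :: "('x, 'r) seed \<Rightarrow> nat \<Rightarrow> 'x \<Rightarrow> nat" where
  "sampled_hash \<omega> i x = snd (fst \<omega> i) (fst (fst \<omega> i) x)"

definition initial_memory :: "nat \<Rightarrow> 'x nn_structure \<Rightarrow> ('x, 'r) seed \<Rightarrow> (nat \<Rightarrow> nat)" where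
  "initial_memory n D \<omega> =
     preprocess D (\<lambda>i\<in>{..<hash_count D}. \<lambda>j\<in>{..<n}. sampled_hash \<omega> i (points D j)) (snd \<omega>)"

definition query_machine ::
  "nat \<Rightarrow> nat \<Rightarrow> ('x \<Rightarrow> 'x \<Rightarrow> real) \<Rightarrow> real \<Rightarrow> 'x nn_structure \<Rightarrow> 'x \<Rightarrow> ('x, 'r) seed \<Rightarrow> machine" where
  "query_machine w n dst r2 D q \<omega> =
     \<lparr> word_len = w, mem_size = space_words D, num_hash = hash_count D, num_points = n,
       hash_word = (\<lambda>i. sampled_hash \<omega> i q),
       dist_less = (\<lambda>j. dst q (points D j) < r2) \<rparr>"

text \<open>
  A query starts with all registers zero and must leave the memory as it found it, so that
  the structure can be queried again. The answer is the index in register \<open>0\<close>; a value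
  \<open>\<ge> n\<close> means that no point is returned.
\<close>

definition query_run ::
  "nat \<Rightarrow> nat \<Rightarrow> ('x \<Rightarrow> 'x \<Rightarrow> real) \<Rightarrow> real \<Rightarrow> com \<Rightarrow> 'x nn_structure \<Rightarrow> 'x \<Rightarrow> ('x, 'r) seed \<Rightarrow>
     nat \<Rightarrow> nat \<Rightarrow> nat \<Rightarrow> nat \<Rightarrow> bool" where
  "query_run w n dst r2 Q D q \<omega> e d t out \<longleftrightarrow>
     (\<exists>\<sigma>. exec (query_machine w n dst r2 D q \<omega>) Q
            (\<lambda>_. 0, initial_memory n D \<omega>) e d t (\<sigma>, initial_memory n D \<omega>) \<and> out = \<sigma> 0)"

definition near_neighbor_solution ::
  "nat \<Rightarrow> 'x set \<Rightarrow> ('x \<Rightarrow> 'x \<Rightarrow> real) \<Rightarrow> 'x set \<Rightarrow> real \<Rightarrow> real \<Rightarrow>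
     ('x \<Rightarrow> 'r::countable) measure \<Rightarrow> ('r \<Rightarrow> nat) measure \<Rightarrow> com \<Rightarrow> 'x nn_structure \<Rightarrow> bool" where
  "near_neighbor_solution w X dst P r1 r2 H G Q D \<longleftrightarrow>
     bij_betw (points D) {..<card P} P \<and>
     (\<forall>\<omega>\<in>space (seed_space w H G D). \<forall>a<space_words D. initial_memory (card P) D \<omega> a < 2 ^ w) \<and>
     (\<forall>q\<in>X. (\<exists>x\<in>P. dst q x \<le> r1) \<longrightarrow>
        measure (seed_space w H G D)
          {\<omega> \<in> space (seed_space w H G D).
             \<exists>e d t out. query_run w (card P) dst r2 Q D q \<omega> e d t out \<and>
               out < card P \<and> dst q (points D out) < r2} \<ge> 1 / 2)"


section \<open>Parameters\<close>

definition lsh_rho :: "real \<Rightarrow> real \<Rightarrow> real" where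
  "lsh_rho p1 p2 = ln (1 / p1) / ln (1 / p2)"

text \<open>
  \<open>log\<^bsub>1/p\<^sub>2\<^esub> n\<close>, rounded up: for \<open>p\<^sub>2 < 1/n\<close> the logarithm is below \<open>1\<close> and can be
  arbitrarily small, whereas at least one hash function per table is needed.
\<close>

definition lsh_k :: "nat \<Rightarrow> real \<Rightarrow> real" where
  "lsh_k n p2 = of_int \<lceil>log (1 / p2) (real n)\<rceil>"

text \<open>
  Word lengths of at least \<open>a\<close> times \<open>log n\<close>. If \<open>p\<^sub>1 > p\<^sub>2\<close>, words must also be able to
  index the hash functions in use; this is implied, up to the constant, by the first
  condition unless \<open>1/p\<^sub>1\<close> or \<open>1/(1 - p\<^sub>2)\<close> is superpolynomial in \<open>n\<close>.
\<close>

definition sufficient_word_length :: "real \<Rightarrow> nat \<Rightarrow> real \<Rightarrow> real \<Rightarrow> nat \<Rightarrow> bool" where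
  "sufficient_word_length a n p1 p2 w \<longleftrightarrow>
     a * log 2 (1 + real n) \<le> real w \<and>
     (p2 < p1 \<longrightarrow> a * log 2 (1 + lsh_k n p2 / p1) \<le> real w)"

end

theory Submission
  imports Defs
begin

text \<open>
  Let \<open>k\<close> be \<open>log\<^bsub>1/p\<^sub>2\<^esub> n\<close> rounded up. Each table sums the words of \<open>k\<close> sampled hash functions modulo
  \<open>2 ^ w\<close>. Once two points differ under one of these functions, pairwise independence makes their
  sums an independent uniform pair, so a single word serves as key and, modulo \<open>n\<close>, as bucket
  index. The \<open>O(n\<^sup>\<rho>/p\<^sub>1)\<close> tables are all pairs of a left table with \<open>k div 2\<close> and a right table with
  \<open>k - k div 2\<close> functions, so that a key costs one addition. Only \<open>O(k\<^sup>2/p\<^sub>1)\<close> functions are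
  sampled and shared between the tables of one side; a near point collides with the query in
  some table of each side by the second moment method, provided that the sets of functions used by
  two tables overlap little. Such sets exist by averaging, hence no random words are needed. Budgets
  for list steps and distance computations bound the running time; by Markov's inequality they
  are rarely exhausted. If \<open>p\<^sub>1 \<le> p\<^sub>2\<close>, a linear scan suffices.
\<close>

section \<open>Weakest preconditions with costs\<close>

text \<open>Rounding the logarithm up separates the two query bounds. Put
  \<open>\<theta> = 1 / p1\<close> and \<open>R = n powr lsh_rho p1 p2\<close>. The number of tables
  is of order \<open>\<theta> ^ k\<close>, and only \<open>\<theta> ^ (k - 1)\<close> is known to be
  at most \<open>R\<close>; this is the origin of the factor \<open>1 / p1\<close>. The expected
  number of far points with a matching key is of order \<open>\<theta> ^ k * p2 ^ k * n\<close>,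
  where rounding up can only help because \<open>\<theta> * p2 < 1\<close>; so distance computations
  escape that factor. Sharing functions destroys the independence of the tables. Since every pair of
  a left and a right table is a table, one success on each side is enough, and the sides can be
  analysed separately. Two sets of functions raise the joint collision probability over the
  independent case by at most \<open>\<theta>\<close> to the size of their overlap. This does not
  involve the query or its neighbor, so one deterministic choice of sets serves all queries. The
  failure probability \<open>1 / 2\<close> is divided evenly among four events: no left collision,
  no right collision, list steps exhausted, distance computations exhausted.\<close>

definition wp :: "machine \<Rightarrow> com \<Rightarrow> state \<Rightarrow> (nat \<Rightarrow> nat \<Rightarrow> nat \<Rightarrow> state \<Rightarrow> bool) \<Rightarrow> bool" where
  "wp M c s Q \<longleftrightarrow> (\<exists>e d t s'. exec M c s e d t s' \<and> Q e d t s')"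

lemma wp_mono:
  assumes "wp M c s R" "\<And>e d t s'. R e d t s' \<Longrightarrow> Q e d t s'"
  shows "wp M c s Q"
  using assms unfolding wp_def by blast

text \<open>Determinism: the execution that witnesses the existential in \<open>wp\<close> is the
  only one, so exhibiting one execution decides \<open>wp\<close> for every postcondition. The
  equations for the basic instructions rest on this.\<close>

lemma wp_iff: "exec M c s e d t s' \<Longrightarrow> wp M c s Q \<longleftrightarrow> Q e d t s'"
  unfolding wp_def using exec_deterministic by metis

lemma wp_Skip [simp]: "wp M Skip s Q \<longleftrightarrow> Q 0 0 0 s"
  by (rule wp_iff[OF exec.Skip])

lemma wp_Const [simp]:
  "wp M (Const x c) (\<sigma>, \<mu>) Q \<longleftrightarrow> Q 0 0 1 (\<sigma>(x := c mod 2 ^ word_len M), \<mu>)"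
  by (rule wp_iff[OF exec.Const])

lemma wp_Binop [simp]:
  "wp M (Binop f x y z) (\<sigma>, \<mu>) Q \<longleftrightarrow>
     Q 0 0 1 (\<sigma>(x := binop_sem (word_len M) f (\<sigma> y) (\<sigma> z)), \<mu>)"
  by (rule wp_iff[OF exec.Binop])

text \<open>Out of range there is no execution at all, so the range condition becomes part of the
  equation and a proof of \<open>wp\<close> includes memory safety. The same applies to
  \<open>Store\<close>, \<open>HashEval\<close> and \<open>DistTest\<close>.\<close>

lemma wp_Load [simp]:
  "wp M (Load x y) (\<sigma>, \<mu>) Q \<longleftrightarrow> \<sigma> y < mem_size M \<and> Q 0 0 1 (\<sigma>(x := \<mu> (\<sigma> y)), \<mu>)"
proof (cases "\<sigma> y < mem_size M")
  case True
  then show ?thesis by (simp only: wp_iff[OF exec.Load] simp_thms)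
qed (auto simp: wp_def elim: exec_elims(4))

lemma wp_Store [simp]:
  "wp M (Store x y) (\<sigma>, \<mu>) Q \<longleftrightarrow> \<sigma> x < mem_size M \<and> Q 0 0 1 (\<sigma>, \<mu>(\<sigma> x := \<sigma> y))"
proof (cases "\<sigma> x < mem_size M")
  case True
  then show ?thesis by (simp only: wp_iff[OF exec.Store] simp_thms)
qed (auto simp: wp_def elim: exec_elims(5))

lemma wp_HashEval [simp]:
  "wp M (HashEval x y) (\<sigma>, \<mu>) Q \<longleftrightarrow>
     \<sigma> y < num_hash M \<and> Q 1 0 0 (\<sigma>(x := hash_word M (\<sigma> y)), \<mu>)"
proof (cases "\<sigma> y < num_hash M")
  case True
  then show ?thesis by (simp only: wp_iff[OF exec.HashEval] simp_thms)
qed (auto simp: wp_def elim: exec_elims(6))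

lemma wp_DistTest [simp]:
  "wp M (DistTest x y) (\<sigma>, \<mu>) Q \<longleftrightarrow>
     \<sigma> y < num_points M \<and>
     Q 0 1 0 (\<sigma>(x := of_bool (dist_less M (\<sigma> y)) mod 2 ^ word_len M), \<mu>)"
proof (cases "\<sigma> y < num_points M")
  case True
  then show ?thesis by (simp only: wp_iff[OF exec.DistTest] simp_thms)
qed (auto simp: wp_def elim: exec_elims(7))

lemma wp_Seq [simp]:
  "wp M (Seq c1 c2) s Q \<longleftrightarrow>
     wp M c1 s (\<lambda>e1 d1 t1 s1. wp M c2 s1 (\<lambda>e2 d2 t2 s2. Q (e1 + e2) (d1 + d2) (t1 + t2) s2))"
  unfolding wp_def by (blast intro: exec.Seq elim: exec_elims(8))

lemma wp_Cond [simp]: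
  "wp M (Cond x c1 c2) (\<sigma>, \<mu>) Q \<longleftrightarrow>
     (if \<sigma> x \<noteq> 0 then wp M c1 (\<sigma>, \<mu>) (\<lambda>e d t. Q e d (Suc t))
      else wp M c2 (\<sigma>, \<mu>) (\<lambda>e d t. Q e d (Suc t)))"
proof (cases "\<sigma> x = 0")
  case True
  have "exec M (Cond x c1 c2) (\<sigma>, \<mu>) e d t s' \<longleftrightarrow> (\<exists>u. t = Suc u \<and> exec M c2 (\<sigma>, \<mu>) e d u s')" for e d t s'
    using True by (auto elim: exec_elims(9) intro: exec.CondF)
  with True show ?thesis unfolding wp_def by (simp del: split_paired_Ex) blast
next
  case False
  have "exec M (Cond x c1 c2) (\<sigma>, \<mu>) e d t s' \<longleftrightarrow> (\<exists>u. t = Suc u \<and> exec M c1 (\<sigma>, \<mu>) e d u s')" for e d t s'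
    using False by (auto elim: exec_elims(9) intro: exec.CondT)
  with False show ?thesis unfolding wp_def by (simp del: split_paired_Ex) blast
qed

text \<open>Loops get introduction rules only; as rewrite rules they could be unfolded without
  end.\<close>

lemma wp_While_0: "\<sigma> x = 0 \<Longrightarrow> Q 0 0 1 (\<sigma>, \<mu>) \<Longrightarrow> wp M (While x c) (\<sigma>, \<mu>) Q"
  unfolding wp_def by (blast intro: exec.WhileF)

lemma wp_While_step:
  assumes "\<sigma> x \<noteq> 0"
    and "wp M c (\<sigma>, \<mu>) (\<lambda>e1 d1 t1 s1. wp M (While x c) s1
             (\<lambda>e2 d2 t2. Q (e1 + e2) (d1 + d2) (Suc (t1 + t2))))"
  shows "wp M (While x c) (\<sigma>, \<mu>) Q"
  using assms unfolding wp_def by (blast intro: exec.WhileT)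

lemma wp_SeqI:
  assumes "wp M c1 s R"
    and "\<And>e1 d1 t1 s1. R e1 d1 t1 s1 \<Longrightarrow>
           wp M c2 s1 (\<lambda>e2 d2 t2 s2. Q (e1 + e2) (d1 + d2) (t1 + t2) s2)"
  shows "wp M (Seq c1 c2) s Q"
  using wp_mono[OF assms(1)] assms(2) by auto

section \<open>The query program\<close>

abbreviation seq :: "com \<Rightarrow> com \<Rightarrow> com"  (infixr ";;" 60) where
  "c1 ;; c2 \<equiv> Seq c1 c2"

abbreviation incr :: "nat \<Rightarrow> com" where "incr r \<equiv> Binop Plus r r 8"
abbreviation decr :: "nat \<Rightarrow> com" where "decr r \<equiv> Binop Minus r r 8"
abbreviation load_at :: "nat \<Rightarrow> nat \<Rightarrow> com" where "load_at r a \<equiv> Const 6 a ;; Load r 6"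

text \<open>
  Registers: 0 answer, 1 groups left, 2 stream pointer, 3 next hash function, 4 sum of the
  current group, 5--7 temporaries, 8 the constant 1, 9 left tables remaining, 10 number of right
  tables, 11 number of points, 12 list step budget, 13 distance budget, 14 current table,
  15 and 16 pointers to the current left and right partial key, 17 right tables remaining,
  18 query key, 19 current list entry (point index plus one, 0 for none), 20 left partial
  key, 21 table size, 22 the constant 3, 23 address of the right partial keys, 24 the constant 0,
  25 and 26 number and address of the partial keys to be reset.
\<close>

definition init_phase :: com where
  "init_phase = Const 8 1 ;; Const 15 11 ;; Const 26 11 ;; Const 22 3 ;;
     load_at 1 0 ;; load_at 2 1 ;; load_at 9 2 ;; load_at 10 3 ;; load_at 11 4 ;;
     load_at 12 5 ;; load_at 13 6 ;; load_at 14 7 ;; load_at 21 8 ;; load_at 23 9 ;;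
     load_at 25 10 ;; load_at 0 4"

definition eval_loop :: com where
  "eval_loop = While 5 (HashEval 6 3 ;; Binop Plus 4 4 6 ;; incr 3 ;; decr 5)"

definition scatter_loop :: com where
  "scatter_loop = While 5
     (Load 6 2 ;; incr 2 ;; Load 7 6 ;; Binop Plus 7 7 4 ;; Store 6 7 ;; decr 5)"

definition hash_phase :: com where
  "hash_phase = While 1
     (Const 4 0 ;; Load 5 2 ;; incr 2 ;; eval_loop ;; Load 5 2 ;; incr 2 ;; scatter_loop ;; decr 1)"

text \<open>Two budgets because the two resources have different bounds: every visited entry is
  charged to register 12, but only an entry whose full key equals the query key is charged to
  register 13 and costs a distance computation. When register 13 is empty the scan continues without
  testing.\<close>

definition scan_loop :: com where
  "scan_loop = While 19
     (Cond 12
       (decr 12 ;; Binop Times 6 19 22 ;; Binop Plus 6 6 14 ;; incr 6 ;; Load 7 6 ;;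
        Binop Equal 7 7 18 ;;
        Cond 7
          (Cond 13
            (decr 13 ;; Binop Minus 7 19 8 ;; DistTest 5 7 ;;
             Cond 5 (Binop Minus 0 19 8 ;; Const 12 0) Skip)
            Skip)
          Skip ;;
        incr 6 ;; Load 19 6)
       (Const 19 0))"

definition table_loop :: com where
  "table_loop = While 17
     (Load 7 16 ;; Binop Plus 18 20 7 ;; Binop Mod 7 18 11 ;; Binop Times 7 7 22 ;;
      Binop Plus 7 7 14 ;; Load 19 7 ;; scan_loop ;; Binop Plus 14 14 21 ;; incr 16 ;; decr 17)"

definition probe_phase :: com where
  "probe_phase = While 9
     (Load 20 15 ;; Binop Plus 16 23 24 ;; Binop Plus 17 10 24 ;; table_loop ;; incr 15 ;; decr 9)"

definition reset_phase :: com where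
  "reset_phase = While 25 (Store 26 24 ;; incr 26 ;; decr 25)"

definition lsh_query :: com where
  "lsh_query = init_phase ;; hash_phase ;; probe_phase ;; reset_phase"

text \<open>
  A group \<open>(b, ds)\<close> instructs the query to evaluate the next \<open>b\<close> hash functions and to add the
  sum of their words to the partial keys of the tables in \<open>ds\<close>; partial key \<open>l\<close> is kept at
  address \<open>11 + l\<close>.
\<close>

definition encode :: "(nat \<times> nat list) list \<Rightarrow> nat list" where
  "encode gs = concat (map (\<lambda>(b, ds). b # length ds # map ((+) 11) ds) gs)"

text \<open>Groups consume the hash functions consecutively, so the encoding stores no function
  indices; \<open>c\<close> is the number of the first function not yet consumed.\<close>

fun used :: "nat \<Rightarrow> (nat \<times> nat list) list \<Rightarrow> nat \<Rightarrow> nat set" where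
  "used c [] l = {}"
| "used c ((b, ds) # gs) l = (if l \<in> set ds then {c..<c + b} else {}) \<union> used (c + b) gs l"

definition hashes :: "(nat \<times> nat list) list \<Rightarrow> nat" where
  "hashes gs = sum_list (map fst gs)"

lemma used_subset: "used c gs l \<subseteq> {c..<c + hashes gs}"
  by (induction c gs l rule: used.induct) (auto simp: hashes_def split: if_splits)

lemma finite_used [simp]: "finite (used c gs l)"
  by (rule finite_subset[OF used_subset]) simp

section \<open>Cost and effect of the hashing phase\<close>

lemmas eval_loop_step = wp_While_step[where x = 5 and c = "HashEval 6 3 ;; Binop Plus 4 4 6 ;; incr 3 ;; decr 5", folded eval_loop_def]

text \<open>Each function costs four operations, namely loop test, addition, increment and
  decrement; the evaluation itself is counted in \<open>e\<close>. The size assumptions keep the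
  counters free of wraparound, whereas the sum is wanted modulo the word size anyway.\<close>

lemma eval_loop:
  assumes "\<sigma> 5 = b" "\<sigma> 3 = c" "\<sigma> 4 = v" "\<sigma> 8 = 1" "c + b \<le> num_hash M" "num_hash M < 2 ^ word_len M"
    "v < 2 ^ word_len M"
  shows "wp M eval_loop (\<sigma>, \<mu>) (\<lambda>e d t (\<sigma>', \<mu>'). e = b \<and> d = 0 \<and> t = 4 * b + 1 \<and> \<mu>' = \<mu> \<and>
           \<sigma>' 3 = c + b \<and> \<sigma>' 4 = (v + (\<Sum>h\<in>{c..<c + b}. hash_word M h)) mod 2 ^ word_len M \<and>
           (\<forall>r. r \<notin> {3, 4, 5, 6} \<longrightarrow> \<sigma>' r = \<sigma> r))"
  using assms
proof (induction b arbitrary: \<sigma> c v)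
  case 0
  then show ?case unfolding eval_loop_def by (intro wp_While_0) auto
next
  case (Suc b)
  have 1: "Suc c mod 2 ^ word_len M = Suc c" "(b + 2 ^ word_len M) mod 2 ^ word_len M = b"
    using Suc.prems by auto
  have 2: "(\<Sum>h = c..<c + Suc b. hash_word M h) = hash_word M c + (\<Sum>h = Suc c..<Suc c + b. hash_word M h)"
    by (subst sum.atLeast_Suc_lessThan) auto
  let ?v = "(v + hash_word M c) mod 2 ^ word_len M"
  let ?s = "\<sigma>(6 := hash_word M c, 4 := ?v, 3 := Suc c, 5 := b)"
  have IH: "wp M eval_loop (?s, \<mu>) (\<lambda>e d t (\<sigma>', \<mu>'). e = b \<and> d = 0 \<and> t = 4 * b + 1 \<and> \<mu>' = \<mu> \<and>
           \<sigma>' 3 = Suc c + b \<and> \<sigma>' 4 = (?v + (\<Sum>h\<in>{Suc c..<Suc c + b}. hash_word M h)) mod 2 ^ word_len M \<and>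
           (\<forall>r. r \<notin> {3, 4, 5, 6} \<longrightarrow> \<sigma>' r = ?s r))"
    by (rule Suc.IH) (use Suc.prems in auto)
  have "wp M eval_loop (?s, \<mu>) (\<lambda>e d t (\<sigma>', \<mu>'). Suc e = Suc b \<and> d = 0 \<and> Suc (Suc (Suc (Suc t))) = 4 * Suc b + 1 \<and> \<mu>' = \<mu> \<and>
           \<sigma>' 3 = c + Suc b \<and> \<sigma>' 4 = (v + (\<Sum>h\<in>{c..<c + Suc b}. hash_word M h)) mod 2 ^ word_len M \<and>
           (\<forall>r. r \<notin> {3, 4, 5, 6} \<longrightarrow> \<sigma>' r = \<sigma> r))"
    unfolding 2 by (rule wp_mono[OF IH]) (auto simp: mod_add_left_eq add.assoc)
  then show ?case
    by (intro eval_loop_step) (use Suc.prems 1 in \<open>simp_all del: sum.op_ivl_Suc\<close>)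
qed

definition stored :: "(nat \<Rightarrow> nat) \<Rightarrow> nat \<Rightarrow> nat list \<Rightarrow> bool" where
  "stored \<mu> a xs \<longleftrightarrow> (\<forall>i<length xs. \<mu> (a + i) = xs ! i)"

lemma stored_Nil [simp]: "stored \<mu> a []"
  by (simp add: stored_def)

lemma stored_Cons [simp]: "stored \<mu> a (x # xs) \<longleftrightarrow> \<mu> a = x \<and> stored \<mu> (Suc a) xs"
  by (auto simp: stored_def less_Suc_eq_0_disj nth_Cons')

lemma stored_append [simp]:
  "stored \<mu> a (xs @ ys) \<longleftrightarrow> stored \<mu> a xs \<and> stored \<mu> (a + length xs) ys"
  by (induction xs arbitrary: a) auto

lemma stored_cong:
  "stored \<mu> a xs \<Longrightarrow> (\<And>i. a \<le> i \<Longrightarrow> \<mu>' i = \<mu> i) \<Longrightarrow> stored \<mu>' a xs"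
  by (simp add: stored_def)

lemmas scatter_loop_step = wp_While_step[where x = 5 and
  c = "Load 6 2 ;; incr 2 ;; Load 7 6 ;; Binop Plus 7 7 4 ;; Store 6 7 ;; decr 5",
  folded scatter_loop_def]

text \<open>All targets lie below the stream pointer, so the stores cannot damage the part of the
  stream still to be read. Distinct targets receive \<open>v\<close> exactly once, which permits a
  pointwise description of the final memory.\<close>

lemma scatter_loop:
  assumes "\<sigma> 5 = length ds" "\<sigma> 2 = sp" "\<sigma> 4 = v" "\<sigma> 8 = 1"
    "stored \<mu> sp (map ((+) 11) ds)" "distinct ds" "\<forall>d\<in>set ds. 11 + d < sp"
    "sp + length ds \<le> mem_size M" "mem_size M < 2 ^ word_len M"
  shows "wp M scatter_loop (\<sigma>, \<mu>) (\<lambda>e d t (\<sigma>', \<mu>'). e = 0 \<and> d = 0 \<and> t = 7 * length ds + 1 \<and>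
           \<sigma>' 2 = sp + length ds \<and>
           \<mu>' = (\<lambda>a. if a \<in> (+) 11 ` set ds then (\<mu> a + v) mod 2 ^ word_len M else \<mu> a) \<and>
           (\<forall>r. r \<notin> {2, 5, 6, 7} \<longrightarrow> \<sigma>' r = \<sigma> r))"
  using assms
proof (induction ds arbitrary: \<sigma> \<mu> sp)
  case Nil
  then show ?case unfolding scatter_loop_def by (intro wp_While_0) auto
next
  case (Cons d ds)
  let ?N = "2 ^ word_len M"
  have 1: "Suc sp mod ?N = Suc sp" "(length ds + ?N) mod ?N = length ds"
    using Cons.prems by auto
  have 2: "\<mu> sp = 11 + d" "11 + d < mem_size M" "sp < mem_size M"
    using Cons.prems by auto
  let ?\<mu> = "\<mu>(11 + d := (\<mu> (11 + d) + v) mod ?N)"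
  let ?s = "\<sigma>(6 := 11 + d, 2 := Suc sp, 7 := (\<mu> (11 + d) + v) mod ?N, 5 := length ds)"
  have st: "stored ?\<mu> (Suc sp) (map ((+) 11) ds)"
    by (rule stored_cong[of \<mu>]) (use Cons.prems in auto)
  have IH: "wp M scatter_loop (?s, ?\<mu>) (\<lambda>e d t (\<sigma>', \<mu>'). e = 0 \<and> d = 0 \<and> t = 7 * length ds + 1 \<and>
           \<sigma>' 2 = Suc sp + length ds \<and>
           \<mu>' = (\<lambda>a. if a \<in> (+) 11 ` set ds then (?\<mu> a + v) mod 2 ^ word_len M else ?\<mu> a) \<and>
           (\<forall>r. r \<notin> {2, 5, 6, 7} \<longrightarrow> \<sigma>' r = ?s r))"
  proof (rule Cons.IH)
    show "stored ?\<mu> (Suc sp) (map ((+) 11) ds)" by (rule st)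
  qed (use Cons.prems in auto)
  have "wp M scatter_loop (?s, ?\<mu>) (\<lambda>e d' t (\<sigma>', \<mu>'). e = 0 \<and> d' = 0 \<and>
           t + 7 = 7 * length (d # ds) + 1 \<and> \<sigma>' 2 = sp + length (d # ds) \<and>
           \<mu>' = (\<lambda>a. if a \<in> (+) 11 ` set (d # ds) then (\<mu> a + v) mod 2 ^ word_len M else \<mu> a) \<and>
           (\<forall>r. r \<notin> {2, 5, 6, 7} \<longrightarrow> \<sigma>' r = \<sigma> r))"
    by (rule wp_mono[OF IH]) (use Cons.prems in \<open>auto simp: fun_eq_iff\<close>)
  then show ?case
    by (intro scatter_loop_step) (use Cons.prems 1 2 in \<open>auto elim!: wp_mono\<close>)
qed

lemma encode_Nil [simp]: "encode [] = []"
  by (simp add: encode_def)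

lemma encode_Cons [simp]: "encode ((b, ds) # gs) = b # length ds # map ((+) 11) ds @ encode gs"
  by (simp add: encode_def)

lemma hashes_Nil [simp]: "hashes [] = 0"
  by (simp add: hashes_def)

lemma hashes_Cons [simp]: "hashes ((b, ds) # gs) = b + hashes gs"
  by (simp add: hashes_def)

lemma length_le_encode: "2 * length gs \<le> length (encode gs)"
  by (induction gs) auto

definition wf_groups :: "nat \<Rightarrow> (nat \<times> nat list) list \<Rightarrow> bool" where
  "wf_groups m gs \<longleftrightarrow> (\<forall>(b, ds)\<in>set gs. distinct ds \<and> set ds \<subseteq> {..<m})"

lemmas hash_phase_step = wp_While_step[where x = 1 and
  c = "Const 4 0 ;; Load 5 2 ;; incr 2 ;; eval_loop ;; Load 5 2 ;; incr 2 ;; scatter_loop ;; decr 1",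
  folded hash_phase_def]

text \<open>Time is charged to the encoding: besides 4 operations per function and 7 per target a
  group costs 9, for which its two leading words pay 14. Only the cells of the partial keys change,
  so header, stream and tables survive.\<close>

lemma hash_phase:
  assumes "\<sigma> 1 = length gs" "\<sigma> 2 = sp" "\<sigma> 3 = c" "\<sigma> 8 = 1"
    "stored \<mu> sp (encode gs)" "wf_groups m gs" "11 + m \<le> sp"
    "sp + length (encode gs) \<le> mem_size M" "mem_size M < 2 ^ word_len M"
    "c + hashes gs \<le> num_hash M" "num_hash M < 2 ^ word_len M"
    "\<forall>l<m. \<mu> (11 + l) < 2 ^ word_len M"
  shows "wp M hash_phase (\<sigma>, \<mu>) (\<lambda>e d t (\<sigma>', \<mu>'). e = hashes gs \<and> d = 0 \<and>
           t \<le> 7 * length (encode gs) + 4 * hashes gs + 1 \<and>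
           (\<forall>l<m. \<mu>' (11 + l) = (\<mu> (11 + l) + (\<Sum>h\<in>used c gs l. hash_word M h)) mod 2 ^ word_len M) \<and>
           (\<forall>a. a \<notin> {11..<11 + m} \<longrightarrow> \<mu>' a = \<mu> a) \<and>
           (\<forall>r. r \<notin> {1, 2, 3, 4, 5, 6, 7} \<longrightarrow> \<sigma>' r = \<sigma> r))"
  using assms
proof (induction gs arbitrary: \<sigma> \<mu> sp c)
  case Nil
  then show ?case unfolding hash_phase_def by (intro wp_While_0) auto
next
  case (Cons g gs)
  obtain b ds where g: "g = (b, ds)" by (cases g)
  let ?N = "2 ^ word_len M"
  note prems = Cons.prems[unfolded g]
  have ds: "distinct ds" "set ds \<subseteq> {..<m}" and wf: "wf_groups m gs"
    using prems by (auto simp: wf_groups_def)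
  have st: "\<mu> sp = b" "\<mu> (Suc sp) = length ds" "stored \<mu> (sp + 2) (map ((+) 11) ds)"
      "stored \<mu> (sp + 2 + length ds) (encode gs)"
    using prems by (auto)
  have bd: "sp + 2 + length ds + length (encode gs) \<le> mem_size M"
    using prems by simp
  have m1: "Suc sp mod ?N = Suc sp" "Suc (Suc sp) mod ?N = Suc (Suc sp)"
      "(length gs + ?N) mod ?N = length gs"
    using prems bd length_le_encode[of gs] by auto
  have ev: "wp M eval_loop (\<sigma>(4 := 0, 5 := b, 2 := Suc sp), \<mu>)
      (\<lambda>e d t (\<sigma>', \<mu>'). e = b \<and> d = 0 \<and> t = 4 * b + 1 \<and> \<mu>' = \<mu> \<and>
           \<sigma>' 3 = c + b \<and> \<sigma>' 4 = (0 + (\<Sum>h\<in>{c..<c + b}. hash_word M h)) mod 2 ^ word_len M \<and>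
           (\<forall>r. r \<notin> {3, 4, 5, 6} \<longrightarrow> \<sigma>' r = (\<sigma>(4 := 0, 5 := b, 2 := Suc sp)) r))"
    by (rule eval_loop) (use prems in auto)
  let ?v = "(\<Sum>h\<in>{c..<c + b}. hash_word M h) mod ?N"
  let ?\<mu> = "\<lambda>a. if a \<in> (+) 11 ` set ds then (\<mu> a + ?v) mod ?N else \<mu> a"
  have sc: "wp M scatter_loop (\<sigma>1(5 := length ds, 2 := Suc (Suc sp)), \<mu>)
      (\<lambda>e d t (\<sigma>', \<mu>'). e = 0 \<and> d = 0 \<and> t = 7 * length ds + 1 \<and>
           \<sigma>' 2 = sp + 2 + length ds \<and> \<mu>' = ?\<mu> \<and>
           (\<forall>r. r \<notin> {2, 5, 6, 7} \<longrightarrow> \<sigma>' r = \<sigma>1 r))"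
    if "\<sigma>1 4 = ?v" "\<sigma>1 8 = 1" for \<sigma>1
    by (rule wp_mono[OF scatter_loop[where sp = "Suc (Suc sp)" and v = ?v and ds = ds]])
       (use that st ds prems in \<open>auto\<close>)
  have IH: "wp M hash_phase (\<sigma>2, ?\<mu>) (\<lambda>e d t (\<sigma>', \<mu>'). e = hashes gs \<and> d = 0 \<and>
           t \<le> 7 * length (encode gs) + 4 * hashes gs + 1 \<and>
           (\<forall>l<m. \<mu>' (11 + l) = (?\<mu> (11 + l) + (\<Sum>h\<in>used (c + b) gs l. hash_word M h)) mod 2 ^ word_len M) \<and>
           (\<forall>a. a \<notin> {11..<11 + m} \<longrightarrow> \<mu>' a = ?\<mu> a) \<and>
           (\<forall>r. r \<notin> {1, 2, 3, 4, 5, 6, 7} \<longrightarrow> \<sigma>' r = \<sigma>2 r))"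
    if "\<sigma>2 1 = length gs" "\<sigma>2 2 = sp + 2 + length ds" "\<sigma>2 3 = c + b" "\<sigma>2 8 = 1" for \<sigma>2
  proof (rule Cons.IH[OF that])
    show "stored ?\<mu> (sp + 2 + length ds) (encode gs)"
      by (rule stored_cong[OF st(4)]) (use prems ds in auto)
  qed (use prems wf bd in auto)
  \<comment> \<open>Later groups only use functions numbered from \<open>c + b\<close> on, so their
    contribution is disjoint from that of the current group and the two sums add up.\<close>
  have sum: "(?\<mu> (11 + l) + (\<Sum>h\<in>used (c + b) gs l. hash_word M h)) mod ?N =
        (\<mu> (11 + l) + (\<Sum>h\<in>used c (g # gs) l. hash_word M h)) mod ?N" if "l < m" for l
  proof (cases "l \<in> set ds")
    case True
    have "{c..<c + b} \<inter> used (c + b) gs l = {}"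
      using used_subset[of "c + b" gs l] by auto
    then have "(\<Sum>h\<in>used c (g # gs) l. hash_word M h) =
        (\<Sum>h\<in>{c..<c + b}. hash_word M h) + (\<Sum>h\<in>used (c + b) gs l. hash_word M h)"
      using True by (simp add: g sum.union_disjoint)
    with True show ?thesis by (simp add: mod_simps ac_simps)
  next
    case False
    then show ?thesis by (auto simp: g)
  qed
  have fr: "?\<mu> a = \<mu> a" if "a \<notin> {11..<11 + m}" for a
    using that ds by auto
  have IH': "wp M hash_phase (\<sigma>2, ?\<mu>) (\<lambda>e d t (\<sigma>', \<mu>'). b + e = hashes (g # gs) \<and> d = 0 \<and>
           4 * b + (7 * length ds + t) + 9 \<le> 7 * length (encode (g # gs)) + 4 * hashes (g # gs) + 1 \<and>
           (\<forall>l<m. \<mu>' (11 + l) =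
              (\<mu> (11 + l) + (\<Sum>h\<in>used c (g # gs) l. hash_word M h)) mod 2 ^ word_len M) \<and>
           (\<forall>a. a \<notin> {11..<11 + m} \<longrightarrow> \<mu>' a = \<mu> a) \<and>
           (\<forall>r. r \<notin> {1, 2, 3, 4, 5, 6, 7} \<longrightarrow> \<sigma>' r = \<sigma> r))"
    if "\<sigma>2 1 = length gs" "\<sigma>2 2 = sp + 2 + length ds" "\<sigma>2 3 = c + b" "\<sigma>2 8 = 1"
      "\<forall>r. r \<notin> {1, 2, 3, 4, 5, 6, 7} \<longrightarrow> \<sigma>2 r = \<sigma> r" for \<sigma>2
  proof (rule wp_mono[OF IH[OF that(1-4)]], clarify, intro conjI)
    fix \<mu>' :: "nat \<Rightarrow> nat"
    assume *: "\<forall>l<m. \<mu>' (11 + l) = (?\<mu> (11 + l) + (\<Sum>h\<in>used (c + b) gs l. hash_word M h)) mod ?N"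
    show "\<forall>l<m. \<mu>' (11 + l) =
              (\<mu> (11 + l) + (\<Sum>h\<in>used c (g # gs) l. hash_word M h)) mod 2 ^ word_len M"
      using * sum by simp
  next
    fix \<mu>' :: "nat \<Rightarrow> nat"
    assume "\<forall>a. a \<notin> {11..<11 + m} \<longrightarrow> \<mu>' a = ?\<mu> a"
    then show "\<forall>a. a \<notin> {11..<11 + m} \<longrightarrow> \<mu>' a = \<mu> a"
      using fr by simp
  qed (use that(5) in \<open>simp_all add: g\<close>)
  show ?case
    apply (rule hash_phase_step)
     apply (use prems in simp)
    apply (simp add: st m1 prems)
    apply (rule conjI, use prems in simp)
    apply (rule wp_mono[OF ev], clarify)
    apply (simp add: st m1 prems)
    apply (rule conjI, use prems in simp)
    apply (rule wp_mono[OF sc], simp, use prems in simp, clarify)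
    apply (simp add: st m1 prems)
    apply (rule wp_mono[OF IH'])
    apply (use prems m1 in simp_all)
    done
qed

section \<open>Bucket lists and the probing loops\<close>

definition chain :: "nat \<Rightarrow> (nat \<Rightarrow> nat) \<Rightarrow> nat \<Rightarrow> nat \<Rightarrow> nat list" where
  "chain n kk b s = filter (\<lambda>p. kk p mod n = b) [s..<n]"

text \<open>A bucket lists its points by increasing index, so its remainder from \<open>s\<close> on
  depends on \<open>s\<close> alone and pointers have a closed form; no insertion procedure has to
  be modelled. The index is stored plus one to leave 0 for the end of the list.\<close>

definition link :: "nat \<Rightarrow> (nat \<Rightarrow> nat) \<Rightarrow> nat \<Rightarrow> nat \<Rightarrow> nat" where
  "link n kk b s = (case chain n kk b s of [] \<Rightarrow> 0 | p # _ \<Rightarrow> Suc p)"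

lemma chain_eq_Cons:
  assumes "chain n kk b s = p # ps"
  shows "p < n" "kk p mod n = b" "chain n kk b (Suc p) = ps"
proof -
  from assms obtain us vs where *: "[s..<n] = us @ p # vs" "kk p mod n = b"
      "ps = filter (\<lambda>p. kk p mod n = b) vs"
    unfolding chain_def by (auto dest!: filter_eq_ConsD)
  then have "p \<in> set [s..<n]" by simp
  then show "p < n" by simp
  have len: "length us < n - s"
    using arg_cong[OF *(1), of length] by simp
  then have p: "p = s + length us"
    using arg_cong[OF *(1), of "\<lambda>l. l ! length us"] by simp
  have "vs = drop (Suc (length us)) [s..<n]" by (simp add: *(1))
  also have "\<dots> = [Suc p..<n]" by (simp add: p)
  finally show "chain n kk b (Suc p) = ps" using *(3) by (simp add: chain_def)
  show "kk p mod n = b" by fact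
qed

text \<open>Bucket heads and point entries share one array of \<open>n + 1\<close> triples. Shifting
  the point entries by one lets a pointer \<open>Suc p\<close> serve directly as the number of its
  triple.\<close>

definition table_at :: "(nat \<Rightarrow> nat) \<Rightarrow> nat \<Rightarrow> nat \<Rightarrow> (nat \<Rightarrow> nat) \<Rightarrow> bool" where
  "table_at \<mu> a n kk \<longleftrightarrow>
     (\<forall>b<n. \<mu> (a + 3 * b) = link n kk b 0) \<and>
     (\<forall>p<n. \<mu> (a + 3 * Suc p + 1) = kk p \<and> \<mu> (a + 3 * Suc p + 2) = link n kk (kk p mod n) (Suc p))"

text \<open>
  The state consists of the two budgets and the answer. Finding a good point sets the list
  step budget to \<open>0\<close>, which turns the rest of the query into a no-op.
\<close>

fun visit :: "(nat \<Rightarrow> bool) \<Rightarrow> bool \<times> nat \<Rightarrow> nat \<times> nat \<times> nat \<Rightarrow> nat \<times> nat \<times> nat" where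
  "visit good (match, p) (wb, db, out) =
     (if wb = 0 then (wb, db, out)
      else if match \<and> db \<noteq> 0 then
        (if good p then (0, db - 1, p) else (wb - 1, db - 1, out))
      else (wb - 1, db, out))"

definition bucket :: "nat \<Rightarrow> (nat \<Rightarrow> nat) \<Rightarrow> nat \<Rightarrow> (bool \<times> nat) list" where
  "bucket n kk key = map (\<lambda>p. (kk p = key, p)) (chain n kk (key mod n) 0)"

lemma fold_visit_0: "fold (visit good) xs (0, db, out) = (0, db, out)"
  by (induction xs) auto

lemmas scan_loop_step = wp_While_step[where x = 19 and
  c = "Cond 12
       (decr 12 ;; Binop Times 6 19 22 ;; Binop Plus 6 6 14 ;; incr 6 ;; Load 7 6 ;;
        Binop Equal 7 7 18 ;;
        Cond 7
          (Cond 13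
            (decr 13 ;; Binop Minus 7 19 8 ;; DistTest 5 7 ;;
             Cond 5 (Binop Minus 0 19 8 ;; Const 12 0) Skip)
            Skip)
          Skip ;;
        incr 6 ;; Load 19 6)
       (Const 19 0)",
  folded scan_loop_def]

lemma mod_pred:
  fixes a N :: nat
  assumes "0 < a" "a < N"
  shows "(a + N - Suc 0) mod N = a - Suc 0"
proof -
  have "a + N - Suc 0 = (a - Suc 0) + N" using assms by simp
  then have "(a + N - Suc 0) mod N = ((a - Suc 0) + N) mod N" by (rule arg_cong)
  also have "\<dots> = (a - Suc 0) mod N" by (rule mod_add_self2)
  also have "\<dots> = a - Suc 0" using assms by (intro mod_less) auto
  finally show ?thesis .
qed

text \<open>The list step budget is the potential of an amortized time bound: an entry costs at most
  17 operations and lowers register 12 by at least one, which pays for 20; the additive 5 covers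
  leaving the loop, also with an empty budget. Distance computations are accounted for exactly by
  the decrease of register 13. The functional part refines the loop to a fold of
  \<open>visit\<close>.\<close>

lemma scan_loop:
  assumes "\<sigma> 19 = link n kk b s" "\<sigma> 12 = wb" "\<sigma> 13 = db" "\<sigma> 0 = out" "\<sigma> 14 = tp" "\<sigma> 18 = key"
    "\<sigma> 22 = 3" "\<sigma> 8 = 1" "table_at \<mu> tp n kk"
    "tp + 3 * (n + 1) \<le> mem_size M" "mem_size M < 2 ^ word_len M"
    "wb < 2 ^ word_len M" "db < 2 ^ word_len M" "num_points M = n"
  shows "wp M scan_loop (\<sigma>, \<mu>) (\<lambda>e d t (\<sigma>', \<mu>'). e = 0 \<and> \<mu>' = \<mu> \<and> d + \<sigma>' 13 = db \<and>
           t + 20 * \<sigma>' 12 \<le> 20 * wb + 5 \<and>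
           (\<sigma>' 12, \<sigma>' 13, \<sigma>' 0) =
             fold (visit (dist_less M)) (map (\<lambda>p. (kk p = key, p)) (chain n kk b s)) (wb, db, out) \<and>
           (\<forall>r. r \<notin> {0, 5, 6, 7, 12, 13, 19} \<longrightarrow> \<sigma>' r = \<sigma> r))"
  using assms
proof (induction "chain n kk b s" arbitrary: \<sigma> s wb db out)
  case Nil
  then show ?case unfolding scan_loop_def
    by (intro wp_While_0) (simp_all add: link_def flip: Nil(1))
next
  case (Cons p ps)
  let ?N = "2 ^ word_len M"
  note ch = chain_eq_Cons[OF Cons(2)[symmetric]]
  have p: "\<sigma> 19 = Suc p" using Cons.prems Cons(2)[symmetric] by (simp add: link_def)
  show ?case
  proof (cases "wb = 0")
    case True
    have "wp M scan_loop (\<sigma>(19 := 0), \<mu>) (\<lambda>e d t (\<sigma>', \<mu>').  e = 0 \<and> \<mu>' = \<mu> \<and> d + \<sigma>' 13 = db \<and>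
           t + 3 + 20 * \<sigma>' 12 \<le> 20 * wb + 5 \<and>
           (\<sigma>' 12, \<sigma>' 13, \<sigma>' 0) =
             fold (visit (dist_less M)) (map (\<lambda>p. (kk p = key, p)) (chain n kk b s)) (wb, db, out) \<and>
           (\<forall>r. r \<notin> {0, 5, 6, 7, 12, 13, 19} \<longrightarrow> \<sigma>' r = \<sigma> r))"
      unfolding scan_loop_def by (rule wp_While_0) (use Cons.prems True in \<open>auto simp: fold_visit_0\<close>)
    then show ?thesis
      by (intro scan_loop_step) (use p Cons.prems True in \<open>auto elim!: wp_mono\<close>)
  next
    case False
    have pn: "p < n" by (rule ch)
    have ld: "\<mu> (tp + 3 * Suc p + 1) = kk p" "\<mu> (tp + 3 * Suc p + 2) = link n kk b (Suc p)"
      using Cons.prems(9) ch unfolding table_at_def by auto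
    have lds: "\<mu> (4 + (p * 3 + tp)) = kk p"
       "\<mu> (5 + (p * 3 + tp)) = link n kk b (Suc p)"
      using ld by (simp_all add: algebra_simps)
    have lt: "5 + (p * 3 + tp) < mem_size M"
      using pn Cons.prems(10) by simp
    have N: "(3 :: nat) < ?N" using lt Cons.prems(11) by simp
    have m: "(3 + p * 3) mod ?N = 3 + p * 3" "(3 + p * 3 + tp) mod ?N = 3 + p * 3 + tp"
      "(4 + (p * 3 + tp)) mod ?N = 4 + (p * 3 + tp)"
      "(5 + (p * 3 + tp)) mod ?N = 5 + (p * 3 + tp)"
      "p mod ?N = p"
      using lt Cons.prems(11) by auto
    have w: "(wb + ?N - Suc 0) mod ?N = wb - Suc 0"
      by (rule mod_pred) (use False Cons.prems in auto)
    have d: "db \<noteq> 0 \<Longrightarrow> (db + ?N - Suc 0) mod ?N = db - Suc 0"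
      by (rule mod_pred) (use Cons.prems in auto)
    \<comment> \<open>One continuation for all four outcomes of the loop body; \<open>dd\<close> is
      the number of distance computations made at the current entry.\<close>
    have IH: "wp M scan_loop (\<sigma>1, \<mu>) (\<lambda>e d t (\<sigma>', \<mu>'). e = 0 \<and> \<mu>' = \<mu> \<and> d + dd + \<sigma>' 13 = db \<and>
           t + 17 + 20 * \<sigma>' 12 \<le> 20 * wb + 5 \<and>
           (\<sigma>' 12, \<sigma>' 13, \<sigma>' 0) =
             fold (visit (dist_less M)) (map (\<lambda>p. (kk p = key, p)) (chain n kk b s)) (wb, db, out) \<and>
           (\<forall>r. r \<notin> {0, 5, 6, 7, 12, 13, 19} \<longrightarrow> \<sigma>' r = \<sigma> r))"
      if "\<sigma>1 19 = link n kk b (Suc p)"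
        "(\<sigma>1 12, \<sigma>1 13, \<sigma>1 0) = visit (dist_less M) (kk p = key, p) (wb, db, out)"
        "\<forall>r. r \<notin> {0, 5, 6, 7, 12, 13, 19} \<longrightarrow> \<sigma>1 r = \<sigma> r"
        "\<sigma>1 13 + dd = db" for \<sigma>1 dd
    proof -
      have v: "\<sigma>1 12 < wb" "\<sigma>1 13 \<le> db"
        using that(2) False by (auto split: if_splits)
      have f: "fold (visit (dist_less M)) (map (\<lambda>p. (kk p = key, p)) (chain n kk b s)) (wb, db, out) =
         fold (visit (dist_less M)) (map (\<lambda>p. (kk p = key, p)) (chain n kk b (Suc p))) (\<sigma>1 12, \<sigma>1 13, \<sigma>1 0)"
        using that(2) Cons(2)[symmetric] ch(3) by simp
      have r: "\<sigma>1 14 = tp" "\<sigma>1 18 = key" "\<sigma>1 22 = 3" "\<sigma>1 8 = 1"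
        using that(3) Cons.prems by simp_all
      show ?thesis unfolding f
      proof (rule wp_mono[OF Cons.hyps(1)[of "Suc p" \<sigma>1 "\<sigma>1 12" "\<sigma>1 13" "\<sigma>1 0"]], goal_cases)
        case (16 e d t s')
        obtain \<sigma>' \<mu>' where s': "s' = (\<sigma>', \<mu>')" by (cases s')
        have "\<sigma>' r = \<sigma> r" if "r \<notin> {0, 5, 6, 7, 12, 13, 19}" for r
          using 16 that \<open>\<forall>r. r \<notin> {0, 5, 6, 7, 12, 13, 19} \<longrightarrow> \<sigma>1 r = \<sigma> r\<close> by (simp add: s')
        moreover have "20 * \<sigma>1 12 + 20 \<le> 20 * wb" using v by simp
        ultimately show ?case using 16 that(4) by (simp add: s')
      qed (use ch that(1) r Cons.prems v in simp_all)
    qed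
    note simps = p Cons.prems False m lds lt w d fun_upd_def[symmetric]
    have bd: "4 + (p * 3 + tp) < mem_size M" "p < num_points M" "0 < wb"
        "0 < word_len M"
      using lt pn Cons.prems False N by (auto intro!: gr0I)
    show ?thesis
    proof (cases "kk p = key \<and> db \<noteq> 0")
      case match: True
      show ?thesis
      proof (cases "dist_less M p")
        case True
        show ?thesis
          apply (rule scan_loop_step)
           apply (simp add: p)
          using match True bd apply (simp add: simps del: visit.simps)
          apply (rule wp_mono[OF IH[of _ 1]])
          apply (simp_all add: simps)
          apply (auto)
          done
      next
        case False
        show ?thesis
          apply (rule scan_loop_step)
           apply (simp add: p)
          using match False bd apply (simp add: simps del: visit.simps)
          apply (rule wp_mono[OF IH[of _ 1]])
          apply (simp_all add: simps)
          apply (auto)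
          done
      qed
    next
      case nomatch: False
      show ?thesis
      proof (cases "kk p = key")
        case True
        show ?thesis
          apply (rule scan_loop_step)
           apply (simp add: p)
          using nomatch True bd apply (simp add: simps del: visit.simps)
          apply (rule wp_mono[OF IH[of _ 0]])
          apply (simp_all add: simps)
          apply (auto)
          done
      next
        case False
        show ?thesis
          apply (rule scan_loop_step)
           apply (simp add: p)
          using False bd apply (simp add: simps del: visit.simps)
          apply (rule wp_mono[OF IH[of _ 0]])
          apply (simp_all add: simps)
          apply (auto)
          done
      qed
    qed
  qed
qed

lemma fold_visit_le: "(wb', db', out') = fold (visit good) xs (wb, db, out) \<Longrightarrow> wb' \<le> wb"
proof (induction xs arbitrary: wb db out)
  case (Cons x xs)
  obtain wb1 db1 out1 where v: "visit good x (wb, db, out) = (wb1, db1, out1)"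
    by (metis prod_cases3)
  have "wb1 \<le> wb" using v by (cases x) (auto split: if_splits)
  with Cons.IH[of wb1 db1 out1] Cons.prems v show ?case by simp
qed simp

lemmas table_loop_step = wp_While_step[where x = 17 and
  c = "Load 7 16 ;; Binop Plus 18 20 7 ;; Binop Mod 7 18 11 ;; Binop Times 7 7 22 ;;
      Binop Plus 7 7 14 ;; Load 19 7 ;; scan_loop ;; Binop Plus 14 14 21 ;; incr 16 ;; decr 17",
  folded table_loop_def]

text \<open>A table adds 10 operations to the 5 left over by \<open>scan_loop\<close>, hence the 15.
  The key is one addition of the fixed left partial key and the next right one; reduced modulo
  \<open>n\<close> it selects the bucket.\<close>

lemma table_loop:
  assumes "\<sigma> 17 = r" "\<sigma> 16 = jp" "\<sigma> 14 = tp" "\<sigma> 20 = u" "\<sigma> 12 = wb" "\<sigma> 13 = db" "\<sigma> 0 = out"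
    "\<sigma> 22 = 3" "\<sigma> 8 = 1" "\<sigma> 11 = n" "\<sigma> 21 = 3 * (n + 1)"
    "\<forall>j<r. \<mu> (jp + j) = v j" "\<forall>j<r. table_at \<mu> (tp + j * (3 * (n + 1))) n (kk j)"
    "jp + r \<le> mem_size M" "tp + r * (3 * (n + 1)) \<le> mem_size M" "mem_size M < 2 ^ word_len M"
    "wb < 2 ^ word_len M" "db < 2 ^ word_len M" "num_points M = n" "0 < n"
  shows "wp M table_loop (\<sigma>, \<mu>) (\<lambda>e d t (\<sigma>', \<mu>'). e = 0 \<and> \<mu>' = \<mu> \<and> d + \<sigma>' 13 = db \<and>
           t + 20 * \<sigma>' 12 \<le> 20 * wb + 15 * r + 1 \<and> \<sigma>' 14 = tp + r * (3 * (n + 1)) \<and>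
           (\<sigma>' 12, \<sigma>' 13, \<sigma>' 0) =
             fold (visit (dist_less M))
               (concat (map (\<lambda>j. bucket n (kk j) ((u + v j) mod 2 ^ word_len M)) [0..<r])) (wb, db, out) \<and>
           (\<forall>r. r \<notin> {0, 5, 6, 7, 12, 13, 14, 16, 17, 18, 19} \<longrightarrow> \<sigma>' r = \<sigma> r))"
  using assms
proof (induction r arbitrary: \<sigma> jp tp wb db out v kk)
  case 0
  then show ?case unfolding table_loop_def by (intro wp_While_0) auto
next
  case (Suc r)
  let ?N = "2 ^ word_len M" and ?L = "3 * (n + 1)"
  define k where "k = (u + v 0) mod ?N"
  define b where "b = k mod n"
  have jp: "\<mu> jp = v 0" "jp < mem_size M" using Suc.prems(12,14) by auto
  have tb: "table_at \<mu> tp n (kk 0)" using Suc.prems(13) by auto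
  have tp: "tp + ?L + r * ?L \<le> mem_size M" using Suc.prems(15) by (simp add: algebra_simps)
  have tp': "tp + ?L \<le> mem_size M" by (rule add_leD1[OF tp])
  have b: "b < n" using \<open>0 < n\<close> by (simp add: b_def)
  have b3: "b * 3 + 3 \<le> n * 3" using b by simp
  have "tp + b * 3 < mem_size M" using b3 tp by (simp add: algebra_simps)
  then have lt: "b * 3 + tp < mem_size M" by simp
  have md: "b mod ?N = b" "(b * 3) mod ?N = b * 3" "(b * 3 + tp) mod ?N = b * 3 + tp"
     "(tp + ?L) mod ?N = tp + ?L" "Suc jp mod ?N = Suc jp" "(r + ?N) mod ?N = r"
    using lt tp Suc.prems(14,16) by (auto simp: algebra_simps)
  have hd: "\<mu> (b * 3 + tp) = link n (kk 0) b 0"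
    using tb b unfolding table_at_def by (simp add: mult.commute add.commute)
  have sl: "wp M scan_loop (\<sigma>1, \<mu>) (\<lambda>e d t (\<sigma>', \<mu>'). e = 0 \<and> \<mu>' = \<mu> \<and> d + \<sigma>' 13 = db \<and>
           t + 20 * \<sigma>' 12 \<le> 20 * wb + 5 \<and>
           (\<sigma>' 12, \<sigma>' 13, \<sigma>' 0) = fold (visit (dist_less M)) (bucket n (kk 0) k) (wb, db, out) \<and>
           (\<forall>r. r \<notin> {0, 5, 6, 7, 12, 13, 19} \<longrightarrow> \<sigma>' r = \<sigma>1 r))"
    if "\<sigma>1 19 = link n (kk 0) b 0" "\<sigma>1 18 = k"
      "\<sigma>1 12 = wb" "\<sigma>1 13 = db" "\<sigma>1 0 = out" "\<sigma>1 14 = tp" "\<sigma>1 22 = 3" "\<sigma>1 8 = 1" for \<sigma>1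
    unfolding bucket_def b_def[symmetric]
    by (rule scan_loop) (use that Suc.prems(16-20) tb tp' in simp_all)
  have IH: "wp M table_loop (\<sigma>2, \<mu>) (\<lambda>e d t (\<sigma>', \<mu>'). e = 0 \<and> \<mu>' = \<mu> \<and> d + dd + \<sigma>' 13 = db \<and>
           t + (tt + 10) + 20 * \<sigma>' 12 \<le> 20 * wb + 15 * Suc r + 1 \<and> \<sigma>' 14 = tp + Suc r * ?L \<and>
           (\<sigma>' 12, \<sigma>' 13, \<sigma>' 0) =
             fold (visit (dist_less M))
               (concat (map (\<lambda>j. bucket n (kk j) ((u + v j) mod 2 ^ word_len M)) [0..<Suc r])) (wb, db, out) \<and>
           (\<forall>r. r \<notin> {0, 5, 6, 7, 12, 13, 14, 16, 17, 18, 19} \<longrightarrow> \<sigma>' r = \<sigma> r))"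
    if *: "dd + \<sigma>2 13 = db" "tt + 20 * \<sigma>2 12 \<le> 20 * wb + 5" "\<sigma>2 17 = r" "\<sigma>2 16 = Suc jp"
      "\<sigma>2 14 = tp + ?L"
      "(\<sigma>2 12, \<sigma>2 13, \<sigma>2 0) = fold (visit (dist_less M)) (bucket n (kk 0) k) (wb, db, out)"
      "\<forall>r. r \<notin> {0, 5, 6, 7, 12, 13, 14, 16, 17, 18, 19} \<longrightarrow> \<sigma>2 r = \<sigma> r" for \<sigma>2 dd tt
  proof -
    have f: "fold (visit (dist_less M))
               (concat (map (\<lambda>j. bucket n (kk j) ((u + v j) mod ?N)) [0..<Suc r])) (wb, db, out) =
      fold (visit (dist_less M))
               (concat (map (\<lambda>j. bucket n (kk (Suc j)) ((u + v (Suc j)) mod ?N)) [0..<r])) (\<sigma>2 12, \<sigma>2 13, \<sigma>2 0)"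
      unfolding *(6) k_def by (subst map_upt_Suc) simp
    have g: "\<sigma>2 20 = u" "\<sigma>2 22 = 3" "\<sigma>2 8 = 1" "\<sigma>2 11 = n" "\<sigma>2 21 = ?L"
      using *(7) Suc.prems by simp_all
    have v: "\<forall>j<r. \<mu> (Suc jp + j) = v (Suc j)" using Suc.prems(12) by auto
    have t: "\<forall>j<r. table_at \<mu> (tp + ?L + j * ?L) n (kk (Suc j))"
      using Suc.prems(13) by (auto simp: add.assoc)
    have wd: "\<sigma>2 12 < ?N" "\<sigma>2 13 < ?N" using * Suc.prems(17,18) by auto
    show ?thesis unfolding f
    proof (rule wp_mono[OF Suc.IH[OF *(3-5) g(1) refl refl refl g(2-5) v t _ _ _ wd]], goal_cases)
      case (6 e d t s')
      obtain \<sigma>' \<mu>' where s': "s' = (\<sigma>', \<mu>')" by (cases s')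
      have "\<sigma>' r = \<sigma> r" if "r \<notin> {0, 5, 6, 7, 12, 13, 14, 16, 17, 18, 19}" for r
        using 6 that *(7) by (simp add: s')
      then show ?case using 6 *(1,2) by (simp add: s' algebra_simps)
    qed (use Suc.prems tp in simp_all)
  qed
  show ?case
    apply (rule table_loop_step)
     apply (use Suc.prems in simp)
    apply (simp add: Suc.prems jp md hd lt del: upt_Suc flip: k_def b_def)
  proof (rule wp_mono[OF sl], goal_cases)
    case (9 e d t s1)
    obtain \<sigma>1 \<mu>1 where s1: "s1 = (\<sigma>1, \<mu>1)" by (cases s1)
    note h = 9[unfolded s1 prod.case]
    have r: "\<sigma>1 8 = 1" "\<sigma>1 14 = tp" "\<sigma>1 16 = jp" "\<sigma>1 17 = Suc r" "\<sigma>1 21 = ?L"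
      using h Suc.prems by simp_all
    have "wp M table_loop (\<sigma>1(14 := tp + ?L, 16 := Suc jp, 17 := r), \<mu>) (\<lambda>e' d' t' (\<sigma>', \<mu>').
           e' = 0 \<and> \<mu>' = \<mu> \<and> d' + d + \<sigma>' 13 = db \<and>
           t' + (t + 10) + 20 * \<sigma>' 12 \<le> 20 * wb + 15 * Suc r + 1 \<and> \<sigma>' 14 = tp + Suc r * ?L \<and>
           (\<sigma>' 12, \<sigma>' 13, \<sigma>' 0) =
             fold (visit (dist_less M))
               (concat (map (\<lambda>j. bucket n (kk j) ((u + v j) mod 2 ^ word_len M)) [0..<Suc r])) (wb, db, out) \<and>
           (\<forall>r. r \<notin> {0, 5, 6, 7, 12, 13, 14, 16, 17, 18, 19} \<longrightarrow> \<sigma>' r = \<sigma> r))"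
      by (rule IH) (use h in simp_all)
    then have "wp M table_loop (\<sigma>1(14 := tp + ?L, 16 := Suc jp, 17 := r), \<mu>) (\<lambda>e' d' t' (\<sigma>', \<mu>').
           e + e' = 0 \<and> \<mu>' = \<mu> \<and> d + d' + \<sigma>' 13 = db \<and>
           10 + (t + t') + 20 * \<sigma>' 12 \<le> 20 * wb + 15 * Suc r + 1 \<and> \<sigma>' 14 = tp + Suc r * ?L \<and>
           (\<sigma>' 12, \<sigma>' 13, \<sigma>' 0) =
             fold (visit (dist_less M))
               (concat (map (\<lambda>j. bucket n (kk j) ((u + v j) mod 2 ^ word_len M)) [0..<Suc r])) (wb, db, out) \<and>
           (\<forall>r. r \<notin> {0, 5, 6, 7, 12, 13, 14, 16, 17, 18, 19} \<longrightarrow> \<sigma>' r = \<sigma> r))"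
      by (rule wp_mono) (use h in auto)
    moreover have "\<mu>1 = \<mu>" "e = 0" using h by auto
    ultimately show ?case using r md by (simp add: s1 del: upt_Suc)
  qed (simp_all add: Suc.prems)
qed

lemmas probe_phase_step = wp_While_step[where x = 9 and
  c = "Load 20 15 ;; Binop Plus 16 23 24 ;; Binop Plus 17 10 24 ;; table_loop ;; incr 15 ;; decr 9",
  folded probe_phase_def]

text \<open>Tables are stored in row-major order of the pairs \<open>(i, j)\<close>, so the table
  pointer only ever advances by one table, while the pointer to the right partial keys is set back
  for each \<open>i\<close>.\<close>

lemma probe_phase:
  assumes "\<sigma> 9 = a" "\<sigma> 15 = ip" "\<sigma> 14 = tp" "\<sigma> 12 = wb" "\<sigma> 13 = db" "\<sigma> 0 = out"
    "\<sigma> 22 = 3" "\<sigma> 8 = 1" "\<sigma> 11 = n" "\<sigma> 21 = 3 * (n + 1)" "\<sigma> 23 = jp" "\<sigma> 10 = B" "\<sigma> 24 = 0"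
    "\<forall>i<a. \<mu> (ip + i) = u i" "\<forall>j<B. \<mu> (jp + j) = v j"
    "\<forall>i<a. \<forall>j<B. table_at \<mu> (tp + (i * B + j) * (3 * (n + 1))) n (kk i j)"
    "ip + a \<le> mem_size M" "jp + B \<le> mem_size M"
    "tp + a * (B * (3 * (n + 1))) \<le> mem_size M" "mem_size M < 2 ^ word_len M"
    "wb < 2 ^ word_len M" "db < 2 ^ word_len M" "num_points M = n" "0 < n"
  shows "wp M probe_phase (\<sigma>, \<mu>) (\<lambda>e d t (\<sigma>', \<mu>'). e = 0 \<and> \<mu>' = \<mu> \<and> d + \<sigma>' 13 = db \<and>
           t + 20 * \<sigma>' 12 \<le> 20 * wb + a * (15 * B + 8) + 1 \<and>
           (\<sigma>' 12, \<sigma>' 13, \<sigma>' 0) =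
             fold (visit (dist_less M))
               (concat (map (\<lambda>i. concat (map (\<lambda>j. bucket n (kk i j) ((u i + v j) mod 2 ^ word_len M)) [0..<B])) [0..<a])) (wb, db, out) \<and>
           (\<forall>r. r > 20 \<or> r = 8 \<longrightarrow> \<sigma>' r = \<sigma> r))"
  using assms
proof (induction a arbitrary: \<sigma> ip tp wb db out u kk)
  case 0
  then show ?case unfolding probe_phase_def by (intro wp_While_0) auto
next
  case (Suc a)
  let ?N = "2 ^ word_len M" and ?L = "3 * (n + 1)"
  let ?F = "\<lambda>i. concat (map (\<lambda>j. bucket n (kk i j) ((u i + v j) mod ?N)) [0..<B])"
  have ip: "\<mu> ip = u 0" "ip < mem_size M" using Suc.prems(14,17) by auto
  have tb: "\<forall>j<B. table_at \<mu> (tp + j * ?L) n (kk 0 j)" using Suc.prems(16) by auto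
  have tp: "tp + B * ?L + a * (B * ?L) \<le> mem_size M" using Suc.prems(19) by (simp add: algebra_simps)
  have tp': "tp + B * ?L \<le> mem_size M" by (rule add_leD1[OF tp])
  have md: "Suc ip mod ?N = Suc ip" "(a + ?N) mod ?N = a" "jp mod ?N = jp" "B mod ?N = B"
    using Suc.prems(17,18,20) by auto
  have tl: "wp M table_loop (\<sigma>1, \<mu>) (\<lambda>e d t (\<sigma>', \<mu>'). e = 0 \<and> \<mu>' = \<mu> \<and> d + \<sigma>' 13 = db \<and>
           t + 20 * \<sigma>' 12 \<le> 20 * wb + 15 * B + 1 \<and> \<sigma>' 14 = tp + B * ?L \<and>
           (\<sigma>' 12, \<sigma>' 13, \<sigma>' 0) =
             fold (visit (dist_less M)) (?F 0) (wb, db, out) \<and>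
           (\<forall>r. r \<notin> {0, 5, 6, 7, 12, 13, 14, 16, 17, 18, 19} \<longrightarrow> \<sigma>' r = \<sigma>1 r))"
    if "\<sigma>1 20 = u 0" "\<sigma>1 16 = jp" "\<sigma>1 17 = B"
      "\<forall>r. r \<notin> {16, 17, 20} \<longrightarrow> \<sigma>1 r = \<sigma> r" for \<sigma>1
    by (rule table_loop) (use that Suc.prems(1-13,15,18,20-24) tb tp' in simp_all)
  have IH: "wp M probe_phase (\<sigma>2, \<mu>) (\<lambda>e d t (\<sigma>', \<mu>'). e = 0 \<and> \<mu>' = \<mu> \<and> d + dd + \<sigma>' 13 = db \<and>
           t + tt + 7 + 20 * \<sigma>' 12 \<le> 20 * wb + Suc a * (15 * B + 8) + 1 \<and>
           (\<sigma>' 12, \<sigma>' 13, \<sigma>' 0) =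
             fold (visit (dist_less M)) (concat (map ?F [0..<Suc a])) (wb, db, out) \<and>
           (\<forall>r. r > 20 \<or> r = 8 \<longrightarrow> \<sigma>' r = \<sigma> r))"
    if *: "dd + \<sigma>2 13 = db" "tt + 20 * \<sigma>2 12 \<le> 20 * wb + 15 * B + 1" "\<sigma>2 9 = a" "\<sigma>2 15 = Suc ip"
      "\<sigma>2 14 = tp + B * ?L"
      "(\<sigma>2 12, \<sigma>2 13, \<sigma>2 0) = fold (visit (dist_less M)) (?F 0) (wb, db, out)"
      "\<forall>r. r \<notin> {0, 5, 6, 7, 9, 12, 13, 14, 15, 16, 17, 18, 19, 20} \<longrightarrow> \<sigma>2 r = \<sigma> r"
      "\<sigma>2 12 \<le> wb" for \<sigma>2 dd tt
  proof -
    have f: "fold (visit (dist_less M)) (concat (map ?F [0..<Suc a])) (wb, db, out) =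
      fold (visit (dist_less M)) (concat (map (\<lambda>i. ?F (Suc i)) [0..<a])) (\<sigma>2 12, \<sigma>2 13, \<sigma>2 0)"
      unfolding *(6) by (subst map_upt_Suc) simp
    have g: "\<sigma>2 22 = 3" "\<sigma>2 8 = 1" "\<sigma>2 11 = n" "\<sigma>2 21 = ?L" "\<sigma>2 23 = jp" "\<sigma>2 10 = B" "\<sigma>2 24 = 0"
      using *(7) Suc.prems by simp_all
    have v: "\<forall>i<a. \<mu> (Suc ip + i) = u (Suc i)" using Suc.prems(14) by auto
    have t: "\<forall>i<a. \<forall>j<B. table_at \<mu> (tp + B * ?L + (i * B + j) * ?L) n (kk (Suc i) j)"
    proof (intro allI impI)
      fix i j assume "i < a" "j < B"
      then have "table_at \<mu> (tp + (Suc i * B + j) * ?L) n (kk (Suc i) j)" using Suc.prems(16) by blast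
      moreover have "tp + (Suc i * B + j) * ?L = tp + B * ?L + (i * B + j) * ?L"
        by (simp add: algebra_simps)
      ultimately show "table_at \<mu> (tp + B * ?L + (i * B + j) * ?L) n (kk (Suc i) j)" by (simp only:)
    qed
    have wd: "\<sigma>2 12 < ?N" "\<sigma>2 13 < ?N" using *(1,8) Suc.prems(21,22) by auto
    show ?thesis unfolding f
    proof (rule wp_mono[OF Suc.IH[OF *(3-5) refl refl refl g v Suc.prems(15) t _ _ tp _ wd]], goal_cases)
      case (6 e d t s')
      obtain \<sigma>' \<mu>' where s': "s' = (\<sigma>', \<mu>')" by (cases s')
      have "\<sigma>' r = \<sigma> r" if "20 < r \<or> r = 8" for r
        using 6 that *(7) by (auto simp: s')
      then show ?case using 6 *(1,2) by (simp add: s' algebra_simps)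
    qed (use Suc.prems in simp_all)
  qed
  show ?case
    apply (rule probe_phase_step)
     apply (use Suc.prems in simp)
    apply (simp add: Suc.prems ip md del: upt_Suc)
  proof (rule wp_mono[OF tl], goal_cases)
    case (5 e d t s1)
    obtain \<sigma>1 \<mu>1 where s1: "s1 = (\<sigma>1, \<mu>1)" by (cases s1)
    note h = 5[unfolded s1 prod.case]
    have r: "\<sigma>1 8 = 1" "\<sigma>1 15 = ip" "\<sigma>1 9 = Suc a"
      using h Suc.prems by simp_all
    have le: "\<sigma>1 12 \<le> wb" using h by (elim conjE) (rule fold_visit_le)
    have "wp M probe_phase (\<sigma>1(15 := Suc ip, 9 := a), \<mu>) (\<lambda>e' d' t' (\<sigma>', \<mu>').
           e' = 0 \<and> \<mu>' = \<mu> \<and> d' + d + \<sigma>' 13 = db \<and>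
           t' + t + 7 + 20 * \<sigma>' 12 \<le> 20 * wb + Suc a * (15 * B + 8) + 1 \<and>
           (\<sigma>' 12, \<sigma>' 13, \<sigma>' 0) =
             fold (visit (dist_less M)) (concat (map ?F [0..<Suc a])) (wb, db, out) \<and>
           (\<forall>r. r > 20 \<or> r = 8 \<longrightarrow> \<sigma>' r = \<sigma> r))"
      by (rule IH) (use h le in \<open>simp_all del: upt_Suc\<close>)
    then have "wp M probe_phase (\<sigma>1(15 := Suc ip, 9 := a), \<mu>) (\<lambda>e' d' t' (\<sigma>', \<mu>').
           e + e' = 0 \<and> \<mu>' = \<mu> \<and> d + d' + \<sigma>' 13 = db \<and>
           7 + (t + t') + 20 * \<sigma>' 12 \<le> 20 * wb + Suc a * (15 * B + 8) + 1 \<and>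
           (\<sigma>' 12, \<sigma>' 13, \<sigma>' 0) =
             fold (visit (dist_less M)) (concat (map ?F [0..<Suc a])) (wb, db, out) \<and>
           (\<forall>r. r > 20 \<or> r = 8 \<longrightarrow> \<sigma>' r = \<sigma> r))"
      by (rule wp_mono) (use h in \<open>auto simp del: upt_Suc\<close>)
    moreover have "\<mu>1 = \<mu>" "e = 0" using h by auto
    ultimately show ?case using r md Suc.prems(8) by (auto simp: s1 simp del: upt_Suc elim!: wp_mono)
  qed (simp_all add: Suc.prems)
qed

lemmas reset_phase_step = wp_While_step[where x = 25 and
  c = "Store 26 24 ;; incr 26 ;; decr 25", folded reset_phase_def]

lemma reset_phase:
  assumes "\<sigma> 25 = m" "\<sigma> 26 = a" "\<sigma> 24 = 0" "\<sigma> 8 = 1" "a + m \<le> mem_size M" "mem_size M < 2 ^ word_len M"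
  shows "wp M reset_phase (\<sigma>, \<mu>) (\<lambda>e d t (\<sigma>', \<mu>'). e = 0 \<and> d = 0 \<and> t = 4 * m + 1 \<and>
           \<mu>' = (\<lambda>x. if x \<in> {a..<a + m} then 0 else \<mu> x) \<and> \<sigma>' 0 = \<sigma> 0)"
  using assms
proof (induction m arbitrary: \<sigma> \<mu> a)
  case 0
  then show ?case unfolding reset_phase_def by (intro wp_While_0) auto
next
  case (Suc m)
  let ?N = "2 ^ word_len M"
  have md: "Suc a mod ?N = Suc a" "(m + ?N) mod ?N = m" using Suc.prems by auto
  have "wp M reset_phase (\<sigma>(26 := Suc a, 25 := m), \<mu>(a := 0)) (\<lambda>e d t (\<sigma>', \<mu>'). e = 0 \<and> d = 0 \<and>
           t = 4 * m + 1 \<and> \<mu>' = (\<lambda>x. if x \<in> {Suc a..<Suc a + m} then 0 else (\<mu>(a := 0)) x) \<and>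
           \<sigma>' 0 = (\<sigma>(26 := Suc a, 25 := m)) 0)"
    by (rule Suc.IH) (use Suc.prems in simp_all)
  then have "wp M reset_phase (\<sigma>(26 := Suc a, 25 := m), \<mu>(a := 0)) (\<lambda>e d t (\<sigma>', \<mu>'). e = 0 \<and> d = 0 \<and>
           t = 4 * m + 1 \<and> \<mu>' = (\<lambda>x. if x \<in> {a..<a + Suc m} then 0 else \<mu> x) \<and> \<sigma>' 0 = \<sigma> 0)"
    by (rule wp_mono) (auto simp: fun_eq_iff)
  then show ?case
    by (intro reset_phase_step) (use Suc.prems md in \<open>auto elim!: wp_mono\<close>)
qed

section \<open>Memory layout and the complete query\<close>

definition lsh_space :: "nat \<Rightarrow> nat \<Rightarrow> nat \<Rightarrow> (nat \<times> nat list) list \<Rightarrow> nat" where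
  "lsh_space A B n gs = 11 + (A + B) + length (encode gs) + A * B * (3 * (n + 1))"

text \<open>
  Layout: header, partial keys (zero between queries), encoded groups, tables. Entry \<open>p\<close> of
  a table holds the head of bucket \<open>p\<close>, the key of point \<open>p - 1\<close> and the successor of point \<open>p - 1\<close> in its
  bucket.
\<close>

definition lsh_memory ::
  "nat \<Rightarrow> nat \<Rightarrow> nat \<Rightarrow> nat \<Rightarrow> nat \<Rightarrow> (nat \<times> nat list) list \<Rightarrow> (nat \<Rightarrow> nat \<Rightarrow> nat \<Rightarrow> nat) \<Rightarrow> nat \<Rightarrow> nat" where
  "lsh_memory A B n W D gs key a =
     (let sp = 11 + (A + B); tp = sp + length (encode gs); L = 3 * (n + 1) in
      if a < 11 then [length gs, sp, A, B, n, W, D, tp, L, 11 + A, A + B] ! a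
      else if a < sp then 0
      else if a < tp then encode gs ! (a - sp)
      else
        let t = (a - tp) div L; r = (a - tp) mod L; kk = key (t div B) (t mod B) in
        if r mod 3 = 0 then link n kk (r div 3) 0
        else if r mod 3 = 1 then kk (r div 3 - 1)
        else link n kk (kk (r div 3 - 1) mod n) (r div 3))"

text \<open>Offsets inside a table stay below its size \<open>3 * (n + 1)\<close>, so division by
  the size recovers the table number \<open>i * B + j\<close>; by \<open>j < B\<close>, division by
  \<open>B\<close> then recovers the pair.\<close>

lemma lsh_memory_table:
  assumes "j < B"
  shows "table_at (lsh_memory A B n W D gs key)
           (11 + (A + B) + length (encode gs) + (i * B + j) * (3 * (n + 1))) n (key i j)"
proof -
  let ?L = "3 * (n + 1)"
  let ?tp = "11 + (A + B) + length (encode gs)"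
  have B: "(i * B + j) div B = i" "(i * B + j) mod B = j" using assms by auto
  have *: "lsh_memory A B n W D gs key (?tp + (i * B + j) * ?L + r) =
      (if r mod 3 = 0 then link n (key i j) (r div 3) 0
        else if r mod 3 = 1 then key i j (r div 3 - 1)
        else link n (key i j) (key i j (r div 3 - 1) mod n) (r div 3))" if "r < ?L" for r
  proof -
    have d: "(?tp + (i * B + j) * ?L + r - ?tp) = r + (i * B + j) * ?L" by simp
    have "(r + (i * B + j) * ?L) div ?L = i * B + j" "(r + (i * B + j) * ?L) mod ?L = r"
      using that by (simp_all only: div_mult_self1 mod_mult_self1) auto
    then show ?thesis
      unfolding lsh_memory_def Let_def d using assms by (simp add: B)
  qed
  show ?thesis
    unfolding table_at_def
  proof (intro conjI allI impI)
    fix b assume "b < n"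
    then show "lsh_memory A B n W D gs key (?tp + (i * B + j) * ?L + 3 * b) = link n (key i j) b 0"
      by (subst *) auto
  next
    fix p assume p: "p < n"
    have 1: "(3 * Suc p + 1) mod 3 = 1" "(3 * Suc p + 1) div 3 = Suc p"
      "(3 * Suc p + 2) mod 3 = 2" "(3 * Suc p + 2) div 3 = Suc p" by presburger+
    show "lsh_memory A B n W D gs key (?tp + (i * B + j) * ?L + 3 * Suc p + 1) = key i j p"
      unfolding add.assoc[of _ "3 * Suc p"] by (subst *) (use p 1 in simp_all)
    show "lsh_memory A B n W D gs key (?tp + (i * B + j) * ?L + 3 * Suc p + 2) =
       link n (key i j) (key i j p mod n) (Suc p)"
      unfolding add.assoc[of _ "3 * Suc p"] by (subst *) (use p 1 in simp_all)
  qed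
qed

lemma link_le: "link n kk b s \<le> n"
  unfolding link_def using chain_eq_Cons(1)[of n kk b s] by (auto split: list.split simp: Suc_le_eq)

lemma encode_le:
  assumes "wf_groups m gs" "x \<in> set (encode gs)"
  shows "x \<le> hashes gs \<or> x \<le> 11 + m"
  using assms
proof (induction gs)
  case (Cons g gs)
  obtain b ds where g: "g = (b, ds)" by (cases g)
  have "distinct ds" "set ds \<subseteq> {..<m}" using Cons.prems by (auto simp: wf_groups_def g)
  then have "length ds \<le> m"
    by (metis card_lessThan card_mono distinct_card finite_lessThan)
  moreover have "wf_groups m gs" using Cons.prems by (auto simp: wf_groups_def)
  ultimately show ?case using Cons \<open>set ds \<subseteq> {..<m}\<close> by (auto simp: g)
qed simp

text \<open>Stored numbers are counts, addresses or point indices, all below the space bound; or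
  group sizes, at most \<open>hashes gs\<close>; or budgets and keys, bounded by assumption. Because
  \<open>A\<close> and \<open>B\<close> are positive there is at least one table, and its size
  bounds \<open>n\<close>.\<close>

lemma lsh_memory_word:
  assumes "wf_groups (A + B) gs" "hashes gs < N" "lsh_space A B n gs < N" "W < N" "D < N"
    "\<And>i j p. key i j p < N" "0 < A" "0 < B"
  shows "lsh_memory A B n W D gs key a < N"
proof -
  let ?sp = "11 + (A + B)" and ?tp = "11 + (A + B) + length (encode gs)"
  have AB: "1 \<le> A * B" using assms by (simp add: Suc_le_eq)
  have "3 * (n + 1) \<le> A * B * (3 * (n + 1))" using AB by (metis mult_1 mult_le_mono1)
  then have n: "3 * (n + 1) + (11 + (A + B) + length (encode gs)) < N"
    using assms(3) unfolding lsh_space_def by linarith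
  have l: "link n kk b s < N" for kk b s
  proof -
    have "n < N" using n by simp
    with link_le[of n kk b s] show ?thesis by (rule le_less_trans)
  qed
  consider "a < 11" | "11 \<le> a" "a < ?sp" | "?sp \<le> a" "a < ?tp" | "?tp \<le> a" by linarith
  then show ?thesis
  proof cases
    case 1
    then have "a = 0 \<or> a = 1 \<or> a = 2 \<or> a = 3 \<or> a = 4 \<or> a = 5 \<or> a = 6 \<or> a = 7 \<or> a = 8 \<or>
        a = 9 \<or> a = 10" by presburger
    then show ?thesis
      using n assms(4,5) length_le_encode[of gs] by (auto simp: lsh_memory_def Let_def)
  next
    case 2
    then show ?thesis using n by (simp add: lsh_memory_def)
  next
    case 3
    then have "encode gs ! (a - ?sp) \<in> set (encode gs)" by (intro nth_mem) linarith
    from encode_le[OF assms(1) this] have "encode gs ! (a - ?sp) < N"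
      using assms(2) n by linarith
    with 3 show ?thesis by (simp add: lsh_memory_def)
  next
    case 4
    then show ?thesis using l assms(6) by (simp add: lsh_memory_def Let_def)
  qed
qed

text \<open>The entries that a query without budgets and without early exit would visit, in the
  order of the visits.\<close>

definition candidates :: "nat \<Rightarrow> nat \<Rightarrow> nat \<Rightarrow> (nat \<Rightarrow> nat \<Rightarrow> nat \<Rightarrow> nat) \<Rightarrow> (nat \<Rightarrow> nat \<Rightarrow> nat) \<Rightarrow> (bool \<times> nat) list" where
  "candidates A B n key kq =
     concat (map (\<lambda>i. concat (map (\<lambda>j. bucket n (key i j) (kq i j)) [0..<B])) [0..<A])"

lemma lsh_query:
  fixes M A B n W D gs key
  defines "\<mu> \<equiv> lsh_memory A B n W D gs key"
    and "S \<equiv> \<lambda>l. (\<Sum>h\<in>used 0 gs l. hash_word M h) mod 2 ^ word_len M"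
  assumes wf: "wf_groups (A + B) gs" and hc: "num_hash M = hashes gs" "hashes gs < 2 ^ word_len M"
    and ms: "mem_size M = lsh_space A B n gs" "lsh_space A B n gs < 2 ^ word_len M"
    and WD: "W < 2 ^ word_len M" "D < 2 ^ word_len M"
    and np: "num_points M = n" "0 < n" and AB: "0 < A" "0 < B"
  shows "wp M lsh_query (\<lambda>_. 0, \<mu>) (\<lambda>e d t (\<sigma>', \<mu>'). e = hashes gs \<and> d \<le> D \<and>
           t \<le> 7 * length (encode gs) + 4 * hashes gs + 20 * W + 62 * (A * B) \<and> \<mu>' = \<mu> \<and>
           \<sigma>' 0 = snd (snd (fold (visit (dist_less M))
             (candidates A B n key (\<lambda>i j. (S i + S (A + j)) mod 2 ^ word_len M)) (W, D, n))))"
proof -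
  let ?N = "2 ^ word_len M"
  let ?sp = "11 + (A + B)"
  let ?tp = "?sp + length (encode gs)"
  let ?L = "3 * (n + 1)"
  have hdr: "\<mu> 0 = length gs" "\<mu> (Suc 0) = ?sp" "\<mu> 2 = A" "\<mu> 3 = B" "\<mu> 4 = n" "\<mu> 5 = W" "\<mu> 6 = D" "\<mu> 7 = ?tp"
    "\<mu> 8 = ?L" "\<mu> 9 = 11 + A" "\<mu> 10 = A + B"
    by (simp_all add: \<mu>_def lsh_memory_def Let_def)
  have \<mu>0: "\<mu> a = 0" if "a \<in> {11..<?sp}" for a
    using that by (simp add: \<mu>_def lsh_memory_def)
  have tab: "table_at \<mu> (?tp + (i * B + j) * ?L) n (key i j)" if "j < B" for i j
    unfolding \<mu>_def by (rule lsh_memory_table[OF that])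
  have enc: "stored \<mu> ?sp (encode gs)"
    by (auto simp: stored_def \<mu>_def lsh_memory_def)
  have ms': "?tp + A * (B * ?L) = mem_size M" by (simp only: ms(1) lsh_space_def mult.assoc)
  have tpm: "?tp \<le> mem_size M" by (rule add_leD1[OF eq_refl[OF ms']])
  have Nm: "mem_size M < ?N" using ms by simp
  have c: "(10::nat) < mem_size M" "(11::nat) < ?N" using tpm Nm by auto
  have cm: "k mod ?N = k" if "k \<le> 11" for k :: nat using c(2) that by simp
  \<comment> \<open>The header occupies addresses 0 to 10, so the partial keys start at 11. The
    answer register is preset to \<open>n\<close>, meaning that no point is returned; registers 3
    and 24 are zero because a query starts with all registers zero.\<close>
  have init: "wp M init_phase (\<lambda>_. 0, \<mu>) (\<lambda>e d t (\<sigma>', \<mu>'). e = 0 \<and> d = 0 \<and> t = 28 \<and> \<mu>' = \<mu> \<and>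
      \<sigma>' 0 = n \<and> \<sigma>' 1 = length gs \<and> \<sigma>' 2 = ?sp \<and> \<sigma>' 3 = 0 \<and> \<sigma>' 8 = 1 \<and> \<sigma>' 9 = A \<and> \<sigma>' 10 = B \<and>
      \<sigma>' 11 = n \<and> \<sigma>' 12 = W \<and> \<sigma>' 13 = D \<and> \<sigma>' 14 = ?tp \<and> \<sigma>' 15 = 11 \<and> \<sigma>' 21 = ?L \<and>
      \<sigma>' 22 = 3 \<and> \<sigma>' 23 = 11 + A \<and> \<sigma>' 24 = 0 \<and> \<sigma>' 25 = A + B \<and> \<sigma>' 26 = 11)"
  proof -
    have "0 < word_len M" using c(2) by (intro gr0I) simp
    then show ?thesis unfolding init_phase_def using c(1) by (simp add: cm hdr)
  qed
  have hash: "wp M hash_phase (\<sigma>, \<mu>) (\<lambda>e d t (\<sigma>', \<mu>'). e = hashes gs \<and> d = 0 \<and>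
           t \<le> 7 * length (encode gs) + 4 * hashes gs + 1 \<and>
           (\<forall>l<A + B. \<mu>' (11 + l) = S l) \<and>
           (\<forall>a. a \<notin> {11..<?sp} \<longrightarrow> \<mu>' a = \<mu> a) \<and>
           (\<forall>r. r \<notin> {1, 2, 3, 4, 5, 6, 7} \<longrightarrow> \<sigma>' r = \<sigma> r))"
    if "\<sigma> 1 = length gs" "\<sigma> 2 = ?sp" "\<sigma> 3 = 0" "\<sigma> 8 = 1" for \<sigma>
    by (rule wp_mono[OF hash_phase[OF that enc wf]])
      (use tpm Nm hc \<mu>0 in \<open>auto simp: S_def\<close>)
  have probe: "wp M probe_phase (\<sigma>, \<mu>1) (\<lambda>e d t (\<sigma>', \<mu>'). e = 0 \<and> \<mu>' = \<mu>1 \<and> d \<le> D \<and>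
           t \<le> 20 * W + A * (15 * B + 8) + 1 \<and>
           \<sigma>' 0 = snd (snd (fold (visit (dist_less M))
             (candidates A B n key (\<lambda>i j. (S i + S (A + j)) mod 2 ^ word_len M)) (W, D, n))) \<and>
           (\<forall>r. r > 20 \<longrightarrow> \<sigma>' r = \<sigma> r) \<and> \<sigma>' 8 = 1)"
    if s: "\<sigma> 9 = A" "\<sigma> 15 = 11" "\<sigma> 14 = ?tp" "\<sigma> 12 = W" "\<sigma> 13 = D" "\<sigma> 0 = n"
    "\<sigma> 22 = 3" "\<sigma> 8 = 1" "\<sigma> 11 = n" "\<sigma> 21 = ?L" "\<sigma> 23 = 11 + A" "\<sigma> 10 = B" "\<sigma> 24 = 0"
    and m: "\<forall>l<A + B. \<mu>1 (11 + l) = S l" "\<forall>a. a \<notin> {11..<?sp} \<longrightarrow> \<mu>1 a = \<mu> a" for \<sigma> \<mu>1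
  proof -
    have t1: "\<forall>i<A. \<forall>j<B. table_at \<mu>1 (?tp + (i * B + j) * ?L) n (key i j)"
    proof (intro allI impI)
      fix i j assume "j < B"
      have "\<mu>1 (?tp + x + y) = \<mu> (?tp + x + y)" "\<mu>1 (?tp + x + y + z) = \<mu> (?tp + x + y + z)" for x y z
        using m(2) by auto
      with tab[OF \<open>j < B\<close>, of i] show "table_at \<mu>1 (?tp + (i * B + j) * ?L) n (key i j)"
        unfolding table_at_def by (simp only:)
    qed
    have u: "\<forall>i<A. \<mu>1 (11 + i) = S i" "\<forall>j<B. \<mu>1 (11 + A + j) = S (A + j)"
      using m(1) by (auto simp: add.assoc)
    show ?thesis
      unfolding candidates_def
      by (rule wp_mono[OF probe_phase[OF s u t1 _ _ eq_refl[OF ms'] Nm WD np]])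
        (use tpm s(8) in \<open>auto simp: prod_eq_iff\<close>)
  qed
  have rest: "wp M (probe_phase ;; reset_phase) (\<sigma>, \<mu>1) (\<lambda>e d t (\<sigma>', \<mu>'). e = 0 \<and> d \<le> D \<and>
           t \<le> 20 * W + A * (15 * B + 8) + 4 * (A + B) + 2 \<and> \<mu>' = \<mu> \<and>
           \<sigma>' 0 = snd (snd (fold (visit (dist_less M))
             (candidates A B n key (\<lambda>i j. (S i + S (A + j)) mod 2 ^ word_len M)) (W, D, n))))"
    if s: "\<sigma> 9 = A" "\<sigma> 15 = 11" "\<sigma> 14 = ?tp" "\<sigma> 12 = W" "\<sigma> 13 = D" "\<sigma> 0 = n"
    "\<sigma> 22 = 3" "\<sigma> 8 = 1" "\<sigma> 11 = n" "\<sigma> 21 = ?L" "\<sigma> 23 = 11 + A" "\<sigma> 10 = B" "\<sigma> 24 = 0"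
    and m: "\<forall>l<A + B. \<mu>1 (11 + l) = S l" "\<forall>a. a \<notin> {11..<?sp} \<longrightarrow> \<mu>1 a = \<mu> a"
    and s': "\<sigma> 25 = A + B" "\<sigma> 26 = 11" for \<sigma> \<mu>1
  proof (rule wp_SeqI[OF probe[OF s m]], goal_cases)
    case (1 e d t s1)
    obtain \<sigma>1 \<mu>2 where s1: "s1 = (\<sigma>1, \<mu>2)" by (cases s1)
    note h = 1[unfolded s1 prod.case]
    have r: "\<sigma>1 25 = A + B" "\<sigma>1 26 = 11" "\<sigma>1 24 = 0" "\<sigma>1 8 = 1"
      using h s s' by auto
    \<comment> \<open>The partial keys are the only cells that a query changes, and they were zero
      before it, so clearing them restores the whole memory.\<close>
    have "(\<lambda>x. if x \<in> {11..<?sp} then 0 else \<mu>1 x) = \<mu>"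
      using m(2) \<mu>0 by auto
    then show ?case unfolding s1
      by (intro wp_mono[OF reset_phase[OF r]]) (use tpm Nm h in auto)
  qed
  \<comment> \<open>With \<open>P = A * B\<close> the constant is \<open>62 = 31 + 15 + 16\<close>:
    the additive terms give 31, the tables 15, and \<open>12 * A + 4 * B\<close> at most 16 times
    \<open>P\<close>.\<close>
  have ineq: "28 + (l + 1 + (w + X + 4 * (A + B) + 2)) \<le> l + w + 62 * P"
    if "X = 15 * P + 8 * A" "A \<le> P" "B \<le> P" "1 \<le> P" for l w X P :: nat
    using that by simp
  have arith: "28 + (7 * length (encode gs) + 4 * hashes gs + 1 +
      (20 * W + A * (15 * B + 8) + 4 * (A + B) + 2)) \<le>
    7 * length (encode gs) + 4 * hashes gs + 20 * W + 62 * (A * B)"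
    by (rule ineq) (use AB in \<open>auto simp: Suc_le_eq algebra_simps\<close>)
  show ?thesis unfolding lsh_query_def
  proof (rule wp_SeqI[OF init], goal_cases)
    case (1 e d t s1)
    obtain \<sigma>1 \<mu>1 where s1: "s1 = (\<sigma>1, \<mu>1)" by (cases s1)
    note h = 1[unfolded s1 prod.case]
    have \<mu>1: "\<mu>1 = \<mu>" using h by simp
    show ?case unfolding s1 \<mu>1
    proof (rule wp_SeqI[OF hash], goal_cases)
      case (5 e' d' t' s2)
      obtain \<sigma>2 \<mu>2 where s2: "s2 = (\<sigma>2, \<mu>2)" by (cases s2)
      note h2 = 5[unfolded s2 prod.case]
      show ?case unfolding s2
      proof (rule wp_mono[OF rest], goal_cases)
        case (18 e'' d'' t'' s3)
        then show ?case using h h2 arith by auto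
      qed (use h h2 in simp_all)
    qed (use h in simp_all)
  qed
qed

text \<open>An entry that is not a good match takes at most one list step, and at most one distance
  computation if it is a false match. The strict inequalities thus leave both budgets positive when
  the first good match is reached, and that match becomes the answer.\<close>

lemma visit_success:
  assumes "(True, p) \<in> set xs" "good p"
    "length (filter (\<lambda>(match, p). \<not> (match \<and> good p)) xs) < W"
    "length (filter (\<lambda>(match, p). match \<and> \<not> good p) xs) < D"
  shows "snd (snd (fold (visit good) xs (W, D, out))) \<in> {p \<in> snd ` set xs. good p}"
  using assms
proof (induction xs arbitrary: W D out)
  case (Cons x xs)
  obtain m p' where x: "x = (m, p')" by (cases x)
  have W: "W \<noteq> 0" "D \<noteq> 0" using Cons.prems by (auto split: if_splits)
  show ?case
  proof (cases "m \<and> good p'")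
    case True
    then show ?thesis using W by (simp add: x fold_visit_0)
  next
    case False
    then have "(True, p) \<in> set xs" using Cons.prems by (auto simp: x)
    with Cons.IH[OF this Cons.prems(2)] Cons.prems False W show ?thesis
      by (fastforce simp: x)
  qed
qed simp

lemma length_filter_bucket:
  "length (filter P (bucket n kk k)) = card {p. p < n \<and> kk p mod n = k mod n \<and> P (kk p = k, p)}"
proof -
  have "length (filter P (bucket n kk k)) =
      length (filter (\<lambda>p. P (kk p = k, p) \<and> kk p mod n = k mod n) [0..<n])"
    by (simp add: bucket_def chain_def filter_map o_def conj_commute)
  also have "\<dots> = card (set (filter (\<lambda>p. P (kk p = k, p) \<and> kk p mod n = k mod n) [0..<n]))"
    by (intro distinct_card[symmetric] distinct_filter distinct_upt)
  also have "set (filter (\<lambda>p. P (kk p = k, p) \<and> kk p mod n = k mod n) [0..<n]) =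
      {p. p < n \<and> kk p mod n = k mod n \<and> P (kk p = k, p)}" by auto
  finally show ?thesis .
qed

text \<open>Turns the list lengths of \<open>visit_success\<close> into cardinalities of sets of
  triples, to which expectations can be applied.\<close>

lemma length_filter_candidates:
  "length (filter P (candidates A B n key kq)) =
     card {(i, j, p). i < A \<and> j < B \<and> p < n \<and>
       key i j p mod n = kq i j mod n \<and> P (key i j p = kq i j, p)}" (is "_ = card ?S")
proof -
  let ?C = "\<lambda>i j. {p. p < n \<and> key i j p mod n = kq i j mod n \<and> P (key i j p = kq i j, p)}"
  have "?S = (SIGMA i:{..<A}. SIGMA j:{..<B}. ?C i j)" by auto
  then have "card ?S = (\<Sum>i<A. \<Sum>j<B. card (?C i j))"
    by simp
  also have "\<dots> = (\<Sum>i\<leftarrow>[0..<A]. \<Sum>j\<leftarrow>[0..<B]. card (?C i j))"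
    by (simp add: interv_sum_list_conv_sum_set_nat atLeast0LessThan)
  finally show ?thesis
    by (simp add: candidates_def filter_concat length_concat o_def length_filter_bucket)
qed

lemma set_candidates:
  "set (candidates A B n key kq) =
     {(key i j p = kq i j, p) | i j p. i < A \<and> j < B \<and> p < n \<and> key i j p mod n = kq i j mod n}"
  by (fastforce simp: candidates_def bucket_def chain_def)

section \<open>Second moments and collision probabilities\<close>

text \<open>Chebyshev's inequality for the number \<open>Z\<close> of events that occur: the
  assumption on pairs says that the variance of \<open>Z\<close> is at most \<open>\<delta>\<close>
  times the squared mean, and \<open>Z = 0\<close> deviates from the mean by the full mean.\<close>

lemma (in prob_space) second_moment_method:
  fixes n :: nat and a \<delta> :: real
  assumes Ev [measurable]: "\<And>l. l < n \<Longrightarrow> Ev l \<in> events"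
    and a: "\<And>l. l < n \<Longrightarrow> prob (Ev l) = a" "0 < a" "0 < n"
    and pairs: "(\<Sum>l<n. \<Sum>l'<n. prob (Ev l \<inter> Ev l')) \<le> (1 + \<delta>) * (n * a)\<^sup>2"
  shows "prob {\<omega> \<in> space M. \<forall>l<n. \<omega> \<notin> Ev l} \<le> \<delta>"
proof -
  define c where "c = n * a"
  have c: "0 < c" using a by (simp add: c_def)
  define Z :: "'a \<Rightarrow> real" where "Z \<omega> = (\<Sum>l<n. indicator (Ev l) \<omega>)" for \<omega>
  have ind: "integrable M (indicator (Ev l) :: 'a \<Rightarrow> real)" if "l < n" for l
    using Ev[OF that] by (simp add: emeasure_eq_measure)
  have iZ: "integrable M Z" unfolding Z_def by (intro Bochner_Integration.integrable_sum ind) simp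
  have Z2: "(Z \<omega>)\<^sup>2 = (\<Sum>l<n. \<Sum>l'<n. indicator (Ev l \<inter> Ev l') \<omega>)" for \<omega>
    unfolding Z_def power2_eq_square sum_product by (simp add: indicator_inter_arith)
  have ind2: "integrable M (indicator (Ev l \<inter> Ev l') :: 'a \<Rightarrow> real)" if "l < n" "l' < n" for l l'
    using Ev[OF that(1)] Ev[OF that(2)] by (simp add: emeasure_eq_measure)
  have iZ2: "integrable M (\<lambda>\<omega>. (Z \<omega>)\<^sup>2)"
    unfolding Z2 by (intro Bochner_Integration.integrable_sum ind2) simp_all
  have EZ: "expectation Z = c"
    unfolding Z_def c_def using a(1) Ev ind by (subst Bochner_Integration.integral_sum) auto
  have EZ2: "expectation (\<lambda>\<omega>. (Z \<omega>)\<^sup>2) = (\<Sum>l<n. \<Sum>l'<n. prob (Ev l \<inter> Ev l'))"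
    unfolding Z2
    apply (subst Bochner_Integration.integral_sum)
     apply (intro Bochner_Integration.integrable_sum ind2; simp)
    apply (intro sum.cong refl)
    apply (subst Bochner_Integration.integral_sum)
     apply (intro ind2; simp)
    using Ev by (intro sum.cong refl) (simp add: Int_absorb1 sets.sets_into_space)
  have dec: "(Z \<omega> - c)\<^sup>2 = (Z \<omega>)\<^sup>2 - 2 * c * Z \<omega> + c\<^sup>2" for \<omega>
    by (simp add: power2_diff)
  have iv: "integrable M (\<lambda>\<omega>. (Z \<omega> - c)\<^sup>2)" unfolding dec using iZ iZ2 by auto
  have "expectation (\<lambda>\<omega>. (Z \<omega> - c)\<^sup>2) = expectation (\<lambda>\<omega>. (Z \<omega>)\<^sup>2) - c\<^sup>2"
    unfolding dec using iZ iZ2 by (simp add: EZ prob_space power2_eq_square)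
  also have "\<dots> \<le> \<delta> * c\<^sup>2"
    using pairs unfolding EZ2 c_def by (simp add: algebra_simps)
  finally have v: "expectation (\<lambda>\<omega>. (Z \<omega> - c)\<^sup>2) \<le> \<delta> * c\<^sup>2" .
  have "prob {\<omega> \<in> space M. \<forall>l<n. \<omega> \<notin> Ev l} \<le> prob {\<omega> \<in> space M. (Z \<omega> - c)\<^sup>2 \<ge> c\<^sup>2}"
    using iv by (intro finite_measure_mono) (auto simp: Z_def)
  also have "\<dots> \<le> expectation (\<lambda>\<omega>. (Z \<omega> - c)\<^sup>2) / c\<^sup>2"
    by (rule integral_Markov_inequality_measure[where A = "{}", OF iv]) (use c in auto)
  also have "\<dots> \<le> \<delta>" using v c by (simp add: divide_le_eq)
  finally show ?thesis .
qed

lemma (in prob_space) markov_count: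
  assumes J: "finite J" and Ev: "\<And>j. j \<in> J \<Longrightarrow> Ev j \<in> events" and c: "0 < (c::real)"
  shows "prob {\<omega> \<in> space M. c \<le> card {j \<in> J. \<omega> \<in> Ev j}} \<le> (\<Sum>j\<in>J. prob (Ev j)) / c"
proof -
  let ?Z = "\<lambda>\<omega>. \<Sum>j\<in>J. indicator (Ev j) \<omega> :: real"
  have Z: "?Z \<omega> = card {j \<in> J. \<omega> \<in> Ev j}" for \<omega>
    using J by (simp add: indicator_def sum.If_cases Int_def)
  have ind: "integrable M (indicator (Ev j) :: 'a \<Rightarrow> real)" if "j \<in> J" for j
    using Ev[OF that] by (simp add: emeasure_eq_measure)
  have iZ: "integrable M ?Z" by (intro Bochner_Integration.integrable_sum ind)
  have "prob {\<omega> \<in> space M. c \<le> ?Z \<omega>} \<le> expectation ?Z / c"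
    by (rule integral_Markov_inequality_measure[where A = "{}", OF iZ]) (use c in \<open>auto simp: sum_nonneg\<close>)
  also have "expectation ?Z = (\<Sum>j\<in>J. prob (Ev j))"
    using Ev ind by (subst Bochner_Integration.integral_sum) auto
  finally show ?thesis by (simp add: Z)
qed

lemma measure_PiM_all:
  assumes "prob_space N" "finite I" "U \<subseteq> I" "E \<in> sets N"
  shows "measure (Pi\<^sub>M I (\<lambda>_. N)) {\<omega> \<in> space (Pi\<^sub>M I (\<lambda>_. N)). \<forall>i\<in>U. \<omega> i \<in> E} = measure N E ^ card U"
proof -
  interpret product_prob_space "\<lambda>_. N" I
    using assms(1) by (simp add: product_prob_space_def product_prob_space_axioms_def
      product_sigma_finite_def prob_space_imp_sigma_finite)
  have "finite U" using assms finite_subset by blast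
  then have "emeasure (Pi\<^sub>M I (\<lambda>_. N)) {\<omega> \<in> space (Pi\<^sub>M I (\<lambda>_. N)). \<forall>i\<in>U. \<omega> i \<in> E} = emeasure N E ^ card U"
    using assms by (subst emeasure_PiM_Collect) auto
  then show ?thesis
    by (simp add: emeasure_eq_measure M.emeasure_eq_measure ennreal_power)
qed

text \<open>For sets of size \<open>k\<close> with overlap \<open>c\<close> the joint probability is
  \<open>p ^ (2 * k - c)\<close>, that is \<open>(p ^ k)\<^sup>2 * (1 / p) ^ c\<close>. As
  \<open>p \<ge> p1\<close>, the correction is at most \<open>(1 / p1) ^ c\<close>, so the
  hypothesis on overlaps concerns the sets alone and not the event \<open>E\<close>.\<close>

lemma second_moment_PiM:
  fixes p1 :: real
  assumes N: "prob_space N" and I: "finite I" and E: "E \<in> sets N"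
    and U: "\<And>l. l < n \<Longrightarrow> U l \<subseteq> I" "\<And>l. l < n \<Longrightarrow> card (U l) = k" and n: "0 < n"
    and p: "0 < p1" "p1 \<le> measure N E"
    and pairs: "(\<Sum>l<n. \<Sum>l'<n. (1 / p1) ^ card (U l \<inter> U l')) \<le> (1 + \<delta>) * (real n)\<^sup>2"
  shows "measure (Pi\<^sub>M I (\<lambda>_. N)) {\<omega> \<in> space (Pi\<^sub>M I (\<lambda>_. N)). \<forall>l<n. \<exists>i\<in>U l. \<omega> i \<notin> E} \<le> \<delta>"
proof -
  let ?P = "Pi\<^sub>M I (\<lambda>_. N)"
  let ?p = "measure N E"
  interpret P: prob_space ?P by (rule prob_space_PiM) (rule N)
  let ?Ev = "\<lambda>l. {\<omega> \<in> space ?P. \<forall>i\<in>U l. \<omega> i \<in> E}"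
  have fin: "finite (U l)" if "l < n" for l using U(1)[OF that] I finite_subset by blast
  have Ev: "?Ev l \<in> sets ?P" if "l < n" for l
    using fin[OF that] U(1)[OF that] E
    by (intro sets.sets_Collect_finite_All sets_Collect_single) auto
  have a: "measure ?P (?Ev l) = ?p ^ k" if "l < n" for l
    using measure_PiM_all[OF N I U(1)[OF that] E] U(2)[OF that] by simp
  have "measure ?P (?Ev l \<inter> ?Ev l') \<le> (?p ^ k)\<^sup>2 * (1 / p1) ^ card (U l \<inter> U l')"
    if l: "l < n" "l' < n" for l l'
  proof -
    have "?Ev l \<inter> ?Ev l' = {\<omega> \<in> space ?P. \<forall>i\<in>U l \<union> U l'. \<omega> i \<in> E}" by auto
    then have m: "measure ?P (?Ev l \<inter> ?Ev l') = ?p ^ card (U l \<union> U l')"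
      using measure_PiM_all[OF N I _ E, of "U l \<union> U l'"] U(1) l by simp
    have "card (U l \<union> U l') + card (U l \<inter> U l') = 2 * k"
      using card_Un_Int[OF fin[OF l(1)] fin[OF l(2)]] U(2) l by simp
    then have "?p ^ card (U l \<union> U l') * ?p ^ card (U l \<inter> U l') = (?p ^ k)\<^sup>2"
      by (metis power_add power_mult mult.commute)
    then have "?p ^ card (U l \<union> U l') = (?p ^ k)\<^sup>2 * (1 / ?p) ^ card (U l \<inter> U l')"
      using p by (simp add: field_simps)
    also have "\<dots> \<le> (?p ^ k)\<^sup>2 * (1 / p1) ^ card (U l \<inter> U l')"
      using p by (intro mult_left_mono power_mono) (auto simp: frac_le)
    finally show ?thesis by (simp add: m)
  qed
  then have "(\<Sum>l<n. \<Sum>l'<n. measure ?P (?Ev l \<inter> ?Ev l')) \<le>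
      (\<Sum>l<n. \<Sum>l'<n. (?p ^ k)\<^sup>2 * (1 / p1) ^ card (U l \<inter> U l'))"
    by (intro sum_mono) auto
  also have "\<dots> = (?p ^ k)\<^sup>2 * (\<Sum>l<n. \<Sum>l'<n. (1 / p1) ^ card (U l \<inter> U l'))"
    by (simp add: sum_distrib_left)
  also have "\<dots> \<le> (?p ^ k)\<^sup>2 * ((1 + \<delta>) * (real n)\<^sup>2)"
    by (intro mult_left_mono pairs) simp
  also have "\<dots> = (1 + \<delta>) * (n * ?p ^ k)\<^sup>2" by (simp add: power_mult_distrib algebra_simps)
  finally have *: "(\<Sum>l<n. \<Sum>l'<n. measure ?P (?Ev l \<inter> ?Ev l')) \<le> (1 + \<delta>) * (n * ?p ^ k)\<^sup>2" .
  have "measure ?P {\<omega> \<in> space ?P. \<forall>l<n. \<omega> \<notin> ?Ev l} \<le> \<delta>"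
    by (rule P.second_moment_method[OF Ev a _ n *]) (use p in auto)
  moreover have "{\<omega> \<in> space ?P. \<forall>l<n. \<omega> \<notin> ?Ev l} = {\<omega> \<in> space ?P. \<forall>l<n. \<exists>i\<in>U l. \<omega> i \<notin> E}" by auto
  ultimately show ?thesis by simp
qed

section \<open>Counting residues of shifted words\<close>

lemma card_mod_eq_le:
  fixes w T r :: nat assumes "0 < T"
  shows "card {u. u < w \<and> u mod T = r} \<le> w div T + 1"
proof -
  have "inj_on (\<lambda>u. u div T) {u. u < w \<and> u mod T = r}"
    by (rule inj_onI) (metis (mono_tags, lifting) div_mod_decomp mem_Collect_eq)
  moreover have "(\<lambda>u. u div T) ` {u. u < w \<and> u mod T = r} \<subseteq> {..w div T}"
    by (auto intro: div_le_mono)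
  ultimately have "card {u. u < w \<and> u mod T = r} \<le> card {..w div T}"
    by (metis card_inj_on_le finite_atMost)
  then show ?thesis by simp
qed

text \<open>For fixed \<open>s\<close>, shifting \<open>t\<close> permutes the words, and a residue
  class modulo \<open>T\<close> contains at most \<open>W div T + 1\<close> of them. The term
  \<open>1 / W\<close> pays for an incomplete class when \<open>T\<close> does not divide
  \<open>W\<close>; for \<open>T = W\<close> the bound is \<open>2 / W\<close>.\<close>

lemma card_shifted_mod_eq_le:
  fixes W T a b :: nat assumes "0 < T"
  shows "real (card {(s, t). s < W \<and> t < W \<and> (s + a) mod W mod T = (t + b) mod W mod T}) \<le>
    (1 / T + 1 / W) * (real W * real W)"
proof (cases "W = 0")
  case False
  have "card {t. t < W \<and> (s + a) mod W mod T = (t + b) mod W mod T} \<le> W div T + 1" for s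
  proof -
    have "inj_on (\<lambda>t. (t + b) mod W) {..<W}"
    proof (rule inj_onI)
      fix x y assume "x \<in> {..<W}" "y \<in> {..<W}" "(x + b) mod W = (y + b) mod W"
      then show "x = y" by (simp add: mod_eq_dvd_iff_nat nat_mod_eq_iff) (metis add_right_cancel mod_less nat_mod_eq_iff mod_add_cong lessThan_iff)
    qed
    then have "inj_on (\<lambda>t. (t + b) mod W) {t. t < W \<and> (s + a) mod W mod T = (t + b) mod W mod T}"
      by (rule inj_on_subset) auto
    moreover have "(\<lambda>t. (t + b) mod W) ` {t. t < W \<and> (s + a) mod W mod T = (t + b) mod W mod T} \<subseteq>
        {u. u < W \<and> u mod T = (s + a) mod W mod T}" using False by auto
    ultimately have "card {t. t < W \<and> (s + a) mod W mod T = (t + b) mod W mod T} \<le>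
        card {u. u < W \<and> u mod T = (s + a) mod W mod T}"
      by (rule card_inj_on_le) simp
    then show ?thesis using card_mod_eq_le[OF assms, of W "(s + a) mod W mod T"] by linarith
  qed
  note le = this
  have "{(s, t). s < W \<and> t < W \<and> (s + a) mod W mod T = (t + b) mod W mod T} =
      (SIGMA s:{..<W}. {t. t < W \<and> (s + a) mod W mod T = (t + b) mod W mod T})" by auto
  then have "card {(s, t). s < W \<and> t < W \<and> (s + a) mod W mod T = (t + b) mod W mod T} =
      (\<Sum>s<W. card {t. t < W \<and> (s + a) mod W mod T = (t + b) mod W mod T})"
    by simp
  also have "\<dots> \<le> (\<Sum>s<W. W div T + 1)" by (intro sum_mono le)
  finally have "real (card {(s, t). s < W \<and> t < W \<and> (s + a) mod W mod T = (t + b) mod W mod T}) \<le>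
      real (W * (W div T + 1))" by (simp only: of_nat_le_iff sum_constant card_lessThan of_nat_id)
  also have "\<dots> = real W * (real (W div T) + 1)" by (simp add: algebra_simps)
  also have "\<dots> \<le> real W * (real W / real T + 1)"
    by (intro mult_left_mono add_mono of_nat_div_le_of_nat) auto
  also have "\<dots> = (1 / T + 1 / W) * (real W * real W)" using False by (simp add: field_simps)
  finally show ?thesis .
qed simp

lemma measurable_count_space2:
  fixes f :: "'a \<Rightarrow> 'b::countable" and g :: "'a \<Rightarrow> 'c"
  assumes "f \<in> M \<rightarrow>\<^sub>M count_space UNIV" "g \<in> M \<rightarrow>\<^sub>M count_space UNIV"
  shows "(\<lambda>\<omega>. F (f \<omega>) (g \<omega>)) \<in> M \<rightarrow>\<^sub>M count_space UNIV"
  by (rule measurable_compose_countable[OF _ assms(1)])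
    (rule measurable_compose[OF assms(2)], simp)

lemma measurable_count_space_sum:
  fixes f :: "'i \<Rightarrow> 'a \<Rightarrow> nat"
  assumes "finite U" "\<And>i. i \<in> U \<Longrightarrow> f i \<in> M \<rightarrow>\<^sub>M count_space UNIV"
  shows "(\<lambda>\<omega>. \<Sum>i\<in>U. f i \<omega>) \<in> M \<rightarrow>\<^sub>M count_space UNIV"
  using assms by (induction U) (auto intro: measurable_count_space2[where F = "(+)"])

lemma sets_Collect_count_space:
  assumes "f \<in> M \<rightarrow>\<^sub>M count_space UNIV"
  shows "{\<omega> \<in> space M. Q (f \<omega>)} \<in> sets M"
proof -
  have "{\<omega> \<in> space M. Q (f \<omega>)} = f -` {x. Q x} \<inter> space M" by auto
  then show ?thesis using measurable_sets[OF assms, of "{x. Q x}"] by simp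
qed

lemma sets_Collect_count_space2:
  fixes f :: "'a \<Rightarrow> 'b::countable" and g :: "'a \<Rightarrow> 'c"
  assumes "f \<in> M \<rightarrow>\<^sub>M count_space UNIV" "g \<in> M \<rightarrow>\<^sub>M count_space UNIV"
  shows "{\<omega> \<in> space M. Q (f \<omega>) (g \<omega>)} \<in> sets M"
  using sets_Collect_count_space[OF measurable_count_space2[OF assms, of Q], of "\<lambda>b. b"] by simp

lemma pairwise_independent_relation:
  fixes G :: "('r::countable \<Rightarrow> nat) measure"
  assumes G: "pairwise_independent_hash w G" and ab: "a \<noteq> b"
  shows "measure G {g \<in> space G. R (g a) (g b)} =
    card {(s, t). s < 2 ^ w \<and> t < 2 ^ w \<and> R s t} / (2 ^ w * 2 ^ w)"
proof -
  interpret prob_space G using G by (simp add: pairwise_independent_hash_def)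
  let ?C = "{(s, t). s < (2::nat) ^ w \<and> t < 2 ^ w \<and> R s t}"
  let ?E = "\<lambda>z. {g \<in> space G. g a = fst z \<and> g b = snd z}"
  have mg: "(\<lambda>g. g r) \<in> G \<rightarrow>\<^sub>M count_space UNIV" for r
    using G by (simp add: pairwise_independent_hash_def)
  have lt: "g r < 2 ^ w" if "g \<in> space G" for g r
    using G that by (simp add: pairwise_independent_hash_def)
  have "?C \<subseteq> {..<2 ^ w} \<times> {..<2 ^ w}" by auto
  then have fin: "finite ?C" by (rule finite_subset) simp
  have U: "{g \<in> space G. R (g a) (g b)} = (\<Union>z\<in>?C. ?E z)"
    using lt by auto
  have "measure G (\<Union>z\<in>?C. ?E z) = (\<Sum>z\<in>?C. measure G (?E z))"
    by (rule finite_measure_finite_Union[OF fin])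
      (auto simp: disjoint_family_on_def intro!: sets_Collect_count_space2[OF mg mg])
  also have "\<dots> = (\<Sum>z\<in>?C. 1 / (2 ^ w * 2 ^ w))"
  proof (rule sum.cong[OF refl])
    fix z assume z: "z \<in> ?C"
    show "measure G (?E z) = 1 / (2 ^ w * 2 ^ w)"
      by (rule G[unfolded pairwise_independent_hash_def, THEN conjunct2, THEN conjunct2,
            THEN conjunct2, rule_format, OF _ _ ab])
        (use z in \<open>simp_all add: case_prod_beta\<close>)
  qed
  finally show ?thesis unfolding U by simp
qed

section \<open>Collisions of keys made from sampled functions\<close>

locale hash_setup =
  fixes X :: "'x set" and H :: "('x \<Rightarrow> 'r::countable) measure" and G :: "('r \<Rightarrow> nat) measure"
    and w :: nat
  assumes H: "hash_family X H" and G: "pairwise_independent_hash w G"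
begin

abbreviation N :: "(('x \<Rightarrow> 'r) \<times> ('r \<Rightarrow> nat)) measure" where "N \<equiv> H \<Otimes>\<^sub>M G"

sublocale H: prob_space H using H by (simp add: hash_family_def)
sublocale G: prob_space G using G by (simp add: pairwise_independent_hash_def)
sublocale HG: pair_prob_space H G ..

lemma prob_space_N: "prob_space N"
  by unfold_locales

lemma measurable_eval: "x \<in> X \<Longrightarrow> (\<lambda>h. h x) \<in> H \<rightarrow>\<^sub>M count_space UNIV"
  using H by (simp add: hash_family_def)

lemma measurable_hash: "x \<in> X \<Longrightarrow> (\<lambda>z. fst z x) \<in> N \<rightarrow>\<^sub>M count_space UNIV"
  using H by (auto simp: hash_family_def intro: measurable_compose[OF measurable_fst])

lemma measurable_word:
  assumes "x \<in> X"
  shows "(\<lambda>z. snd z (fst z x)) \<in> N \<rightarrow>\<^sub>M count_space UNIV"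
proof (rule measurable_compose_countable[OF _ measurable_hash[OF assms]])
  fix r
  have "(\<lambda>g. g r) \<in> G \<rightarrow>\<^sub>M count_space UNIV"
    using G by (simp add: pairwise_independent_hash_def)
  then show "(\<lambda>z. snd z r) \<in> N \<rightarrow>\<^sub>M count_space UNIV"
    by (rule measurable_compose[OF measurable_snd])
qed

text \<open>Equality of hash values, not of words. Words of different hash values may also agree,
  but that accident is charged to the pairwise independent function instead of to
  \<open>H\<close>.\<close>

definition coll :: "'x \<Rightarrow> 'x \<Rightarrow> (('x \<Rightarrow> 'r) \<times> ('r \<Rightarrow> nat)) set" where
  "coll x q = {z \<in> space N. fst z x = fst z q}"

lemma coll_sets: "x \<in> X \<Longrightarrow> q \<in> X \<Longrightarrow> coll x q \<in> sets N"
  unfolding coll_def by (rule sets_Collect_count_space2[OF measurable_hash measurable_hash])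

lemma measure_coll:
  assumes "x \<in> X" "q \<in> X"
  shows "measure N (coll x q) = measure H {h \<in> space H. h x = h q}"
proof -
  have "coll x q = {h \<in> space H. h x = h q} \<times> space G"
    by (auto simp: coll_def space_pair_measure)
  moreover have "{h \<in> space H. h x = h q} \<in> sets H"
    by (rule sets_Collect_count_space2[OF measurable_eval[OF assms(1)] measurable_eval[OF assms(2)]])
  ultimately show ?thesis
    by (simp add: measure_def G.emeasure_pair_measure_Times G.emeasure_space_1)
qed

text \<open>Integrate over \<open>h\<close> first: if \<open>h\<close> separates the points, then
  pairwise independence at two distinct arguments gives the bound \<open>c\<close>; otherwise the
  event is empty. Keeping the probability of separation as a factor allows bounds for disjoint
  events to be added later without loss.\<close>

lemma emeasure_distinct_hashes:
  fixes c :: real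
  assumes "x \<in> X" "q \<in> X"
    and R: "card {(s, t). s < 2 ^ w \<and> t < 2 ^ w \<and> R s t} \<le> c * (2 ^ w * 2 ^ w)"
  shows "emeasure N {z \<in> space N. fst z x \<noteq> fst z q \<and> R (snd z (fst z x)) (snd z (fst z q))} \<le>
    ennreal c * emeasure N {z \<in> space N. fst z x \<noteq> fst z q}" (is "emeasure N ?A \<le> _ * emeasure N ?B")
proof -
  let ?f = "\<lambda>y z. (fst z y, snd z (fst z y))"
  have f: "?f y \<in> N \<rightarrow>\<^sub>M count_space UNIV" if "y \<in> X" for y
    by (rule measurable_count_space2[where F = Pair, OF measurable_hash[OF that] measurable_word[OF that]])
  have "{z \<in> space N. (\<lambda>u v. fst u \<noteq> fst v \<and> R (snd u) (snd v)) (?f x z) (?f q z)} \<in> sets N"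
    by (rule sets_Collect_count_space2[OF f[OF assms(1)] f[OF assms(2)]])
  then have A: "?A \<in> sets N" by simp
  have B: "?B \<in> sets N"
    by (rule sets_Collect_count_space2[OF measurable_hash[OF assms(1)] measurable_hash[OF assms(2)]])
  have "emeasure N ?A = (\<integral>\<^sup>+h. emeasure G (Pair h -` ?A) \<partial>H)"
    by (rule G.emeasure_pair_measure_alt[OF A])
  also have "\<dots> \<le> (\<integral>\<^sup>+h. ennreal c * emeasure G (Pair h -` ?B) \<partial>H)"
  proof (rule nn_integral_mono)
    fix h assume h: "h \<in> space H"
    show "emeasure G (Pair h -` ?A) \<le> ennreal c * emeasure G (Pair h -` ?B)"
    proof (cases "h x = h q")
      case False
      have 1: "Pair h -` ?A = {g \<in> space G. R (g (h x)) (g (h q))}"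
        using h False by (auto simp: space_pair_measure)
      have 2: "Pair h -` ?B = space G" using h False by (auto simp: space_pair_measure)
      have "measure G (Pair h -` ?A) \<le> c"
        unfolding 1 pairwise_independent_relation[OF G False] using R by (simp add: divide_le_eq)
      then have "emeasure G (Pair h -` ?A) \<le> ennreal c"
        by (subst G.emeasure_eq_measure) (rule ennreal_leI)
      then show ?thesis unfolding 2 by (simp add: G.emeasure_space_1)
    qed simp
  qed
  also have "\<dots> = ennreal c * emeasure N ?B"
    unfolding G.emeasure_pair_measure_alt[OF B]
    by (rule nn_integral_cmult[OF G.measurable_emeasure_Pair[OF B]])
  finally show ?thesis .
qed

definition key :: "nat set \<Rightarrow> (nat \<Rightarrow> ('x \<Rightarrow> 'r) \<times> ('r \<Rightarrow> nat)) \<Rightarrow> 'x \<Rightarrow> nat" where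
  "key U \<omega> x = (\<Sum>i\<in>U. snd (\<omega> i) (fst (\<omega> i) x)) mod 2 ^ w"

lemma measurable_component_hash:
  "x \<in> X \<Longrightarrow> i \<in> I \<Longrightarrow> (\<lambda>\<omega>. fst (\<omega> i) x) \<in> Pi\<^sub>M I (\<lambda>_. N) \<rightarrow>\<^sub>M count_space UNIV"
  by (rule measurable_compose[where f = "\<lambda>\<omega>. \<omega> i" and N = N, OF measurable_component_singleton measurable_hash])

lemma measurable_component_word:
  "x \<in> X \<Longrightarrow> i \<in> I \<Longrightarrow> (\<lambda>\<omega>. snd (\<omega> i) (fst (\<omega> i) x)) \<in> Pi\<^sub>M I (\<lambda>_. N) \<rightarrow>\<^sub>M count_space UNIV"
  by (rule measurable_compose[where f = "\<lambda>\<omega>. \<omega> i" and N = N, OF measurable_component_singleton measurable_word])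

lemma measurable_key:
  assumes "x \<in> X" "finite U" "U \<subseteq> I"
  shows "(\<lambda>\<omega>. key U \<omega> x) \<in> Pi\<^sub>M I (\<lambda>_. N) \<rightarrow>\<^sub>M count_space UNIV"
proof -
  have "(\<lambda>\<omega>. \<Sum>i\<in>U. snd (\<omega> i) (fst (\<omega> i) x)) \<in> Pi\<^sub>M I (\<lambda>_. N) \<rightarrow>\<^sub>M count_space UNIV"
    using assms by (intro measurable_count_space_sum measurable_component_word) auto
  then show "(\<lambda>\<omega>. key U \<omega> x) \<in> Pi\<^sub>M I (\<lambda>_. N) \<rightarrow>\<^sub>M count_space UNIV"
    unfolding key_def by (rule measurable_compose) simp
qed

text \<open>
  Condition on the first function in \<open>U\<close> that separates the points and on all other functions: its
  two words are uniform and independent, hence so are the two keys.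
\<close>

lemma prob_key_collision:
  assumes X: "x \<in> X" "q \<in> X" and I: "finite I" "U \<subseteq> I" and T: "0 < T"
  shows "measure (Pi\<^sub>M I (\<lambda>_. N)) {\<omega> \<in> space (Pi\<^sub>M I (\<lambda>_. N)).
    (\<exists>i\<in>U. fst (\<omega> i) x \<noteq> fst (\<omega> i) q) \<and> key U \<omega> x mod T = key U \<omega> q mod T} \<le> 1 / T + 1 / 2 ^ w"
    (is "measure ?P ?E \<le> ?c")
proof -
  interpret P: prob_space ?P by (rule prob_space_PiM) (rule prob_space_N)
  interpret PS: product_sigma_finite "\<lambda>_. N"
    by (simp add: product_sigma_finite_def prob_space_N prob_space_imp_sigma_finite)
  have U: "finite U" using I finite_subset by blast
  have hx: "(\<lambda>\<omega>. fst (\<omega> i) y) \<in> ?P \<rightarrow>\<^sub>M count_space UNIV" if "y \<in> X" "i \<in> U" for i y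
    using that I by (intro measurable_component_hash) auto
  let ?ne = "\<lambda>i. {\<omega> \<in> space ?P. fst (\<omega> i) x \<noteq> fst (\<omega> i) q}"
  let ?col = "{\<omega> \<in> space ?P. key U \<omega> x mod T = key U \<omega> q mod T}"
  have ne: "?ne i \<in> sets ?P" if "i \<in> U" for i
    by (rule sets_Collect_count_space2[OF hx[OF X(1) that] hx[OF X(2) that]])
  have col: "?col \<in> sets ?P"
    by (rule sets_Collect_count_space2[OF measurable_key[OF X(1) U I(2)] measurable_key[OF X(2) U I(2)]])
  define F where "F i = ?ne i - (\<Union>j\<in>{j\<in>U. j < i}. ?ne j)" for i
  have F: "F i \<in> sets ?P" if "i \<in> U" for i
    unfolding F_def using ne that U by (intro sets.Diff sets.finite_UN) auto
  have bound: "emeasure ?P (F i \<inter> ?col) \<le> ennreal ?c * emeasure ?P (F i)" if i: "i \<in> U" for i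
  proof -
    define J where "J = I - {i}"
    have IJ: "I = insert i J" "i \<notin> J" "finite J" using i I by (auto simp: J_def)
    let ?PJ = "Pi\<^sub>M J (\<lambda>_. N)"
    have inner: "(\<integral>\<^sup>+z. indicator (F i \<inter> ?col) (\<omega> (i := z)) \<partial>N) \<le>
        ennreal ?c * (\<integral>\<^sup>+z. indicator (F i) (\<omega> (i := z)) \<partial>N)" if \<omega>: "\<omega> \<in> space ?PJ" for \<omega>
    proof -
      \<comment> \<open>With all components except \<open>i\<close> fixed, the other functions shift
        the two keys by the constants \<open>s x\<close> and \<open>s q\<close>, and
        \<open>b\<close> states that no earlier function of \<open>U\<close> separates the
        points.\<close>
      define s where "s y = (\<Sum>j\<in>U - {i}. snd (\<omega> j) (fst (\<omega> j) y))" for y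
      define b where "b \<longleftrightarrow> (\<forall>j\<in>U. j < i \<longrightarrow> fst (\<omega> j) x = fst (\<omega> j) q)"
      let ?R = "\<lambda>u v. (u + s x) mod 2 ^ w mod T = (v + s q) mod 2 ^ w mod T"
      have sp: "\<omega> (i := z) \<in> space ?P" if "z \<in> space N" for z
        using that \<omega> unfolding IJ(1) by (auto simp: space_PiM PiE_iff extensional_def)
      have key: "key U (\<omega> (i := z)) y = (snd z (fst z y) + s y) mod 2 ^ w" for z y
        unfolding key_def s_def using U i by (subst sum.remove[of U i]) (auto intro!: arg_cong2[where f = "(mod)"] sum.cong)
      have Fi: "\<omega> (i := z) \<in> F i \<longleftrightarrow> b \<and> fst z x \<noteq> fst z q" if "z \<in> space N" for z
        using sp[OF that] i by (auto simp: F_def b_def)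
      let ?A = "{z \<in> space N. fst z x \<noteq> fst z q \<and> ?R (snd z (fst z x)) (snd z (fst z q))}"
      let ?B = "{z \<in> space N. fst z x \<noteq> fst z q}"
      let ?f = "\<lambda>y z. (fst z y, snd z (fst z y))"
      have f: "?f y \<in> N \<rightarrow>\<^sub>M count_space UNIV" if "y \<in> X" for y
        by (rule measurable_count_space2[where F = Pair, OF measurable_hash[OF that] measurable_word[OF that]])
      have "{z \<in> space N. (\<lambda>u v. fst u \<noteq> fst v \<and> ?R (snd u) (snd v)) (?f x z) (?f q z)} \<in> sets N"
        by (rule sets_Collect_count_space2[OF f[OF X(1)] f[OF X(2)]])
      then have A: "?A \<in> sets N" by simp
      have B: "?B \<in> sets N"
        by (rule sets_Collect_count_space2[OF measurable_hash[OF X(1)] measurable_hash[OF X(2)]])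
      have le: "emeasure N ?A \<le> ennreal ?c * emeasure N ?B"
        using card_shifted_mod_eq_le[OF T, of "2 ^ w" "s x" "s q"]
        by (intro emeasure_distinct_hashes X) simp
      have "(\<integral>\<^sup>+z. indicator (F i \<inter> ?col) (\<omega> (i := z)) \<partial>N) = (\<integral>\<^sup>+z. of_bool b * indicator ?A z \<partial>N)"
        using Fi sp by (intro nn_integral_cong) (auto simp: indicator_def key)
      also have "\<dots> = of_bool b * emeasure N ?A"
        using A by (simp add: nn_integral_cmult)
      also have "\<dots> \<le> of_bool b * (ennreal ?c * emeasure N ?B)"
        by (intro mult_left_mono le) simp
      also have "\<dots> = ennreal ?c * (of_bool b * emeasure N ?B)" by (simp add: ac_simps)
      also have "of_bool b * emeasure N ?B = (\<integral>\<^sup>+z. of_bool b * indicator ?B z \<partial>N)"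
        using B by (simp add: nn_integral_cmult)
      also have "\<dots> = (\<integral>\<^sup>+z. indicator (F i) (\<omega> (i := z)) \<partial>N)"
        using Fi by (intro nn_integral_cong) (auto simp: indicator_def)
      finally show ?thesis .
    qed
    have ins: "emeasure ?P E = (\<integral>\<^sup>+\<omega>. (\<integral>\<^sup>+z. indicator E (\<omega> (i := z)) \<partial>N) \<partial>?PJ)" if "E \<in> sets ?P" for E
    proof -
      have "emeasure ?P E = (\<integral>\<^sup>+\<omega>. indicator E \<omega> \<partial>?P)" using that by simp
      also have "\<dots> = (\<integral>\<^sup>+\<omega>. (\<integral>\<^sup>+z. indicator E (\<omega> (i := z)) \<partial>N) \<partial>?PJ)"
        using that unfolding IJ(1) by (intro PS.product_nn_integral_insert IJ) simp
      finally show ?thesis .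
    qed
    have Fm: "(\<lambda>\<omega>. \<integral>\<^sup>+z. indicator (F i) (\<omega> (i := z)) \<partial>N) \<in> borel_measurable ?PJ"
    proof (rule HG.borel_measurable_nn_integral)
      have "(indicator (F i) :: _ \<Rightarrow> ennreal) \<in> borel_measurable (Pi\<^sub>M (insert i J) (\<lambda>_. N))"
        using F[OF i] unfolding IJ(1) by simp
      from measurable_compose[OF measurable_add_dim this]
      show "(\<lambda>(\<omega>, z). indicator (F i) (\<omega> (i := z)) :: ennreal) \<in> borel_measurable (?PJ \<Otimes>\<^sub>M N)"
        by (simp add: split_beta')
    qed
    have "emeasure ?P (F i \<inter> ?col) \<le> (\<integral>\<^sup>+\<omega>. ennreal ?c * (\<integral>\<^sup>+z. indicator (F i) (\<omega> (i := z)) \<partial>N) \<partial>?PJ)"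
      unfolding ins[OF sets.Int[OF F[OF i] col]] by (rule nn_integral_mono) (rule inner)
    also have "\<dots> = ennreal ?c * emeasure ?P (F i)"
      unfolding ins[OF F[OF i]] by (rule nn_integral_cmult[OF Fm])
    finally show ?thesis .
  qed
  have c0: "0 \<le> ?c" by simp
  have "?E \<subseteq> (\<Union>i\<in>U. F i \<inter> ?col)"
  proof
    fix \<omega> assume \<omega>: "\<omega> \<in> ?E"
    define V where "V = {i\<in>U. fst (\<omega> i) x \<noteq> fst (\<omega> i) q}"
    have V: "V \<noteq> {}" "finite V" using \<omega> U by (auto simp: V_def)
    then have "Min V \<in> V" and "\<forall>j\<in>V. Min V \<le> j" by auto
    then have "\<omega> \<in> F (Min V)" "Min V \<in> U" using \<omega> by (auto simp: V_def F_def)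
    then show "\<omega> \<in> (\<Union>i\<in>U. F i \<inter> ?col)" using \<omega> by auto
  qed
  then have "measure ?P ?E \<le> measure ?P (\<Union>i\<in>U. F i \<inter> ?col)"
    using F col U by (intro P.finite_measure_mono sets.finite_UN sets.Int) auto
  also have "\<dots> \<le> (\<Sum>i\<in>U. measure ?P (F i \<inter> ?col))"
    using F col U by (intro measure_UNION_le) auto
  also have "\<dots> \<le> (\<Sum>i\<in>U. ?c * measure ?P (F i))"
  proof (rule sum_mono)
    fix i assume "i \<in> U"
    from bound[OF this] show "measure ?P (F i \<inter> ?col) \<le> ?c * measure ?P (F i)"
      using c0 by (simp add: P.emeasure_eq_measure ennreal_mult[symmetric] del: ennreal_plus)
  qed
  \<comment> \<open>The events \<open>F i\<close> are disjoint, so their probabilities add up to at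
    most 1 and no factor \<open>card U\<close> appears.\<close>
  also have "\<dots> = ?c * measure ?P (\<Union>i\<in>U. F i)"
  proof -
    have "disjoint_family_on F U"
      by (auto simp: disjoint_family_on_def F_def) (metis linorder_neqE_nat)+
    then have "measure ?P (\<Union>i\<in>U. F i) = (\<Sum>i\<in>U. measure ?P (F i))"
      using F U by (intro P.finite_measure_finite_Union) auto
    then show ?thesis by (simp add: sum_distrib_left)
  qed
  also have "\<dots> \<le> ?c" using c0 by (intro mult_left_le P.prob_le_1)
  finally show ?thesis .
qed

end

section \<open>Sharing hash functions between tables\<close>

text \<open>The weight is a product over the coordinates, so the sum factors; in each coordinate one
  value has weight \<open>\<theta>\<close> and the other \<open>m - 1\<close> have weight 1. Divided
  by \<open>m ^ k\<close> this is the mean weight of the overlap of a random choice with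
  \<open>u\<close>.\<close>

lemma sum_PiE_power_card:
  fixes \<theta> :: real and m k :: nat
  assumes u: "\<And>j. j < k \<Longrightarrow> u j < m"
  shows "(\<Sum>f\<in>{..<k} \<rightarrow>\<^sub>E {..<m}. \<theta> ^ card {j. j < k \<and> f j = u j}) = (real m - 1 + \<theta>) ^ k"
proof -
  have "(\<Sum>f\<in>{..<k} \<rightarrow>\<^sub>E {..<m}. \<theta> ^ card {j. j < k \<and> f j = u j}) =
      (\<Sum>f\<in>{..<k} \<rightarrow>\<^sub>E {..<m}. \<Prod>j<k. if f j = u j then \<theta> else 1)"
    by (intro sum.cong refl) (simp add: prod.If_cases Int_def)
  also have "\<dots> = (\<Prod>j<k. \<Sum>c<m. if c = u j then \<theta> else 1)"
    by (simp add: prod_sum_PiE)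
  also have "\<dots> = (\<Prod>j<k. real m - 1 + \<theta>)"
  proof (rule prod.cong[OF refl])
    fix j assume "j \<in> {..<k}"
    then have "u j \<in> {..<m}" using u by simp
    then have "(\<Sum>c<m. if c = u j then \<theta> else 1) = \<theta> + (\<Sum>c\<in>{..<m} - {u j}. 1)"
      by (subst sum.remove[of _ "u j"]) (auto intro!: sum.cong)
    also have "\<dots> = real m - 1 + \<theta>"
      using \<open>u j \<in> {..<m}\<close> by (simp add: card_Diff_singleton of_nat_diff)
    finally show "(\<Sum>c<m. if c = u j then \<theta> else 1) = real m - 1 + \<theta>" .
  qed
  finally show ?thesis by simp
qed

text \<open>
  Greedy choice: averaged over all functions, the cost of the next table against the previous
  ones is exactly the bound.
\<close>

lemma exists_sparse_family:
  fixes \<theta> :: real and m k n :: nat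
  assumes m: "0 < m"
  shows "\<exists>v. (\<forall>l<n. \<forall>j<k. v l j < m) \<and>
    (\<forall>l<n. (\<Sum>l'<l. \<theta> ^ card {j. j < k \<and> v l j = v l' j}) \<le> l * (1 + (\<theta> - 1) / m) ^ k)"
proof (induction n)
  case (Suc n)
  then obtain v where v: "\<forall>l<n. \<forall>j<k. v l j < m"
    "\<forall>l<n. (\<Sum>l'<l. \<theta> ^ card {j. j < k \<and> v l j = v l' j}) \<le> l * (1 + (\<theta> - 1) / m) ^ k" by blast
  let ?F = "{..<k} \<rightarrow>\<^sub>E {..<m}"
  let ?g = "\<lambda>f. \<Sum>l'<n. \<theta> ^ card {j. j < k \<and> f j = v l' j}"
  have fin: "finite ?F" by (intro finite_PiE) auto
  have card: "card ?F = m ^ k" by (simp add: card_PiE)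
  have "(\<Sum>f\<in>?F. ?g f) = (\<Sum>l'<n. \<Sum>f\<in>?F. \<theta> ^ card {j. j < k \<and> f j = v l' j})"
    by (rule sum.swap)
  also have "\<dots> = n * (real m - 1 + \<theta>) ^ k"
    using v(1) by (simp add: sum_PiE_power_card)
  also have "\<dots> = (\<Sum>f\<in>?F. n * (1 + (\<theta> - 1) / m) ^ k)"
  proof -
    have "real m - 1 + \<theta> = m * (1 + (\<theta> - 1) / m)" using m by (simp add: field_simps)
    then show ?thesis by (simp add: card power_mult_distrib)
  qed
  finally have s: "(\<Sum>f\<in>?F. ?g f) = (\<Sum>f\<in>?F. n * (1 + (\<theta> - 1) / m) ^ k)" .
  have "\<exists>f\<in>?F. ?g f \<le> n * (1 + (\<theta> - 1) / m) ^ k"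
  proof (rule ccontr)
    assume "\<not> ?thesis"
    then have "\<forall>f\<in>?F. n * (1 + (\<theta> - 1) / m) ^ k < ?g f" by auto
    moreover have "?F \<noteq> {}" using m by (simp add: PiE_eq_empty_iff lessThan_empty_iff)
    ultimately have "(\<Sum>f\<in>?F. n * (1 + (\<theta> - 1) / m) ^ k) < (\<Sum>f\<in>?F. ?g f)"
      using fin by (intro sum_strict_mono) auto
    with s show False by simp
  qed
  then obtain f where f: "f \<in> ?F" "?g f \<le> n * (1 + (\<theta> - 1) / m) ^ k" by blast
  show ?case
  proof (intro exI[of _ "v(n := f)"] conjI allI impI)
    fix l j assume "l < Suc n" "j < k"
    then show "(v(n := f)) l j < m" using v(1) f(1) by (auto simp: less_Suc_eq PiE_iff)
  next
    fix l assume "l < Suc n"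
    then show "(\<Sum>l'<l. \<theta> ^ card {j. j < k \<and> (v(n := f)) l j = (v(n := f)) l' j}) \<le>
        l * (1 + (\<theta> - 1) / m) ^ k"
      using v(2) f(2) by (cases "l = n") auto
  qed
qed simp

lemma power_le_one_plus:
  fixes x :: real
  assumes "0 \<le> x" "k * x \<le> 1 / 32"
  shows "(1 + x) ^ k \<le> 1 + 1 / 16"
proof -
  have "(1 + x) ^ k \<le> exp x ^ k"
    using assms by (intro power_mono) (auto simp: exp_ge_add_one_self)
  also have "\<dots> = exp (k * x)" by (simp add: exp_of_nat_mult)
  also have "\<dots> \<le> exp (1 / 32)" using assms by simp
  also have "\<dots> \<le> 1 + 1 / 32 + (1 / 32)\<^sup>2" by (rule exp_bound) auto
  also have "\<dots> \<le> 1 + 1 / 16" by (simp add: power2_eq_square)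
  finally show ?thesis .
qed

lemma sum_symmetric_pairs:
  fixes g :: "nat \<Rightarrow> nat \<Rightarrow> real"
  assumes "\<And>i j. g i j = g j i"
  shows "(\<Sum>i<n. \<Sum>j<n. g i j) = (\<Sum>i<n. g i i) + 2 * (\<Sum>i<n. \<Sum>j<i. g i j)"
proof (induction n)
  case (Suc n)
  have "(\<Sum>i<n. g i n) = (\<Sum>i<n. g n i)" by (intro sum.cong refl assms)
  then show ?case using Suc by (simp add: sum.distrib)
qed simp

text \<open>The diagonal pairs contribute \<open>n * \<theta> ^ k\<close>, at most
  \<open>n\<^sup>2 / 16\<close> because of the factor 16 in the number of tables. Every other pair
  is counted twice by the greedy bound, whose excess \<open>(1 + (\<theta> - 1) / m) ^ k\<close> is
  at most \<open>exp (1 / 32) \<le> 1 + 1 / 16\<close> because of the factor 32 in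
  \<open>m\<close>.\<close>

lemma exists_sparse_design:
  fixes \<theta> :: real and m k n :: nat
  assumes \<theta>: "1 \<le> \<theta>" and m: "0 < m" "32 * k * \<theta> \<le> m" and n: "16 * \<theta> ^ k \<le> n"
  shows "\<exists>v. (\<forall>l<n. \<forall>j<k. v l j < m) \<and>
    (\<Sum>l<n. \<Sum>l'<n. \<theta> ^ card {j. j < k \<and> v l j = v l' j}) \<le> (1 + 1 / 8) * (real n)\<^sup>2"
proof -
  let ?r = "(1 + (\<theta> - 1) / m) ^ k"
  obtain v where v: "\<forall>l<n. \<forall>j<k. v l j < m"
    "\<forall>l<n. (\<Sum>l'<l. \<theta> ^ card {j. j < k \<and> v l j = v l' j}) \<le> l * ?r"
    using exists_sparse_family[OF m(1)] by blast
  have "k * ((\<theta> - 1) / m) \<le> k * \<theta> / m"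
    using m by (simp add: divide_right_mono mult_left_mono)
  also have "\<dots> \<le> 1 / 32" using m by (simp add: field_simps)
  finally have r: "?r \<le> 1 + 1 / 16"
    using \<theta> by (intro power_le_one_plus) auto
  have "(\<Sum>l<n. \<Sum>l'<n. \<theta> ^ card {j. j < k \<and> v l j = v l' j}) =
      (\<Sum>l<n. \<theta> ^ k) + 2 * (\<Sum>l<n. \<Sum>l'<l. \<theta> ^ card {j. j < k \<and> v l j = v l' j})"
  proof -
    have "\<theta> ^ card {j. j < k \<and> v i j = v i' j} = \<theta> ^ card {j. j < k \<and> v i' j = v i j}" for i i'
      by (simp add: eq_commute)
    from sum_symmetric_pairs[of "\<lambda>i i'. \<theta> ^ card {j. j < k \<and> v i j = v i' j}", OF this]
    show ?thesis by simp
  qed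
  also have "\<dots> \<le> n * \<theta> ^ k + 2 * (\<Sum>l<n. real l * ?r)"
    using v(2) by (auto intro!: sum_mono)
  also have "\<dots> = n * \<theta> ^ k + 2 * (\<Sum>l<n. real l) * ?r" by (simp add: sum_distrib_right)
  also have "2 * (\<Sum>l<n. real l) = real n * (real n - 1)"
    by (induction n) (auto simp: algebra_simps)
  also have "n * \<theta> ^ k + real n * (real n - 1) * ?r \<le> n * (n / 16) + real n * real n * (1 + 1 / 16)"
    using n r \<theta> by (intro add_mono mult_mono mult_left_mono) auto
  also have "\<dots> = (1 + 1 / 8) * (real n)\<^sup>2" by (simp add: power2_eq_square field_simps)
  finally show ?thesis using v(1) by blast
qed

section \<open>Realizing families of sets by groups\<close>

lemma used_append: "used c (gs @ hs) l = used c gs l \<union> used (c + hashes gs) hs l"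
  by (induction gs arbitrary: c) (auto simp: add.assoc)

lemma hashes_append: "hashes (gs @ hs) = hashes gs + hashes hs"
  by (simp add: hashes_def)

lemma encode_append: "encode (gs @ hs) = encode gs @ encode hs"
  by (simp add: encode_def)

lemma used_singletons:
  "used c (map (\<lambda>h. (1, f h)) [0..<d]) l = {c + h | h. h < d \<and> l \<in> set (f h)}"
proof (induction d)
  case (Suc d)
  have "hashes (map (\<lambda>h. (1, f h)) [0..<d]) = d"
    by (simp add: hashes_def o_def sum_list_triv)
  then show ?case using Suc by (auto simp: used_append less_Suc_eq)
qed simp

lemma used_blocks:
  "used c (map (\<lambda>i. (b, [s + i])) [0..<d]) l =
     (if s \<le> l \<and> l < s + d then {c + (l - s) * b..<c + (l - s) * b + b} else {})"
proof (induction d)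
  case (Suc d)
  have "hashes (map (\<lambda>i. (b, [s + i])) [0..<d]) = d * b"
    by (simp add: hashes_def o_def sum_list_triv)
  then show ?case using Suc by (auto simp: used_append)
qed simp

text \<open>One group per function, listing the tables that use it: the transposed incidence lists
  of the sets \<open>V l\<close>. Any family can be represented in this way, at the price of two
  words per function in addition to one per incidence.\<close>

definition dense_groups :: "nat \<Rightarrow> nat \<Rightarrow> (nat \<Rightarrow> nat set) \<Rightarrow> (nat \<times> nat list) list" where
  "dense_groups d t V = map (\<lambda>h. (1, filter (\<lambda>l. h \<in> V l) [0..<t])) [0..<d]"

lemma used_dense_groups:
  assumes "l < t" "V l \<subseteq> {..<d}"
  shows "used 0 (dense_groups d t V) l = V l"
  unfolding dense_groups_def used_singletons using assms by auto

lemma wf_dense_groups: "wf_groups t (dense_groups d t V)"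
  by (auto simp: wf_groups_def dense_groups_def)

lemma hashes_dense_groups: "hashes (dense_groups d t V) = d"
  by (simp add: dense_groups_def hashes_def o_def sum_list_triv)

lemma length_encode_dense_groups:
  assumes "\<And>l. l < t \<Longrightarrow> V l \<subseteq> {..<d}"
  shows "length (encode (dense_groups d t V)) = 2 * d + (\<Sum>l<t. card (V l))"
proof -
  have "length (filter (\<lambda>l. h \<in> V l) [0..<t]) = (\<Sum>l<t. of_bool (h \<in> V l))" for h
  proof -
    have "length (filter (\<lambda>l. h \<in> V l) [0..<t]) = card (set (filter (\<lambda>l. h \<in> V l) [0..<t]))"
      by (intro distinct_card[symmetric] distinct_filter distinct_upt)
    also have "set (filter (\<lambda>l. h \<in> V l) [0..<t]) = {l\<in>{..<t}. h \<in> V l}" by auto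
    finally show ?thesis by (simp add: of_bool_def sum.If_cases Int_def)
  qed
  then have "length (encode (dense_groups d t V)) = (\<Sum>h<d. 2 + (\<Sum>l<t. of_bool (h \<in> V l)))"
    unfolding encode_def dense_groups_def
    by (simp add: length_concat o_def interv_sum_list_conv_sum_set_nat atLeast0LessThan)
  also have "\<dots> = 2 * d + (\<Sum>h<d. \<Sum>l<t. of_bool (h \<in> V l))"
    by (simp only: sum.distrib sum_constant card_lessThan of_nat_id mult.commute)
  also have "(\<Sum>h<d. \<Sum>l<t. of_bool (h \<in> V l)) = (\<Sum>l<t. \<Sum>h<d. of_bool (h \<in> V l) :: nat)"
    by (rule sum.swap)
  also have "\<dots> = (\<Sum>l<t. card (V l))"
  proof (rule sum.cong[OF refl])
    fix l assume "l \<in> {..<t}"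
    then have "{h\<in>{..<d}. h \<in> V l} = V l" using assms by auto
    then show "(\<Sum>h<d. of_bool (h \<in> V l)) = card (V l)"
      by (simp add: of_bool_def sum.If_cases Int_def)
  qed
  finally show ?thesis .
qed

text \<open>The functions are arranged in rows of length \<open>m\<close>; a table takes one
  function from each of \<open>k\<close> rows, beginning with row \<open>s\<close>. The overlap of
  two tables is then the number of rows in which their choices agree.\<close>

definition grid :: "nat \<Rightarrow> nat \<Rightarrow> nat \<Rightarrow> (nat \<Rightarrow> nat) \<Rightarrow> nat set" where
  "grid s m k f = (\<lambda>j. (s + j) * m + f j) ` {..<k}"

lemma grid_eq_iff:
  fixes a b m c d :: nat
  assumes "c < m" "d < m"
  shows "a * m + c = b * m + d \<longleftrightarrow> a = b \<and> c = d"
  using assms by (metis add.commute add_diff_cancel_right' div_mult_self3 div_less add_0 less_nat_zero_code mult.commute)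

lemma grid_card:
  assumes "\<And>j. j < k \<Longrightarrow> f j < m"
  shows "card (grid s m k f) = k"
  unfolding grid_def using assms by (subst card_image) (auto intro!: inj_onI simp: grid_eq_iff)

lemma grid_Int_card:
  assumes "\<And>j. j < k \<Longrightarrow> f j < m" "\<And>j. j < k \<Longrightarrow> g j < m"
  shows "card (grid s m k f \<inter> grid s m k g) = card {j. j < k \<and> f j = g j}"
proof -
  have eq: "grid s m k f \<inter> grid s m k g = (\<lambda>j. (s + j) * m + f j) ` {j. j < k \<and> f j = g j}"
    unfolding grid_def using assms by (auto simp: grid_eq_iff image_iff)
  show ?thesis unfolding eq using assms
    by (subst card_image) (auto intro!: inj_onI simp: grid_eq_iff)
qed

lemma grid_subset:
  assumes "\<And>j. j < k \<Longrightarrow> f j < m" "s + k \<le> n"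
  shows "grid s m k f \<subseteq> {s * m..<n * m}"
proof
  fix x assume "x \<in> grid s m k f"
  then obtain j where j: "j < k" "x = (s + j) * m + f j" by (auto simp: grid_def)
  have "x < (s + j) * m + m" using j assms(1) by simp
  also have "\<dots> = Suc (s + j) * m" by simp
  also have "\<dots> \<le> n * m" using j assms(2) by (intro mult_le_mono1) simp
  finally show "x \<in> {s * m..<n * m}" using j by (auto simp: add_mult_distrib)
qed

text \<open>A run of consecutive functions per table is a single group of three words, so this
  encoding does not grow with the number of functions. Different tables have overlap 0 and
  contribute 1 each; only the diagonal adds an excess.\<close>

lemma exists_design_fresh:
  fixes \<theta> :: real
  assumes \<theta>: "1 \<le> \<theta>" and A: "16 * \<theta> ^ k1 \<le> A" and B: "16 * \<theta> ^ k2 \<le> B"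
  shows "\<exists>gs. wf_groups (A + B) gs \<and>
    (\<forall>i<A. card (used 0 gs i) = k1) \<and> (\<forall>j<B. card (used 0 gs (A + j)) = k2) \<and>
    (\<forall>i<A. \<forall>j<B. used 0 gs i \<inter> used 0 gs (A + j) = {}) \<and>
    (\<Sum>l<A. \<Sum>l'<A. \<theta> ^ card (used 0 gs l \<inter> used 0 gs l')) \<le> (1 + 1 / 8) * (real A)\<^sup>2 \<and>
    (\<Sum>l<B. \<Sum>l'<B. \<theta> ^ card (used 0 gs (A + l) \<inter> used 0 gs (A + l'))) \<le> (1 + 1 / 8) * (real B)\<^sup>2 \<and>
    hashes gs = A * k1 + B * k2 \<and> length (encode gs) = 3 * (A + B)"
proof -
  define gs where "gs = map (\<lambda>i. (k1, [0 + i])) [0..<A] @ map (\<lambda>j. (k2, [A + j])) [0..<B]"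
  have h: "hashes (map (\<lambda>i. (k1, [0 + i])) [0..<A]) = A * k1"
    "hashes (map (\<lambda>j. (k2, [A + j])) [0..<B]) = B * k2"
    by (simp_all add: hashes_def o_def sum_list_triv)
  have l: "used 0 gs i = {i * k1..<i * k1 + k1}" if "i < A" for i
    unfolding gs_def used_append h used_blocks using that by simp
  have r: "used 0 gs (A + j) = {A * k1 + j * k2..<A * k1 + j * k2 + k2}" if "j < B" for j
    unfolding gs_def used_append h used_blocks using that by simp
  have disj: "{c + i * k..<c + i * k + k} \<inter> {c + i' * k..<c + i' * k + k} = {}" if ne: "i \<noteq> i'" for i i' k c :: nat
  proof -
    have le: "x * k + k \<le> y * k" if "x < y" for x y :: nat
      using mult_le_mono1[of "Suc x" y k] that by simp
    consider "i < i'" | "i' < i" using ne by linarith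
    then show ?thesis
    proof cases
      case 1
      from le[OF 1] show ?thesis by auto
    next
      case 2
      from le[OF 2] show ?thesis by auto
    qed
  qed
  have lr: "i * k1 + k1 \<le> A * k1" if "i < A" for i
    using mult_le_mono1[of "Suc i" A k1] that by simp
  have pairs: "(\<Sum>l<n. \<Sum>l'<n. \<theta> ^ card ({c + l * k..<c + l * k + k} \<inter> {c + l' * k..<c + l' * k + k}))
      \<le> (1 + 1 / 8) * (real n)\<^sup>2" if n: "16 * \<theta> ^ k \<le> n" for n k c :: nat
  proof -
    have "(\<Sum>l<n. \<Sum>l'<n. \<theta> ^ card ({c + l * k..<c + l * k + k} \<inter> {c + l' * k..<c + l' * k + k}))
        \<le> (\<Sum>l<n. \<Sum>l'<n. 1 + (if l' = l then \<theta> ^ k else 0))"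
    proof (intro sum_mono)
      fix l l'
      show "\<theta> ^ card ({c + l * k..<c + l * k + k} \<inter> {c + l' * k..<c + l' * k + k}) \<le>
          1 + (if l' = l then \<theta> ^ k else 0)"
      proof (cases "l' = l")
        case False
        then have "{c + l * k..<c + l * k + k} \<inter> {c + l' * k..<c + l' * k + k} = {}"
          by (intro disj) simp
        then show ?thesis using False by (simp only: card.empty power_0) simp
      qed simp
    qed
    also have "\<dots> = real n * real n + real n * \<theta> ^ k"
      by (simp add: sum.distrib algebra_simps)
    also have "\<dots> \<le> real n * real n + real n * (n / 8)"
    proof -
      have "0 \<le> \<theta> ^ k" using \<theta> by simp
      then have "\<theta> ^ k \<le> n / 8" using n by simp
      then show ?thesis by (simp only: add_left_mono mult_left_mono of_nat_0_le_iff)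
    qed
    also have "\<dots> = (1 + 1 / 8) * (real n)\<^sup>2" by (simp add: power2_eq_square field_simps)
    finally show ?thesis .
  qed
  show ?thesis
  proof (intro exI[of _ gs] conjI allI impI)
    show "wf_groups (A + B) gs" by (auto simp: wf_groups_def gs_def)
    show "used 0 gs i \<inter> used 0 gs (A + j) = {}" if "i < A" "j < B" for i j
      using lr[OF that(1)] by (auto simp: l[OF that(1)] r[OF that(2)])
    show "(\<Sum>l<A. \<Sum>l'<A. \<theta> ^ card (used 0 gs l \<inter> used 0 gs l')) \<le> (1 + 1 / 8) * (real A)\<^sup>2"
      using pairs[OF A, of 0] by (simp add: l)
    show "(\<Sum>l<B. \<Sum>l'<B. \<theta> ^ card (used 0 gs (A + l) \<inter> used 0 gs (A + l'))) \<le> (1 + 1 / 8) * (real B)\<^sup>2"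
      using pairs[OF B, of "A * k1"] by (simp add: r)
    show "hashes gs = A * k1 + B * k2" by (simp add: gs_def hashes_append h[simplified])
    show "length (encode gs) = 3 * (A + B)"
      by (simp add: gs_def encode_append) (simp add: encode_def length_concat o_def sum_list_triv)
  qed (simp_all add: l r)
qed

text \<open>Left tables choose from the first \<open>k1\<close> rows of the grid and right tables
  from the remaining \<open>k2\<close> rows, which makes the sides disjoint; within a side the
  choices come from \<open>exists_sparse_design\<close>.\<close>

lemma exists_design_shared:
  fixes \<theta> :: real
  assumes \<theta>: "1 \<le> \<theta>" and A: "16 * \<theta> ^ k1 \<le> A" and B: "16 * \<theta> ^ k2 \<le> B"
    and m: "0 < m" "32 * (k1 + k2) * \<theta> \<le> m"
  shows "\<exists>gs. wf_groups (A + B) gs \<and>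
    (\<forall>i<A. card (used 0 gs i) = k1) \<and> (\<forall>j<B. card (used 0 gs (A + j)) = k2) \<and>
    (\<forall>i<A. \<forall>j<B. used 0 gs i \<inter> used 0 gs (A + j) = {}) \<and>
    (\<Sum>l<A. \<Sum>l'<A. \<theta> ^ card (used 0 gs l \<inter> used 0 gs l')) \<le> (1 + 1 / 8) * (real A)\<^sup>2 \<and>
    (\<Sum>l<B. \<Sum>l'<B. \<theta> ^ card (used 0 gs (A + l) \<inter> used 0 gs (A + l'))) \<le> (1 + 1 / 8) * (real B)\<^sup>2 \<and>
    hashes gs = (k1 + k2) * m \<and> length (encode gs) = 2 * ((k1 + k2) * m) + (A * k1 + B * k2)"
proof -
  have m1: "32 * k1 * \<theta> \<le> m" "32 * k2 * \<theta> \<le> m"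
    using m(2) \<theta> by (auto simp: algebra_simps intro: order_trans[rotated])
  obtain f where f: "\<And>l j. l < A \<Longrightarrow> j < k1 \<Longrightarrow> f l j < m"
    "(\<Sum>l<A. \<Sum>l'<A. \<theta> ^ card {j. j < k1 \<and> f l j = f l' j}) \<le> (1 + 1 / 8) * (real A)\<^sup>2"
    using exists_sparse_design[OF \<theta> m(1) m1(1) A] by blast
  obtain g where g: "\<And>l j. l < B \<Longrightarrow> j < k2 \<Longrightarrow> g l j < m"
    "(\<Sum>l<B. \<Sum>l'<B. \<theta> ^ card {j. j < k2 \<and> g l j = g l' j}) \<le> (1 + 1 / 8) * (real B)\<^sup>2"
    using exists_sparse_design[OF \<theta> m(1) m1(2) B] by blast
  let ?d = "(k1 + k2) * m"
  define V where "V l = (if l < A then grid 0 m k1 (f l) else grid k1 m k2 (g (l - A)))" for l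
  define gs where "gs = dense_groups ?d (A + B) V"
  have sl: "V l \<subseteq> {..<k1 * m}" if "l < A" for l
    using grid_subset[of k1 "f l" m 0 k1] f(1) that by (auto simp: V_def)
  have sr: "V (A + j) \<subseteq> {k1 * m..<?d}" if "j < B" for j
    using grid_subset[of k2 "g j" m k1 "k1 + k2"] g(1) that by (auto simp: V_def)
  have V: "V l \<subseteq> {..<?d}" if "l < A + B" for l
  proof (cases "l < A")
    case True
    then show ?thesis using sl[OF True] by (auto simp: add_mult_distrib intro: less_le_trans)
  next
    case False
    then show ?thesis using sr[of "l - A"] that by fastforce
  qed
  have u: "used 0 gs l = V l" if "l < A + B" for l
    unfolding gs_def by (rule used_dense_groups[of l "A + B" V ?d, OF that V[OF that]])
  have cl: "card (V i) = k1" if "i < A" for i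
    using that f(1) by (simp add: V_def grid_card)
  have cr: "card (V (A + j)) = k2" if "j < B" for j
    using that g(1) by (simp add: V_def grid_card)
  show ?thesis
  proof (intro exI[of _ gs] conjI allI impI)
    show "wf_groups (A + B) gs" unfolding gs_def by (rule wf_dense_groups)
    show "used 0 gs i \<inter> used 0 gs (A + j) = {}" if "i < A" "j < B" for i j
      using sl[OF that(1)] sr[OF that(2)] that by (fastforce simp: u)
    have "(\<Sum>l<A. \<Sum>l'<A. \<theta> ^ card (used 0 gs l \<inter> used 0 gs l')) =
        (\<Sum>l<A. \<Sum>l'<A. \<theta> ^ card {j. j < k1 \<and> f l j = f l' j})"
      using f(1) by (intro sum.cong refl) (simp add: u V_def grid_Int_card)
    with f(2) show "(\<Sum>l<A. \<Sum>l'<A. \<theta> ^ card (used 0 gs l \<inter> used 0 gs l')) \<le> (1 + 1 / 8) * (real A)\<^sup>2"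
      by simp
    have "(\<Sum>l<B. \<Sum>l'<B. \<theta> ^ card (used 0 gs (A + l) \<inter> used 0 gs (A + l'))) =
        (\<Sum>l<B. \<Sum>l'<B. \<theta> ^ card {j. j < k2 \<and> g l j = g l' j})"
      using g(1) by (intro sum.cong refl) (simp add: u V_def grid_Int_card)
    with g(2) show "(\<Sum>l<B. \<Sum>l'<B. \<theta> ^ card (used 0 gs (A + l) \<inter> used 0 gs (A + l'))) \<le> (1 + 1 / 8) * (real B)\<^sup>2"
      by simp
    show "hashes gs = ?d" unfolding gs_def by (rule hashes_dense_groups)
    have "(\<Sum>l<A + b. h l) = (\<Sum>l<A. h l) + (\<Sum>j<b. h (A + j))" for h :: "nat \<Rightarrow> nat" and b
      by (induction b) (simp_all add: add.assoc)
    then have "(\<Sum>l<A + B. card (V l)) = (\<Sum>l<A. card (V l)) + (\<Sum>j<B. card (V (A + j)))"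
      by blast
    also have "\<dots> = A * k1 + B * k2" by (simp add: cl cr)
    finally show "length (encode gs) = 2 * ?d + (A * k1 + B * k2)"
      unfolding gs_def using length_encode_dense_groups[of "A + B" V ?d] V by simp
  qed (simp_all add: u cl cr)
qed

text \<open>All that the probabilistic analysis needs to know about the groups. Disjoint sides
  ensure that a pair of tables uses \<open>k1 + k2\<close> different functions; the excess
  \<open>1 / 8\<close> in each double sum becomes the failure probability of that side.\<close>

definition design ::
  "real \<Rightarrow> nat \<Rightarrow> nat \<Rightarrow> nat \<Rightarrow> nat \<Rightarrow> (nat \<times> nat list) list \<Rightarrow> bool" where
  "design \<theta> k1 k2 A B gs \<longleftrightarrow> wf_groups (A + B) gs \<and>
    (\<forall>i<A. card (used 0 gs i) = k1) \<and> (\<forall>j<B. card (used 0 gs (A + j)) = k2) \<and>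
    (\<forall>i<A. \<forall>j<B. used 0 gs i \<inter> used 0 gs (A + j) = {}) \<and>
    (\<Sum>l<A. \<Sum>l'<A. \<theta> ^ card (used 0 gs l \<inter> used 0 gs l')) \<le> (1 + 1 / 8) * (real A)\<^sup>2 \<and>
    (\<Sum>l<B. \<Sum>l'<B. \<theta> ^ card (used 0 gs (A + l) \<inter> used 0 gs (A + l'))) \<le> (1 + 1 / 8) * (real B)\<^sup>2"

lemma ceiling_bounds:
  fixes x :: real assumes "1 \<le> x" "0 < c"
  shows "c * x \<le> nat \<lceil>c * x\<rceil>" "nat \<lceil>c * x\<rceil> \<le> (c + 1) * x"
proof -
  have "0 < c * x" using assms by simp
  then show "c * x \<le> nat \<lceil>c * x\<rceil>" "nat \<lceil>c * x\<rceil> \<le> (c + 1) * x"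
    using assms(1) by (simp_all add: distrib_right) linarith+
qed

text \<open>
  If \<open>k\<close> is so large that \<open>O(k\<^sup>2/p\<^sub>1)\<close> functions suffice for disjoint tables, these are used:
  storing one word per function would then exceed the space bound. Otherwise there is room
  to store which functions each table uses.
\<close>

lemma exists_design:
  fixes \<theta> R :: real and k :: nat
  assumes \<theta>: "1 \<le> \<theta>" and k: "1 \<le> k" and R: "\<theta> ^ (k - 1) \<le> R"
  defines "k1 \<equiv> k div 2" and "k2 \<equiv> k - k div 2"
  defines "A \<equiv> nat \<lceil>16 * \<theta> ^ k1\<rceil>" and "B \<equiv> nat \<lceil>16 * \<theta> ^ k2\<rceil>"
  shows "\<exists>gs. design \<theta> k1 k2 A B gs \<and> hashes gs \<le> 33 * (real k)\<^sup>2 * \<theta> \<and>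
    length (encode gs) \<le> 102 * R * \<theta>"
proof -
  have k12: "k1 + k2 = k" "1 \<le> k2" "k1 \<le> k2" "2 * (k2 - 1) \<le> k - 1"
    using k by (auto simp: k1_def k2_def)
  have mono: "\<theta> ^ i \<le> \<theta> ^ j" if "i \<le> j" for i j using that \<theta> by (rule power_increasing)
  have one: "1 \<le> \<theta> ^ i" for i using \<theta> by (rule one_le_power)
  have A: "16 * \<theta> ^ k1 \<le> A" "A \<le> 17 * \<theta> ^ k1"
    using ceiling_bounds[OF one[of k1], of 16] by (auto simp: A_def)
  have B: "16 * \<theta> ^ k2 \<le> B" "B \<le> 17 * \<theta> ^ k2"
    using ceiling_bounds[OF one[of k2], of 16] by (auto simp: B_def)
  have kk: "\<theta> ^ k2 = \<theta> * \<theta> ^ (k2 - 1)" "\<theta> ^ k = \<theta> * \<theta> ^ (k - 1)"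
    using k12 k by (metis One_nat_def Suc_pred less_le_trans less_numeral_extra(1) power_Suc)+
  have Ak: "A * k1 + B * k2 \<le> 17 * \<theta> * (\<theta> ^ (k2 - 1) * k)"
  proof -
    have "real A * k1 \<le> 17 * \<theta> ^ k2 * k1"
      using A(2) mono[OF k12(3)] by (intro mult_right_mono) auto
    moreover have "real B * k2 \<le> 17 * \<theta> ^ k2 * k2"
      using B(2) by (intro mult_right_mono) auto
    ultimately have "real A * k1 + real B * k2 \<le> 17 * \<theta> ^ k2 * (k1 + k2)"
      by (simp add: algebra_simps)
    then show ?thesis unfolding k12(1) kk by (simp add: algebra_simps)
  qed
  show ?thesis
  \<comment> \<open>Disjoint tables use about \<open>\<theta> * \<theta> ^ (k2 - 1) * k\<close>
    functions by \<open>Ak\<close>, which is of order \<open>k\<^sup>2 * \<theta>\<close> below the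
    threshold. Above it, \<open>k\<^sup>2\<close> is at most
    \<open>\<theta> ^ (2 * (k2 - 1))\<close>, hence at most
    \<open>\<theta> ^ (k - 1) \<le> R\<close>, and words for every shared function fit into the
    space bound.\<close>
  proof (cases "\<theta> ^ (k2 - 1) \<le> k")
    case True
    obtain gs where gs: "design \<theta> k1 k2 A B gs" "hashes gs = A * k1 + B * k2"
      "length (encode gs) = 3 * (A + B)"
      using exists_design_fresh[OF \<theta> A(1) B(1)] unfolding design_def by blast
    have "17 * \<theta> * (\<theta> ^ (k2 - 1) * k) \<le> 17 * \<theta> * (real k * k)"
      using True \<theta> by (intro mult_left_mono mult_right_mono) auto
    also have "\<dots> \<le> 33 * (real k)\<^sup>2 * \<theta>" using \<theta> by (simp add: power2_eq_square)
    finally have "hashes gs \<le> 33 * (real k)\<^sup>2 * \<theta>" using Ak gs(2) by simp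
    moreover have "length (encode gs) \<le> 102 * R * \<theta>"
    proof -
      have "real A \<le> 17 * \<theta> ^ k" "real B \<le> 17 * \<theta> ^ k"
        using A(2) B(2) mono[of k1 k] mono[of k2 k] k12 by auto
      \<comment> \<open>The constant is \<open>102 = 3 * (17 + 17)\<close>; the shared design needs
        only \<open>66 + 17\<close>.\<close>
      then have "3 * (real A + real B) \<le> 102 * \<theta> ^ k" by simp
      also have "\<dots> \<le> 102 * R * \<theta>" unfolding kk using R \<theta> by simp
      finally show ?thesis using gs(3) by simp
    qed
    ultimately show ?thesis using gs(1) by blast
  next
    case False
    define m where "m = nat \<lceil>32 * (k * \<theta>)\<rceil>"
    have kt: "1 \<le> k * \<theta>" using k \<theta> by (metis mult_mono mult_1 of_nat_1 of_nat_mono order_trans zero_le_one of_nat_0_le_iff)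
    have m: "32 * (k * \<theta>) \<le> m" "m \<le> 33 * (k * \<theta>)"
      using ceiling_bounds[OF kt, of 32] by (auto simp: m_def)
    have "0 < real m" using m(1) kt by linarith
    then have m0: "0 < m" by simp
    have "real k1 + real k2 = k" by (simp flip: k12(1))
    then have m1: "32 * (real k1 + real k2) * \<theta> \<le> m" using m(1) by (simp add: mult.assoc)
    obtain gs where gs: "design \<theta> k1 k2 A B gs" "hashes gs = k * m"
      "length (encode gs) = 2 * (k * m) + (A * k1 + B * k2)"
      using exists_design_shared[OF \<theta> A(1) B(1) m0 m1] unfolding design_def k12(1) by blast
    have km: "real k * m \<le> 33 * (real k)\<^sup>2 * \<theta>"
      using mult_left_mono[OF m(2), of "real k"] by (simp add: power2_eq_square algebra_simps)
    have sq: "\<theta> ^ (k2 - 1) * \<theta> ^ (k2 - 1) \<le> R"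
    proof -
      have "\<theta> ^ (k2 - 1) * \<theta> ^ (k2 - 1) = \<theta> ^ (2 * (k2 - 1))" by (simp add: mult_2 power_add)
      also have "\<dots> \<le> \<theta> ^ (k - 1)" by (rule mono) (rule k12)
      finally show ?thesis using R by simp
    qed
    have "(real k)\<^sup>2 \<le> \<theta> ^ (k2 - 1) * \<theta> ^ (k2 - 1)"
      unfolding power2_eq_square using False \<theta> by (intro mult_mono) auto
    then have k2R: "(real k)\<^sup>2 \<le> R" using sq by simp
    have "\<theta> ^ (k2 - 1) * k \<le> \<theta> ^ (k2 - 1) * \<theta> ^ (k2 - 1)"
      using False \<theta> by (intro mult_left_mono) auto
    then have kR: "\<theta> ^ (k2 - 1) * k \<le> R" using sq by simp
    have "real (length (encode gs)) = 2 * (real k * m) + (real A * k1 + real B * k2)" using gs(3) by simp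
    also have "\<dots> \<le> 2 * (33 * (real k)\<^sup>2 * \<theta>) + 17 * \<theta> * (\<theta> ^ (k2 - 1) * k)"
      using km Ak by simp
    also have "\<dots> \<le> 2 * (33 * R * \<theta>) + 17 * \<theta> * R"
      using k2R kR \<theta> by (intro add_mono mult_left_mono mult_right_mono) auto
    also have "\<dots> \<le> 102 * R * \<theta>"
    proof -
      have "0 \<le> R * \<theta>" using kR \<theta> by (simp add: order_trans[OF _ k2R])
      then show ?thesis by (simp add: algebra_simps)
    qed
    finally show ?thesis using gs(1,2) km by auto
  qed
qed

section \<open>The data structure\<close>

lemma measurable_count_space_map:
  fixes f :: "'b \<Rightarrow> 'a \<Rightarrow> 'c::countable"
  assumes "\<And>x. x \<in> set xs \<Longrightarrow> f x \<in> M \<rightarrow>\<^sub>M count_space UNIV"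
  shows "(\<lambda>\<omega>. map (\<lambda>x. f x \<omega>) xs) \<in> M \<rightarrow>\<^sub>M count_space UNIV"
  using assms
proof (induction xs)
  case (Cons x xs)
  then show ?case
    using measurable_count_space2[where F = Cons, of "f x" M "\<lambda>\<omega>. map (\<lambda>x. f x \<omega>) xs"] by simp
qed simp

text \<open>An event that depends on the outcome only through \<open>Z\<close> is a preimage under
  \<open>Z\<close>. Applied to the finitely many hash words that determine the answer, this makes
  the success event measurable without any analysis of the program.\<close>

lemma sets_Collect_factor:
  assumes Z: "Z \<in> M \<rightarrow>\<^sub>M count_space UNIV"
    and \<Phi>: "\<And>\<omega> \<omega>'. \<omega> \<in> space M \<Longrightarrow> \<omega>' \<in> space M \<Longrightarrow> Z \<omega> = Z \<omega>' \<Longrightarrow> \<Phi> \<omega> \<Longrightarrow> \<Phi> \<omega>'"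
  shows "{\<omega> \<in> space M. \<Phi> \<omega>} \<in> sets M"
proof -
  have "{\<omega> \<in> space M. \<Phi> \<omega>} = Z -` (Z ` {\<omega> \<in> space M. \<Phi> \<omega>}) \<inter> space M"
  proof (intro equalityI subsetI)
    fix \<omega> assume "\<omega> \<in> Z -` (Z ` {\<omega> \<in> space M. \<Phi> \<omega>}) \<inter> space M"
    then obtain \<omega>' where "\<omega>' \<in> space M" "\<Phi> \<omega>'" "Z \<omega> = Z \<omega>'" "\<omega> \<in> space M" by auto
    then show "\<omega> \<in> {\<omega> \<in> space M. \<Phi> \<omega>}" using \<Phi>[of \<omega>' \<omega>] by auto
  qed auto
  then show ?thesis using measurable_sets[OF Z, of "Z ` {\<omega> \<in> space M. \<Phi> \<omega>}"] by simp
qed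

text \<open>Polymorphic in the argument: preprocessing sees the words by point number, the analysis
  evaluates the functions at points of the space.\<close>

definition table_key ::
  "nat \<Rightarrow> nat \<Rightarrow> (nat \<times> nat list) list \<Rightarrow> (nat \<Rightarrow> 'p \<Rightarrow> nat) \<Rightarrow> nat \<Rightarrow> nat \<Rightarrow> 'p \<Rightarrow> nat" where
  "table_key w A gs hv i j p =
     ((\<Sum>h\<in>used 0 gs i. hv h p) + (\<Sum>h\<in>used 0 gs (A + j). hv h p)) mod 2 ^ w"

definition lsh_structure ::
  "nat \<Rightarrow> (nat \<Rightarrow> 'x) \<Rightarrow> nat \<Rightarrow> nat \<Rightarrow> nat \<Rightarrow> nat \<Rightarrow> nat \<Rightarrow> (nat \<times> nat list) list \<Rightarrow> 'x nn_structure" where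
  "lsh_structure w pts n A B W D gs =
     \<lparr> points = pts, hash_count = hashes gs, random_count = 0, space_words = lsh_space A B n gs,
       preprocess = (\<lambda>hv _. lsh_memory A B n W D gs (table_key w A gs hv)) \<rparr>"

locale lsh = hash_setup X H G w
  for X :: "'x set" and H :: "('x \<Rightarrow> 'r::countable) measure" and G w +
  fixes dst :: "'x \<Rightarrow> 'x \<Rightarrow> real" and r2 :: real and pts :: "nat \<Rightarrow> 'x"
    and n A B W D :: nat and gs :: "(nat \<times> nat list) list"
  assumes wf: "wf_groups (A + B) gs"
    and words: "hashes gs < 2 ^ w" "lsh_space A B n gs < 2 ^ w" "W < 2 ^ w" "D < 2 ^ w"
    and pos: "0 < n" "0 < A" "0 < B"
    and pts: "\<And>p. p < n \<Longrightarrow> pts p \<in> X"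
begin

abbreviation S :: "'x nn_structure" where "S \<equiv> lsh_structure w pts n A B W D gs"

abbreviation seeds :: "('x, 'r) seed measure" where "seeds \<equiv> seed_space w H G S"

abbreviation \<Omega> :: "(nat \<Rightarrow> ('x \<Rightarrow> 'r) \<times> ('r \<Rightarrow> nat)) measure" where
  "\<Omega> \<equiv> Pi\<^sub>M {..<hashes gs} (\<lambda>_. N)"

abbreviation tkey :: "('x, 'r) seed \<Rightarrow> nat \<Rightarrow> nat \<Rightarrow> 'x \<Rightarrow> nat" where
  "tkey \<omega> \<equiv> table_key w A gs (sampled_hash \<omega>)"

definition stored_key :: "('x, 'r) seed \<Rightarrow> nat \<Rightarrow> nat \<Rightarrow> nat \<Rightarrow> nat" where
  "stored_key \<omega> = table_key w A gs (\<lambda>i\<in>{..<hashes gs}. \<lambda>j\<in>{..<n}. sampled_hash \<omega> i (pts j))"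

definition answer :: "('x, 'r) seed \<Rightarrow> 'x \<Rightarrow> nat" where
  "answer \<omega> q = snd (snd (fold (visit (\<lambda>p. dst q (pts p) < r2))
     (candidates A B n (stored_key \<omega>) (\<lambda>i j. tkey \<omega> i j q)) (W, D, n)))"

lemma stored_key: "p < n \<Longrightarrow> stored_key \<omega> i j p = tkey \<omega> i j (pts p)"
proof -
  assume p: "p < n"
  have "(\<Sum>h\<in>used 0 gs l. (\<lambda>i\<in>{..<hashes gs}. \<lambda>j\<in>{..<n}. sampled_hash \<omega> i (pts j)) h p) =
      (\<Sum>h\<in>used 0 gs l. sampled_hash \<omega> h (pts p))" for l
    using used_subset[of 0 gs l] p by (intro sum.cong refl) auto
  then show ?thesis by (simp add: stored_key_def table_key_def)
qed

lemma initial_memory_eq: "initial_memory n S \<omega> = lsh_memory A B n W D gs (stored_key \<omega>)"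
  by (simp add: initial_memory_def lsh_structure_def stored_key_def)

lemma initial_memory_word:
  fixes \<omega> :: "('x, 'r) seed"
  shows "initial_memory n S \<omega> a < 2 ^ w"
  unfolding initial_memory_eq
  by (rule lsh_memory_word[OF wf words _ pos(2,3)]) (simp add: stored_key_def table_key_def)

lemma query_run_lsh:
  "\<exists>d t. query_run w n dst r2 lsh_query S q \<omega> (hashes gs) d t (answer \<omega> q) \<and> d \<le> D \<and>
     t \<le> 7 * length (encode gs) + 4 * hashes gs + 20 * W + 62 * (A * B)"
proof -
  let ?M = "query_machine w n dst r2 S q \<omega>"
  have M: "word_len ?M = w" "mem_size ?M = lsh_space A B n gs" "num_hash ?M = hashes gs" "num_points ?M = n"
    "hash_word ?M = (\<lambda>i. sampled_hash \<omega> i q)" "dist_less ?M = (\<lambda>p. dst q (pts p) < r2)"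
    by (simp_all add: query_machine_def lsh_structure_def)
  \<comment> \<open>The query reduces each partial key and then their sum, preprocessing reduces
    only once; both give the same residue, so equal hash values do yield equal keys.\<close>
  have kq: "((\<Sum>h\<in>used 0 gs i. hash_word ?M h) mod 2 ^ w + (\<Sum>h\<in>used 0 gs (A + j). hash_word ?M h) mod 2 ^ w) mod 2 ^ w
      = tkey \<omega> i j q" for i j
    by (simp add: M table_key_def mod_simps)
  from lsh_query[of A B gs ?M n W D "stored_key \<omega>", unfolded M(1) kq]
  have "wp ?M lsh_query (\<lambda>_. 0, initial_memory n S \<omega>) (\<lambda>e d t (\<sigma>', \<mu>'). e = hashes gs \<and> d \<le> D \<and>
     t \<le> 7 * length (encode gs) + 4 * hashes gs + 20 * W + 62 * (A * B) \<and>
     \<mu>' = initial_memory n S \<omega> \<and> \<sigma>' 0 = answer \<omega> q)"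
    using wf words pos by (simp add: M initial_memory_eq answer_def)
  then show ?thesis unfolding wp_def query_run_def by fastforce
qed

text \<open>By determinism the existential quantifier over runs in the success event collapses to a
  statement about \<open>answer\<close>.\<close>

lemma query_run_unique:
  "query_run w n dst r2 lsh_query S q \<omega> e d t out \<Longrightarrow> out = answer \<omega> q"
proof -
  assume "query_run w n dst r2 lsh_query S q \<omega> e d t out"
  moreover obtain d' t' where "query_run w n dst r2 lsh_query S q \<omega> (hashes gs) d' t' (answer \<omega> q)"
    using query_run_lsh by blast
  ultimately obtain \<sigma> \<sigma>' where
    "exec (query_machine w n dst r2 S q \<omega>) lsh_query (\<lambda>_. 0, initial_memory n S \<omega>) e d t (\<sigma>, initial_memory n S \<omega>)"
    "exec (query_machine w n dst r2 S q \<omega>) lsh_query (\<lambda>_. 0, initial_memory n S \<omega>) (hashes gs) d' t' (\<sigma>', initial_memory n S \<omega>)"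
    "out = \<sigma> 0" "answer \<omega> q = \<sigma>' 0"
    unfolding query_run_def by blast
  with exec_deterministic[OF this(1,2)] show ?thesis by simp
qed

text \<open>The first cardinality counts bucket entries that use up a list step without success, the
  second counts matches at far points, which use up a distance computation. Together with one good
  match these are the premises of \<open>visit_success\<close>.\<close>

lemma answer_correct:
  assumes "i < A" "j < B" "p < n" "tkey \<omega> i j (pts p) = tkey \<omega> i j q" "dst q (pts p) < r2"
    and "card {(i, j, p). i < A \<and> j < B \<and> p < n \<and> tkey \<omega> i j (pts p) mod n = tkey \<omega> i j q mod n \<and>
      \<not> (tkey \<omega> i j (pts p) = tkey \<omega> i j q \<and> dst q (pts p) < r2)} < W" (is "card ?bad < W")
    and "card {(i, j, p). i < A \<and> j < B \<and> p < n \<and> tkey \<omega> i j (pts p) = tkey \<omega> i j q \<and>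
      \<not> dst q (pts p) < r2} < D" (is "card ?far < D")
  shows "answer \<omega> q < n \<and> dst q (pts (answer \<omega> q)) < r2"
proof -
  let ?good = "\<lambda>p. dst q (pts p) < r2"
  let ?xs = "candidates A B n (stored_key \<omega>) (\<lambda>i j. tkey \<omega> i j q)"
  have "(True, p) \<in> set ?xs"
    unfolding set_candidates using assms(1-4) by (fastforce simp: stored_key)
  moreover have "length (filter (\<lambda>(match, p). \<not> (match \<and> ?good p)) ?xs) < W"
  proof -
    have "{(i, j, p). i < A \<and> j < B \<and> p < n \<and> stored_key \<omega> i j p mod n = tkey \<omega> i j q mod n \<and>
       (\<lambda>(match, p). \<not> (match \<and> ?good p)) (stored_key \<omega> i j p = tkey \<omega> i j q, p)} = ?bad"
      by (auto simp: stored_key)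
    with assms(6) show ?thesis unfolding length_filter_candidates by simp
  qed
  moreover have "length (filter (\<lambda>(match, p). match \<and> \<not> ?good p) ?xs) < D"
  proof -
    have "{(i, j, p). i < A \<and> j < B \<and> p < n \<and> stored_key \<omega> i j p mod n = tkey \<omega> i j q mod n \<and>
       (\<lambda>(match, p). match \<and> \<not> ?good p) (stored_key \<omega> i j p = tkey \<omega> i j q, p)} = ?far"
      by (auto simp: stored_key)
    with assms(7) show ?thesis unfolding length_filter_candidates by simp
  qed
  ultimately have "answer \<omega> q \<in> {p \<in> snd ` set ?xs. ?good p}"
    unfolding answer_def using assms(5) by (intro visit_success)
  then show ?thesis unfolding set_candidates by auto
qed

lemma seeds_eq: "seeds = \<Omega> \<Otimes>\<^sub>M (\<Pi>\<^sub>M i\<in>{}. uniform_count_measure {..<2 ^ w})"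
  by (simp add: seed_space_def lsh_structure_def)

lemma prob_space_seeds: "prob_space seeds"
proof -
  interpret A: prob_space \<Omega> by (rule prob_space_PiM) (rule prob_space_N)
  interpret B: prob_space "\<Pi>\<^sub>M i\<in>{}. uniform_count_measure {..<2 ^ w} :: nat measure"
    by (rule prob_space_PiM) simp
  interpret pair_prob_space \<Omega> "\<Pi>\<^sub>M i\<in>{}. uniform_count_measure {..<2 ^ w} :: nat measure" ..
  show ?thesis unfolding seeds_eq by unfold_locales
qed

lemma measure_seeds_fst:
  assumes "E \<in> sets \<Omega>"
  shows "{\<omega> \<in> space seeds. fst \<omega> \<in> E} \<in> sets seeds"
    "measure seeds {\<omega> \<in> space seeds. fst \<omega> \<in> E} = measure \<Omega> E"
proof -
  let ?R = "\<Pi>\<^sub>M i\<in>{}. uniform_count_measure {..<2 ^ w} :: nat measure"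
  interpret B: prob_space ?R by (rule prob_space_PiM) simp
  have eq: "{\<omega> \<in> space seeds. fst \<omega> \<in> E} = E \<times> space ?R"
    using sets.sets_into_space[OF assms] by (auto simp: seeds_eq space_pair_measure)
  show "{\<omega> \<in> space seeds. fst \<omega> \<in> E} \<in> sets seeds"
    unfolding eq seeds_eq using assms by simp
  show "measure seeds {\<omega> \<in> space seeds. fst \<omega> \<in> E} = measure \<Omega> E"
    unfolding eq unfolding seeds_eq measure_def using assms
    by (simp add: B.emeasure_pair_measure_Times B.emeasure_space_1)
qed

lemma measurable_sampled_hash:
  assumes "x \<in> X" "h < hashes gs"
  shows "(\<lambda>\<omega>. sampled_hash \<omega> h x) \<in> seeds \<rightarrow>\<^sub>M count_space UNIV"
  unfolding sampled_hash_def seeds_eq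
  using measurable_compose[OF measurable_fst measurable_component_word[of x h "{..<hashes gs}"]] assms
  by simp

lemma success_sets:
  assumes q: "q \<in> X"
  shows "{\<omega> \<in> space seeds. answer \<omega> q < n \<and> dst q (pts (answer \<omega> q)) < r2} \<in> sets seeds"
proof (rule sets_Collect_factor)
  let ?Z = "\<lambda>\<omega>. map (\<lambda>h. map (\<lambda>x. sampled_hash \<omega> h x) (q # map pts [0..<n])) [0..<hashes gs]"
  show "?Z \<in> seeds \<rightarrow>\<^sub>M count_space UNIV"
    using q pts by (intro measurable_count_space_map[where f = "\<lambda>h \<omega>. map (\<lambda>x. sampled_hash \<omega> h x) (q # map pts [0..<n])"]
      measurable_count_space_map[where f = "\<lambda>x \<omega>. sampled_hash \<omega> _ x"] measurable_sampled_hash) auto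
  fix \<omega> \<omega>' :: "('x, 'r) seed" assume Z: "?Z \<omega> = ?Z \<omega>'"
  then have Z': "sampled_hash \<omega> h x = sampled_hash \<omega>' h x" if "h < hashes gs" "x = q \<or> x \<in> pts ` {..<n}" for h x
    using that by (auto simp: map_eq_conv)
  have 1: "stored_key \<omega> = stored_key \<omega>'"
  proof -
    have "(\<lambda>i\<in>{..<hashes gs}. \<lambda>j\<in>{..<n}. sampled_hash \<omega> i (pts j)) =
        (\<lambda>i\<in>{..<hashes gs}. \<lambda>j\<in>{..<n}. sampled_hash \<omega>' i (pts j))"
      using Z' by (auto simp: restrict_def fun_eq_iff)
    then show ?thesis by (simp add: stored_key_def)
  qed
  have 2: "tkey \<omega> i j q = tkey \<omega>' i j q" for i j
  proof -
    have "(\<Sum>h\<in>used 0 gs l. sampled_hash \<omega> h q) = (\<Sum>h\<in>used 0 gs l. sampled_hash \<omega>' h q)" for l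
      using used_subset[of 0 gs l] by (intro sum.cong refl Z') auto
    then show ?thesis by (simp add: table_key_def)
  qed
  have "answer \<omega> q = answer \<omega>' q" unfolding answer_def 1 2 ..
  moreover assume "answer \<omega> q < n \<and> dst q (pts (answer \<omega> q)) < r2"
  ultimately show "answer \<omega>' q < n \<and> dst q (pts (answer \<omega>' q)) < r2" by simp
qed

lemma success_eq:
  "{\<omega> \<in> space seeds. \<exists>e d t out. query_run w n dst r2 lsh_query S q \<omega> e d t out \<and>
      out < n \<and> dst q (points S out) < r2} =
   {\<omega> \<in> space seeds. answer \<omega> q < n \<and> dst q (pts (answer \<omega> q)) < r2}"
proof -
  have "points S = pts" by (simp add: lsh_structure_def)
  then show ?thesis using query_run_lsh query_run_unique by fastforce
qed

text \<open>\<open>F1\<close> and \<open>F2\<close> say that no left, respectively no right, table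
  collides with the near point in all its functions; the second moment bound makes each at most
  \<open>1 / 8\<close>. The budgets are at least eight times the expected counts, so by Markov's
  inequality the exhaustion events \<open>F3\<close> and \<open>F4\<close> are also at most
  \<open>1 / 8\<close> each.\<close>

lemma success_prob:
  assumes q: "q \<in> X" and sens: "sensitive X dst r1 r2 p1 p2 H"
    and p: "0 < p1" "0 \<le> p2" and r: "r1 < r2"
    and des: "design (1 / p1) k1 k2 A B gs"
    and near: "p0 < n" "dst q (pts p0) \<le> r1"
    and D8: "8 * (real A * real B * real n * (p2 ^ (k1 + k2) + 2 / 2 ^ w)) \<le> D" "0 < D"
    and W8: "8 * (real A * real B * real n * (p2 ^ (k1 + k2) + 3 / 2 ^ w + 1 / n)) \<le> W" "0 < W"
  shows "1 / 2 \<le> measure seeds {\<omega> \<in> space seeds. answer \<omega> q < n \<and> dst q (pts (answer \<omega> q)) < r2}"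
    (is "_ \<le> measure seeds ?good")
proof -
  interpret \<Omega>: prob_space \<Omega> by (rule prob_space_PiM) (rule prob_space_N)
  interpret seeds: prob_space seeds by (rule prob_space_seeds)
  let ?I = "{..<hashes gs}"
  let ?L = "\<lambda>i. used 0 gs i" and ?R = "\<lambda>j. used 0 gs (A + j)"
  let ?U = "\<lambda>i j. ?L i \<union> ?R j"
  have sub: "used 0 gs l \<subseteq> ?I" for l using used_subset[of 0 gs l] by auto
  have dj: "?L i \<inter> ?R j = {}" if "i < A" "j < B" for i j
    using des that by (simp add: design_def)
  have cU: "card (?U i j) = k1 + k2" if "i < A" "j < B" for i j
    using des that dj[OF that] by (simp add: design_def card_Un_disjoint)
  have tk: "tkey \<omega> i j x = key (?U i j) (fst \<omega>) x" if "i < A" "j < B" for \<omega> i j x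
    using dj[OF that] by (simp add: table_key_def key_def sampled_hash_def sum.union_disjoint)
  define x0 where "x0 = pts p0"
  have x0: "x0 \<in> X" "dst q x0 \<le> r1" using near pts by (auto simp: x0_def)
  have c0: "p1 \<le> measure N (coll q x0)"
    using sens q x0 measure_coll[OF q x0(1)] by (auto simp: sensitive_def)
  define F1 where "F1 = {\<omega> \<in> space \<Omega>. \<forall>i<A. \<exists>h\<in>?L i. \<omega> h \<notin> coll q x0}"
  define F2 where "F2 = {\<omega> \<in> space \<Omega>. \<forall>j<B. \<exists>h\<in>?R j. \<omega> h \<notin> coll q x0}"
  have F1: "measure \<Omega> F1 \<le> 1 / 8" unfolding F1_def
    by (rule second_moment_PiM[OF prob_space_N _ coll_sets[OF q x0(1)] sub _ pos(2) p(1) c0])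
      (use des in \<open>auto simp: design_def\<close>)
  have F2: "measure \<Omega> F2 \<le> 1 / 8" unfolding F2_def
    by (rule second_moment_PiM[OF prob_space_N _ coll_sets[OF q x0(1)] sub _ pos(3) p(1) c0])
      (use des in \<open>auto simp: design_def\<close>)
  have F12s: "{\<omega> \<in> space \<Omega>. \<forall>i<m. \<exists>h\<in>V i. \<omega> h \<notin> coll q x0} \<in> sets \<Omega>"
    if "\<And>i. V i \<subseteq> ?I" for V and m :: nat
  proof -
    have "{\<omega> \<in> space \<Omega>. \<forall>h\<in>V i. \<omega> h \<in> coll q x0} \<in> sets \<Omega>" for i
      using that[of i] finite_subset[OF that[of i]] coll_sets[OF q x0(1)]
      by (intro sets.sets_Collect_finite_All sets_Collect_single) auto
    moreover have "{\<omega> \<in> space \<Omega>. \<forall>i<m. \<exists>h\<in>V i. \<omega> h \<notin> coll q x0} =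
        space \<Omega> - (\<Union>i\<in>{..<m}. {\<omega> \<in> space \<Omega>. \<forall>h\<in>V i. \<omega> h \<in> coll q x0})" by auto
    ultimately show ?thesis by auto
  qed
  have F1s: "F1 \<in> sets \<Omega>" and F2s: "F2 \<in> sets \<Omega>"
    unfolding F1_def F2_def by (intro F12s sub)+
  let ?J = "{..<A} \<times> {..<B} \<times> {..<n}"
  let ?k = "\<lambda>i j \<omega> x. key (?U i j) \<omega> x"
  define far where "far = (\<lambda>(i, j, p). {\<omega> \<in> space \<Omega>. ?k i j \<omega> q = ?k i j \<omega> (pts p) \<and> \<not> dst q (pts p) < r2})"
  define bad where "bad = (\<lambda>(i, j, p). {\<omega> \<in> space \<Omega>. ?k i j \<omega> q mod n = ?k i j \<omega> (pts p) mod n \<and>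
    \<not> (?k i j \<omega> q = ?k i j \<omega> (pts p) \<and> dst q (pts p) < r2)})"
  have Usub: "?U i j \<subseteq> ?I" for i j using sub by blast
  have mk: "(\<lambda>\<omega>. ?k i j \<omega> x) \<in> \<Omega> \<rightarrow>\<^sub>M count_space UNIV" if "x \<in> X" for i j x
    by (rule measurable_key[OF that _ Usub]) simp
  have far_s: "far t \<in> sets \<Omega>" if "t \<in> ?J" for t
    using that pts unfolding far_def by (auto intro!: sets_Collect_count_space2[OF mk[OF q] mk])
  have bad_s: "bad t \<in> sets \<Omega>" if "t \<in> ?J" for t
    using that pts unfolding bad_def by (auto intro!: sets_Collect_count_space2[OF mk[OF q] mk])
  let ?diff = "\<lambda>i j p T. {\<omega> \<in> space \<Omega>. (\<exists>h\<in>?U i j. fst (\<omega> h) q \<noteq> fst (\<omega> h) (pts p)) \<and>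
      ?k i j \<omega> q mod T = ?k i j \<omega> (pts p) mod T}"
  have diff_s: "?diff i j p T \<in> sets \<Omega>" if "p < n" for i j p T
  proof -
    have "?diff i j p T = (\<Union>h\<in>?U i j. {\<omega> \<in> space \<Omega>. fst (\<omega> h) q \<noteq> fst (\<omega> h) (pts p)}) \<inter>
       {\<omega> \<in> space \<Omega>. ?k i j \<omega> q mod T = ?k i j \<omega> (pts p) mod T}" by auto
    moreover have "{\<omega> \<in> space \<Omega>. ?k i j \<omega> q mod T = ?k i j \<omega> (pts p) mod T} \<in> sets \<Omega>"
      by (rule sets_Collect_count_space2[OF mk[OF q] mk[OF pts[OF that]]])
    moreover have "{\<omega> \<in> space \<Omega>. fst (\<omega> h) q \<noteq> fst (\<omega> h) (pts p)} \<in> sets \<Omega>" if h: "h \<in> ?U i j" for h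
    proof -
      have h: "h \<in> ?I" using h Usub by blast
      show ?thesis
        by (rule sets_Collect_count_space2[OF measurable_component_hash[OF q h]
              measurable_component_hash[OF pts[OF \<open>p < n\<close>] h]])
    qed
    ultimately show ?thesis by (simp only:) (intro sets.Int sets.finite_UN; simp)
  qed
  have diff_m: "measure \<Omega> (?diff i j p T) \<le> 1 / T + 1 / 2 ^ w" if "p < n" "0 < T" for i j p T
    by (rule prob_key_collision[OF q pts[OF that(1)] _ Usub that(2)]) simp
  have far_m: "measure \<Omega> (far t) \<le> p2 ^ (k1 + k2) + 2 / 2 ^ w" if t: "t \<in> ?J" for t
  proof -
    obtain i j p where tt: "t = (i, j, p)" and ij: "i < A" "j < B" "p < n" using t by auto
    show ?thesis
    proof (cases "dst q (pts p) < r2")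
      case True
      then show ?thesis using \<open>0 \<le> p2\<close> by (simp add: far_def tt)
    next
      case False
      let ?E = "{\<omega> \<in> space \<Omega>. \<forall>h\<in>?U i j. \<omega> h \<in> coll q (pts p)}"
      have c: "measure N (coll q (pts p)) \<le> p2"
        using sens q pts[OF ij(3)] False measure_coll[OF q pts[OF ij(3)]] by (auto simp: sensitive_def)
      have "measure \<Omega> ?E = measure N (coll q (pts p)) ^ card (?U i j)"
        by (rule measure_PiM_all[OF prob_space_N _ Usub coll_sets[OF q pts[OF ij(3)]]]) simp
      also have "\<dots> \<le> p2 ^ (k1 + k2)" unfolding cU[OF ij(1,2)] by (intro power_mono c) simp
      finally have E: "measure \<Omega> ?E \<le> p2 ^ (k1 + k2)" .
      have Es: "?E \<in> sets \<Omega>"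
        using Usub[of i j] coll_sets[OF q pts[OF ij(3)]]
        by (intro sets.sets_Collect_finite_All sets_Collect_single) auto
      \<comment> \<open>A far match has one of two causes: all \<open>k1 + k2\<close> functions
        collide, or some function separates the points and the full words agree by accident, with
        probability at most \<open>2 / 2 ^ w\<close>.\<close>
      have "far t \<subseteq> ?E \<union> ?diff i j p (2 ^ w)"
      proof
        fix \<omega> assume \<omega>: "\<omega> \<in> far t"
        then have sp: "\<omega> \<in> space \<Omega>" by (simp add: far_def tt)
        then have "\<omega> h \<in> space N" if "h \<in> ?U i j" for h
          using that Usub[of i j] by (auto simp: space_PiM PiE_iff)
        then show "\<omega> \<in> ?E \<union> ?diff i j p (2 ^ w)"
          using \<omega> sp by (auto simp: far_def tt coll_def)
      qed
      then have "measure \<Omega> (far t) \<le> measure \<Omega> (?E \<union> ?diff i j p (2 ^ w))"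
        using Es diff_s[OF ij(3)] by (intro \<Omega>.finite_measure_mono) auto
      also have "\<dots> \<le> measure \<Omega> ?E + measure \<Omega> (?diff i j p (2 ^ w))"
        by (rule measure_Un_le[OF Es diff_s[OF ij(3)]])
      also have "\<dots> \<le> p2 ^ (k1 + k2) + 2 / 2 ^ w"
        using E diff_m[OF ij(3), of "2 ^ w" i j] by simp
      finally show ?thesis .
    qed
  qed
  have bad_m: "measure \<Omega> (bad t) \<le> p2 ^ (k1 + k2) + 3 / 2 ^ w + 1 / n" if t: "t \<in> ?J" for t
  proof -
    obtain i j p where tt: "t = (i, j, p)" and ij: "i < A" "j < B" "p < n" using t by auto
    \<comment> \<open>If the keys agree, an unsuccessful entry is a far match. If they differ, some
      function separates the points, and sharing the bucket is an accident modulo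
      \<open>n\<close>.\<close>
    have "bad t \<subseteq> far t \<union> ?diff i j p n"
    proof
      fix \<omega> assume \<omega>: "\<omega> \<in> bad t"
      show "\<omega> \<in> far t \<union> ?diff i j p n"
      proof (cases "?k i j \<omega> q = ?k i j \<omega> (pts p)")
        case True
        then show ?thesis using \<omega> by (auto simp: bad_def far_def tt)
      next
        case False
        then have "\<exists>h\<in>?U i j. fst (\<omega> h) q \<noteq> fst (\<omega> h) (pts p)"
          by (auto simp: key_def intro: sum.cong arg_cong[where f = "\<lambda>s. s mod 2 ^ w"])
        then show ?thesis using \<omega> by (auto simp: bad_def tt)
      qed
    qed
    then have "measure \<Omega> (bad t) \<le> measure \<Omega> (far t \<union> ?diff i j p n)"
      using far_s[OF t] diff_s[OF ij(3)] by (intro \<Omega>.finite_measure_mono) auto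
    also have "\<dots> \<le> measure \<Omega> (far t) + measure \<Omega> (?diff i j p n)"
      by (rule measure_Un_le[OF far_s[OF t] diff_s[OF ij(3)]])
    also have "\<dots> \<le> (p2 ^ (k1 + k2) + 2 / 2 ^ w) + (1 / n + 1 / 2 ^ w)"
      by (intro add_mono far_m[OF t] diff_m[OF ij(3) pos(1)])
    finally show ?thesis by simp
  qed
  have eighth: "m \<le> 1 / 8" if "m \<le> s / v" "s \<le> c" "8 * c \<le> v" "0 < v" for m s v c :: real
  proof -
    have "s / v \<le> (v / 8) / v" using that by (intro divide_right_mono) auto
    also have "\<dots> = 1 / 8" using that by simp
    finally show ?thesis using that(1) by (rule order_trans[rotated])
  qed
  have cJ: "real (card ?J) = real A * real B * real n" by (simp add: card_cartesian_product)
  define F3 where "F3 = {\<omega> \<in> space \<Omega>. real W \<le> card {t \<in> ?J. \<omega> \<in> bad t}}"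
  define F4 where "F4 = {\<omega> \<in> space \<Omega>. real D \<le> card {t \<in> ?J. \<omega> \<in> far t}}"
  have count_s: "{\<omega> \<in> space \<Omega>. c \<le> real (card {t \<in> ?J. \<omega> \<in> Ev t})} \<in> sets \<Omega>"
    if Ev: "\<And>t. t \<in> ?J \<Longrightarrow> Ev t \<in> sets \<Omega>" for Ev c
  proof -
    have "real (card {t \<in> ?J. \<omega> \<in> Ev t}) = (\<Sum>t\<in>?J. indicator (Ev t) \<omega>)" for \<omega>
      by (simp add: indicator_def sum.If_cases Int_def)
    moreover have "(\<lambda>\<omega>. \<Sum>t\<in>?J. indicator (Ev t) \<omega> :: real) \<in> borel_measurable \<Omega>"
      using Ev by (intro borel_measurable_sum borel_measurable_indicator) auto
    ultimately show ?thesis by simp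
  qed
  have F3s: "F3 \<in> sets \<Omega>" unfolding F3_def by (rule count_s) (rule bad_s)
  have F4s: "F4 \<in> sets \<Omega>" unfolding F4_def by (rule count_s) (rule far_s)
  have F3: "measure \<Omega> F3 \<le> 1 / 8"
  proof -
    have "measure \<Omega> F3 \<le> (\<Sum>t\<in>?J. measure \<Omega> (bad t)) / W"
      unfolding F3_def by (rule \<Omega>.markov_count[OF _ bad_s]) (use W8 in auto)
    moreover have "(\<Sum>t\<in>?J. measure \<Omega> (bad t)) \<le> card ?J * (p2 ^ (k1 + k2) + 3 / 2 ^ w + 1 / n)"
      using bad_m by (rule sum_bounded_above)
    ultimately show ?thesis using W8 unfolding cJ by (intro eighth) auto
  qed
  have F4: "measure \<Omega> F4 \<le> 1 / 8"
  proof -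
    have "measure \<Omega> F4 \<le> (\<Sum>t\<in>?J. measure \<Omega> (far t)) / D"
      unfolding F4_def by (rule \<Omega>.markov_count[OF _ far_s]) (use D8 in auto)
    moreover have "(\<Sum>t\<in>?J. measure \<Omega> (far t)) \<le> card ?J * (p2 ^ (k1 + k2) + 2 / 2 ^ w)"
      using far_m by (rule sum_bounded_above)
    ultimately show ?thesis using D8 unfolding cJ by (intro eighth) auto
  qed
  let ?F = "F1 \<union> F2 \<union> (F3 \<union> F4)"
  have Fs: "?F \<in> sets \<Omega>" using F1s F2s F3s F4s by auto
  have "measure \<Omega> ?F \<le> measure \<Omega> F1 + measure \<Omega> F2 + (measure \<Omega> F3 + measure \<Omega> F4)"
    using F1s F2s F3s F4s
    by (intro order_trans[OF measure_Un_le] add_mono measure_Un_le) auto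
  then have F: "measure \<Omega> ?F \<le> 1 / 2" using F1 F2 F3 F4 by simp
  have "space seeds - ?good \<subseteq> {\<omega> \<in> space seeds. fst \<omega> \<in> ?F}"
  proof
    fix \<omega> assume \<omega>: "\<omega> \<in> space seeds - ?good"
    then have sp: "fst \<omega> \<in> space \<Omega>" by (auto simp: seeds_eq space_pair_measure)
    have "fst \<omega> \<in> ?F"
    proof (rule ccontr)
      assume nF: "fst \<omega> \<notin> ?F"
      obtain i where i: "i < A" "\<forall>h\<in>?L i. fst \<omega> h \<in> coll q x0" using nF sp by (auto simp: F1_def)
      obtain j where j: "j < B" "\<forall>h\<in>?R j. fst \<omega> h \<in> coll q x0" using nF sp by (auto simp: F2_def)
      have "(\<Sum>h\<in>?U i j. snd (fst \<omega> h) (fst (fst \<omega> h) x0)) = (\<Sum>h\<in>?U i j. snd (fst \<omega> h) (fst (fst \<omega> h) q))"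
        using i(2) j(2) by (intro sum.cong refl) (auto simp: coll_def)
      then have eq: "tkey \<omega> i j (pts p0) = tkey \<omega> i j q"
        unfolding tk[OF i(1) j(1)] by (simp add: key_def x0_def)
      have "{(i, j, p). i < A \<and> j < B \<and> p < n \<and> tkey \<omega> i j (pts p) mod n = tkey \<omega> i j q mod n \<and>
          \<not> (tkey \<omega> i j (pts p) = tkey \<omega> i j q \<and> dst q (pts p) < r2)} = {t \<in> ?J. fst \<omega> \<in> bad t}"
        using sp by (auto simp: bad_def tk)
      moreover have "card {t \<in> ?J. fst \<omega> \<in> bad t} < W" using nF sp by (auto simp: F3_def)
      moreover have "{(i, j, p). i < A \<and> j < B \<and> p < n \<and> tkey \<omega> i j (pts p) = tkey \<omega> i j q \<and>
          \<not> dst q (pts p) < r2} = {t \<in> ?J. fst \<omega> \<in> far t}"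
        using sp by (auto simp: far_def tk)
      moreover have "card {t \<in> ?J. fst \<omega> \<in> far t} < D" using nF sp by (auto simp: F4_def)
      ultimately have "answer \<omega> q < n \<and> dst q (pts (answer \<omega> q)) < r2"
        using near r by (intro answer_correct[OF i(1) j(1) near(1) eq]) auto
      with \<omega> show False by simp
    qed
    with \<omega> show "\<omega> \<in> {\<omega> \<in> space seeds. fst \<omega> \<in> ?F}" by simp
  qed
  then have "measure seeds (space seeds - ?good) \<le> measure seeds {\<omega> \<in> space seeds. fst \<omega> \<in> ?F}"
    by (rule seeds.finite_measure_mono) (rule measure_seeds_fst[OF Fs])
  also have "\<dots> \<le> 1 / 2" unfolding measure_seeds_fst[OF Fs] by (rule F)
  finally show ?thesis using seeds.prob_compl[OF success_sets[OF q]] by simp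
qed

end

section \<open>Choice of the parameters\<close>

text \<open>With \<open>x\<close> the unrounded logarithm, \<open>R = (1 / p1) powr x\<close> and
  \<open>n = (1 / p2) powr x\<close>. The bound \<open>k - 1 < x\<close> gives the estimate with
  exponent \<open>k - 1\<close>; \<open>x \<le> k\<close> gives the one for far matches, since
  \<open>p2 / p1 < 1\<close> makes \<open>(p2 / p1) ^ k\<close> decrease in
  \<open>k\<close>.\<close>

lemma lsh_parameters:
  fixes n k :: nat and p1 p2 R :: real
  assumes n: "2 \<le> n" and p: "0 < p1" "p1 \<le> 1" "0 < p2" "p2 < p1" "p2 < 1"
  defines "k \<equiv> nat \<lceil>log (1 / p2) n\<rceil>" and "R \<equiv> n powr lsh_rho p1 p2"
  shows "1 \<le> k" "lsh_k n p2 = k" "(1 / p1) ^ (k - 1) \<le> R" "(1 / p1) ^ k * p2 ^ k * n \<le> R"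
    "1 \<le> R" "R \<le> n"
proof -
  define L1 where "L1 = ln (1 / p1)"
  define L2 where "L2 = ln (1 / p2)"
  define x where "x = log (1 / p2) n"
  have L: "0 \<le> L1" "0 < L2" "L1 < L2" using p by (auto simp: L1_def L2_def divide_simps)
  have ln: "0 < ln (real n)" using n by simp
  have x: "x * L2 = ln n" "0 < x" using L ln by (auto simp: x_def log_def L2_def)
  have k: "real k - 1 < x" "x \<le> real k"
    using x(2) unfolding k_def x_def by linarith+
  show k1: "1 \<le> k" using k x(2) by linarith
  show "lsh_k n p2 = k" using x(2) by (simp add: lsh_k_def k_def x_def)
  have R: "R = exp (x * L1)"
  proof -
    have "lsh_rho p1 p2 * ln n = x * L1"
      using L x(1)[symmetric] by (simp add: lsh_rho_def L1_def L2_def)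
    then show ?thesis using n by (simp add: R_def powr_def)
  qed
  have "1 / p1 = exp L1" unfolding L1_def using p by (subst exp_ln) auto
  moreover have "p2 = exp (- L2)" "real n = exp (ln n)"
    using p n by (auto simp: L2_def ln_div)
  ultimately have e: "1 / p1 = exp L1" "p2 = exp (- L2)" "real n = exp (ln n)" by auto
  have "(1 / p1) ^ (k - 1) = exp (real (k - 1) * L1)" by (simp add: e(1) exp_of_nat_mult)
  also have "\<dots> \<le> R" unfolding R using k k1 L by (simp add: mult_right_mono of_nat_diff)
  finally show "(1 / p1) ^ (k - 1) \<le> R" .
  have "(1 / p1) ^ k * p2 ^ k * n = exp (k * L1) * exp (k * (- L2)) * exp (ln n)"
    by (subst e(1), subst e(2), subst e(3)) (simp only: exp_of_nat_mult)
  also have "\<dots> = exp (k * (L1 - L2) + x * L2)" by (simp add: x(1) flip: exp_add) (simp add: algebra_simps)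
  also have "\<dots> \<le> R" unfolding R
  proof -
    have "real k * (L1 - L2) \<le> x * (L1 - L2)" using k L by (intro mult_right_mono_neg) auto
    then show "exp (k * (L1 - L2) + x * L2) \<le> exp (x * L1)" by (simp add: algebra_simps)
  qed
  finally show "(1 / p1) ^ k * p2 ^ k * n \<le> R" .
  show "1 \<le> R" unfolding R using x L by simp
  have "x * L1 \<le> x * L2" using x(2) L by simp
  then have "R \<le> exp (ln n)" unfolding R x(1) by simp
  then show "R \<le> n" using n by simp
qed

lemma sufficient_word_lengthD:
  assumes "sufficient_word_length 30 n p1 p2 w"
  shows "(1 + real n) ^ 30 \<le> 2 ^ w"
    "p2 < p1 \<Longrightarrow> 0 \<le> lsh_k n p2 / p1 \<Longrightarrow> (1 + lsh_k n p2 / p1) ^ 30 \<le> 2 ^ w"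
proof -
  have *: "y ^ 30 \<le> 2 ^ w" if "30 * log 2 y \<le> real w" "1 \<le> y" for y :: real
  proof -
    have "log 2 (y ^ 30) = 30 * log 2 y" using that by (simp add: log_nat_power)
    then have "log 2 (y ^ 30) \<le> log 2 (2 ^ w)" using that by (simp add: log_nat_power)
    then show ?thesis using that by (subst (asm) log_le_cancel_iff) auto
  qed
  show "(1 + real n) ^ 30 \<le> 2 ^ w"
    using assms by (intro *) (auto simp: sufficient_word_length_def)
  show "p2 < p1 \<Longrightarrow> 0 \<le> lsh_k n p2 / p1 \<Longrightarrow> (1 + lsh_k n p2 / p1) ^ 30 \<le> 2 ^ w"
    using assms by (intro *) (auto simp: sufficient_word_length_def)
qed

text \<open>The origin of the factor 30 in the word length: the geometric mean of the two hypotheses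
  gives \<open>y ^ 15 * z ^ 15 \<le> N\<close>. Two powers of each factor are kept, and the other 13
  of each supply \<open>2 ^ 26\<close>, which exceeds 67000000.\<close>

lemma product_le_word:
  fixes y z N :: real
  assumes "y ^ 30 \<le> N" "z ^ 30 \<le> N" "2 \<le> y" "2 \<le> z"
  shows "67000000 * (y\<^sup>2 * z\<^sup>2) \<le> N"
proof -
  have "67000000 * (y\<^sup>2 * z\<^sup>2) \<le> 2 ^ 13 * 2 ^ 13 * (y\<^sup>2 * z\<^sup>2)" by (intro mult_right_mono) auto
  also have "\<dots> \<le> y ^ 13 * z ^ 13 * (y\<^sup>2 * z\<^sup>2)"
    using assms by (intro mult_right_mono mult_mono power_mono) auto
  also have "\<dots> = y ^ 15 * z ^ 15" by (simp flip: power_add add: algebra_simps)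
  also have "\<dots> \<le> N"
  proof (rule power2_le_imp_le)
    have "(y ^ 15 * z ^ 15)\<^sup>2 = y ^ 30 * z ^ 30" by (simp add: power_mult_distrib flip: power_mult)
    also have "\<dots> \<le> N * N" using assms by (intro mult_mono) (auto intro: order_trans[OF _ assms(1)])
    finally show "(y ^ 15 * z ^ 15)\<^sup>2 \<le> N\<^sup>2" by (simp add: power2_eq_square)
    show "0 \<le> N" using assms(1,3) by (intro order_trans[OF _ assms(1)]) auto
  qed
  finally show ?thesis .
qed

definition lsh_bounds ::
  "'x set \<Rightarrow> ('x \<Rightarrow> 'x \<Rightarrow> real) \<Rightarrow> 'x set \<Rightarrow> real \<Rightarrow> real \<Rightarrow> real \<Rightarrow> real \<Rightarrow>
     ('x \<Rightarrow> 'r::countable) measure \<Rightarrow> ('r \<Rightarrow> nat) measure \<Rightarrow> nat \<Rightarrow> 'x nn_structure \<Rightarrow> bool" where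
  "lsh_bounds X dst P r1 r2 p1 p2 H G w S \<longleftrightarrow>
     near_neighbor_solution w X dst P r1 r2 H G lsh_query S \<and>
     (\<forall>q\<in>X. \<forall>\<omega>\<in>space (seed_space w H G S).
        \<exists>e d t out. query_run w (card P) dst r2 lsh_query S q \<omega> e d t out \<and>
          real e \<le> 200000 * ((lsh_k (card P) p2)\<^sup>2 / p1) \<and>
          real d \<le> 200000 * real (card P) powr lsh_rho p1 p2 \<and>
          real t \<le> 200000 * (real (card P) powr lsh_rho p1 p2 / p1 + real e)) \<and>
     real (space_words S) \<le> 200000 * (real (card P) powr (1 + lsh_rho p1 p2) / p1) \<and>
     real (hash_count S) \<le> 200000 * ((lsh_k (card P) p2)\<^sup>2 / p1)"

context lsh
begin

lemma lsh_boundsI: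
  assumes P: "bij_betw pts {..<n} P" "card P = n"
    and success: "\<And>q. q \<in> X \<Longrightarrow> \<exists>x\<in>P. dst q x \<le> r1 \<Longrightarrow>
      1 / 2 \<le> measure seeds {\<omega> \<in> space seeds. answer \<omega> q < n \<and> dst q (pts (answer \<omega> q)) < r2}"
    and e: "real (hashes gs) \<le> 200000 * ((lsh_k n p2)\<^sup>2 / p1)"
    and d: "real D \<le> 200000 * n powr lsh_rho p1 p2"
    and t: "7 * real (length (encode gs)) + 4 * real (hashes gs) + 20 * real W + 62 * (real A * real B) \<le>
      200000 * (n powr lsh_rho p1 p2 / p1 + real (hashes gs))"
    and s: "real (lsh_space A B n gs) \<le> 200000 * (n powr (1 + lsh_rho p1 p2) / p1)"
  shows "lsh_bounds X dst P r1 r2 p1 p2 H G w S"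
proof -
  have S: "points S = pts" "space_words S = lsh_space A B n gs" "hash_count S = hashes gs"
    by (simp_all add: lsh_structure_def)
  have "near_neighbor_solution w X dst P r1 r2 H G lsh_query S"
    unfolding near_neighbor_solution_def P(2) success_eq
    using P(1) success initial_memory_word by (simp add: S(1))
  moreover have "\<exists>e d t out. query_run w n dst r2 lsh_query S q \<omega> e d t out \<and>
          real e \<le> 200000 * ((lsh_k n p2)\<^sup>2 / p1) \<and> real d \<le> 200000 * n powr lsh_rho p1 p2 \<and>
          real t \<le> 200000 * (n powr lsh_rho p1 p2 / p1 + real e)" for q and \<omega> :: "('x, 'r) seed"
  proof -
    obtain d' t' where run: "query_run w n dst r2 lsh_query S q \<omega> (hashes gs) d' t' (answer \<omega> q)"
      and d': "d' \<le> D" and t': "t' \<le> 7 * length (encode gs) + 4 * hashes gs + 20 * W + 62 * (A * B)"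
      using query_run_lsh by blast
    have "real t' \<le> real (7 * length (encode gs) + 4 * hashes gs + 20 * W + 62 * (A * B))"
      using t' by (rule of_nat_mono)
    then have "real t' \<le> 200000 * (n powr lsh_rho p1 p2 / p1 + real (hashes gs))" using t by simp
    moreover have "real d' \<le> 200000 * n powr lsh_rho p1 p2" using d d' by simp
    ultimately show ?thesis using run e by blast
  qed
  ultimately show ?thesis unfolding lsh_bounds_def P(2) S using e s by blast
qed

end

section \<open>The structure for a given instance\<close>

locale lsh_instance =
  fixes X :: "'x set" and dst :: "'x \<Rightarrow> 'x \<Rightarrow> real" and P :: "'x set" and n :: nat
    and r1 r2 p1 p2 :: real and H :: "('x \<Rightarrow> 'r::countable) measure" and G :: "('r \<Rightarrow> nat) measure"
    and w :: nat
  assumes dist: "distance_space X dst" and P: "P \<subseteq> X" "finite P" "card P = n" and n: "1 \<le> n"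
    and r: "0 < r1" "r1 < r2" and p: "0 < p1" "0 < p2" "p2 < 1"
    and H: "hash_family X H" and sens: "sensitive X dst r1 r2 p1 p2 H"
    and word: "sufficient_word_length 30 n p1 p2 w" and G: "pairwise_independent_hash w G"
begin

text \<open>A data point has distance 0 to itself and always collides with itself;
  \<open>1 \<le> n\<close> provides such a point.\<close>

lemma p1_le_1: "p1 \<le> 1"
proof -
  interpret H: prob_space H using H by (simp add: hash_family_def)
  obtain x where x: "x \<in> P" using P n by (metis card.empty ex_in_conv not_one_le_zero)
  then have "x \<in> X" "dst x x \<le> r1" using P dist r by (auto simp: distance_space_def)
  then have "p1 \<le> measure H {h \<in> space H. h x = h x}" using sens unfolding sensitive_def by blast
  also have "\<dots> \<le> 1" by (rule H.prob_le_1)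
  finally show ?thesis .
qed

lemma exists_enumeration: "\<exists>pts. bij_betw pts {..<n} P"
  using P bij_betw_iff_card[of "{..<n}" P] by simp

text \<open>If \<^term>\<open>p1 \<le> p2\<close> then the exponent is at least \<open>1\<close> and a linear scan is affordable;
  it is the instance with a single table and no hash functions.\<close>

lemma exists_structure_scan:
  assumes scan: "n = 1 \<or> p1 \<le> p2"
  shows "\<exists>S. lsh_bounds X dst P r1 r2 p1 p2 H G w S"
proof -
  obtain pts where enum: "bij_betw pts {..<n} P" using exists_enumeration by blast
  have ptsX: "pts i \<in> X" if "i < n" for i using enum P that by (auto simp: bij_betw_def)
  have "3 * real n + 17 \<le> 2 ^ w"
  proof -
    have "3 * real n + 17 \<le> 2 ^ 29 * (1 + real n)" by simp
    also have "\<dots> \<le> (1 + real n) ^ 29 * (1 + real n)"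
      using n by (intro mult_right_mono power_mono) auto
    also have "\<dots> \<le> 2 ^ w" using sufficient_word_lengthD(1)[OF word] by (simp flip: power_Suc2)
    finally show ?thesis .
  qed
  then have "real (3 * n + 17) \<le> real (2 ^ w)" by simp
  then have ws: "3 * n + 17 \<le> 2 ^ w" by (simp only: of_nat_le_iff)
  \<comment> \<open>Without hash functions every key is the empty sum 0, so all points lie in bucket
    0 and match the query. Budgets of \<open>n + 1\<close> strictly exceed the number of entries, so
    this instance succeeds for every seed.\<close>
  interpret L: lsh X H G w dst r2 pts n 1 1 "n + 1" "n + 1" "[]"
    by unfold_locales (use H G ws n ptsX in \<open>auto simp: wf_groups_def lsh_space_def\<close>)
  let ?R = "n powr lsh_rho p1 p2"
  have R: "real n \<le> ?R"
  proof (cases "n = 1")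
    case False
    then have le: "p1 \<le> p2" using scan by simp
    have "1 \<le> lsh_rho p1 p2"
      unfolding lsh_rho_def using le p by (subst le_divide_eq_1_pos) (auto simp: divide_simps)
    then have "n powr 1 \<le> ?R" using n by (intro powr_mono) auto
    then show ?thesis using n by simp
  qed simp
  have Rp: "?R \<le> ?R / p1" using p1_le_1 p by (simp add: divide_simps mult_left_le)
  have "lsh_bounds X dst P r1 r2 p1 p2 H G w L.S"
  proof (rule L.lsh_boundsI[OF enum P(3)])
    fix q assume q: "q \<in> X" and "\<exists>x\<in>P. dst q x \<le> r1"
    then obtain p0 where p0: "p0 < n" "dst q (pts p0) < r2"
      using enum r by (force simp: bij_betw_def)
    have card: "card {(i, j, p). i < (1::nat) \<and> j < (1::nat) \<and> p < n \<and> Q i j p} < n + 1" for Q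
    proof -
      have "{(i, j, p). i < (1::nat) \<and> j < (1::nat) \<and> p < n \<and> Q i j p} \<subseteq> {0} \<times> {0} \<times> {..<n}" by auto
      from card_mono[OF _ this] show ?thesis by (simp add: card_cartesian_product)
    qed
    have "L.answer \<omega> q < n \<and> dst q (pts (L.answer \<omega> q)) < r2" for \<omega>
    proof (rule L.answer_correct[of 0 0 p0], goal_cases)
      case 6
      show ?case by (rule card)
    next
      case 7
      show ?case by (rule card)
    qed (use p0 in \<open>auto simp: table_key_def\<close>)
    then have "{\<omega> \<in> space L.seeds. L.answer \<omega> q < n \<and> dst q (pts (L.answer \<omega> q)) < r2} = space L.seeds" by auto
    then show "1 / 2 \<le> measure L.seeds {\<omega> \<in> space L.seeds. L.answer \<omega> q < n \<and> dst q (pts (L.answer \<omega> q)) < r2}"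
      using prob_space.prob_space[OF L.prob_space_seeds] by simp
  next
    show "real (hashes []) \<le> 200000 * ((lsh_k n p2)\<^sup>2 / p1)" using p by simp
    show "real (n + 1) \<le> 200000 * ?R" using R n by simp
    show "7 * real (length (encode [])) + 4 * real (hashes []) + 20 * real (n + 1) + 62 * (real 1 * real 1) \<le>
      200000 * (?R / p1 + real (hashes []))"
      using R Rp n by simp
    have "real (lsh_space 1 1 n []) \<le> 200000 * (n * (?R / p1))"
    proof -
      have "real (lsh_space 1 1 n []) \<le> 200000 * real n" using n by (simp add: lsh_space_def)
      also have "\<dots> \<le> 200000 * (n * (?R / p1))"
      proof -
        have "1 \<le> ?R / p1" using R Rp n by simp
        then have "real n * 1 \<le> n * (?R / p1)" by (intro mult_left_mono) auto
        then show ?thesis by linarith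
      qed
      finally show ?thesis .
    qed
    then show "real (lsh_space 1 1 n []) \<le> 200000 * (n powr (1 + lsh_rho p1 p2) / p1)"
      using n by (simp add: powr_add)
  qed
  then show ?thesis by blast
qed

lemma exists_structure_lsh:
  assumes n2: "2 \<le> n" and p21: "p2 < p1"
  shows "\<exists>S. lsh_bounds X dst P r1 r2 p1 p2 H G w S"
proof -
  obtain pts where enum: "bij_betw pts {..<n} P" using exists_enumeration by blast
  have ptsX: "pts i \<in> X" if "i < n" for i using enum P that by (auto simp: bij_betw_def)
  define k where "k = nat \<lceil>log (1 / p2) n\<rceil>"
  define R where "R = n powr lsh_rho p1 p2"
  define \<theta> where "\<theta> = 1 / p1"
  note par = lsh_parameters[OF n2 p(1) p1_le_1 p(2) p21 p(3), folded k_def R_def \<theta>_def]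
  have \<theta>: "1 \<le> \<theta>" using p p1_le_1 by (simp add: \<theta>_def)
  define k1 where "k1 = k div 2"
  define k2 where "k2 = k - k div 2"
  have k12: "k1 + k2 = k" by (simp add: k1_def k2_def)
  define A where "A = nat \<lceil>16 * \<theta> ^ k1\<rceil>"
  define B where "B = nat \<lceil>16 * \<theta> ^ k2\<rceil>"
  obtain gs where gs: "design \<theta> k1 k2 A B gs" "hashes gs \<le> 33 * (real k)\<^sup>2 * \<theta>"
    "length (encode gs) \<le> 102 * R * \<theta>"
    using exists_design[OF \<theta> par(1,3)] unfolding k1_def k2_def A_def B_def by blast
  \<comment> \<open>Here \<open>289 = 17 * 17\<close> bounds the rounding in \<open>A * B\<close>.
    The list budget is \<open>6936 = 24 * 289\<close>, as far collisions, word accidents and bucket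
    accidents contribute \<open>8 * 289\<close> each. The distance budget
    \<open>4624 = 16 * 289\<close> covers \<open>8 * 289\<close> for far collisions and
    \<open>16 * 289 / 3\<close> for word accidents.\<close>
  define D where "D = nat \<lceil>4624 * R\<rceil>"
  have R\<theta>: "1 \<le> R * \<theta>" using mult_mono[OF par(5) \<theta>] par(5) by simp
  define W where "W = nat \<lceil>6936 * (R * \<theta>)\<rceil>"
  have D: "4624 * R \<le> D" "D \<le> 4625 * R" using ceiling_bounds[OF par(5), of 4624] by (auto simp: D_def)
  have W: "6936 * (R * \<theta>) \<le> W" "W \<le> 6937 * (R * \<theta>)"
    using ceiling_bounds[OF R\<theta>, of 6936] by (auto simp: W_def)
  have A: "16 * \<theta> ^ k1 \<le> A" "A \<le> 17 * \<theta> ^ k1"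
    using ceiling_bounds[OF one_le_power[OF \<theta>], of 16 k1] by (auto simp: A_def)
  have B: "16 * \<theta> ^ k2 \<le> B" "B \<le> 17 * \<theta> ^ k2"
    using ceiling_bounds[OF one_le_power[OF \<theta>], of 16 k2] by (auto simp: B_def)
  have "1 \<le> real A" "1 \<le> real B"
    using A(1) B(1) one_le_power[OF \<theta>, of k1] one_le_power[OF \<theta>, of k2] by linarith+
  then have AB1: "1 \<le> A" "1 \<le> B" by simp_all
  have AB: "real A * real B \<le> 289 * \<theta> ^ k"
  proof -
    have "real A * real B \<le> (17 * \<theta> ^ k1) * (17 * \<theta> ^ k2)" using A B \<theta> by (intro mult_mono) auto
    then show ?thesis by (simp add: power_add flip: k12)
  qed
  have \<theta>k: "\<theta> ^ k \<le> R * \<theta>"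
  proof -
    have "\<theta> ^ k = \<theta> ^ (k - 1) * \<theta>" using par(1) by (metis Suc_diff_1 less_le_trans power_Suc2 zero_less_one)
    also have "\<dots> \<le> R * \<theta>" using par(3) \<theta> by (intro mult_right_mono) auto
    finally show ?thesis .
  qed
  have ABR: "real A * real B \<le> 289 * (R * \<theta>)" using AB \<theta>k by linarith

  \<comment> \<open>A common bound, up to constants, for all counts, addresses and budgets that have
    to fit into a word. It is polynomial in \<open>n\<close> and \<open>k / p1\<close>, the two
    quantities controlled by the word length.\<close>
  define V :: real where "V = (1 + real n)\<^sup>2 * (1 + real k * \<theta>)\<^sup>2"
  have k\<theta>: "1 \<le> real k * \<theta>" using mult_mono[of 1 "real k" 1 \<theta>] par(1) \<theta> by simp
  have big: "67000000 * V \<le> 2 ^ w"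
  proof -
    have "(1 + real n) ^ 30 \<le> 2 ^ w" by (rule sufficient_word_lengthD(1)[OF word])
    moreover have "(1 + real k * \<theta>) ^ 30 \<le> 2 ^ w"
      using sufficient_word_lengthD(2)[OF word p21] p k\<theta> by (simp add: par(2) \<theta>_def)
    ultimately show ?thesis unfolding V_def using n2 k\<theta> by (intro product_le_word) auto
  qed
  have k\<theta>1: "\<theta> \<le> (1 + real k * \<theta>)\<^sup>2"
  proof -
    have "1 * \<theta> \<le> real k * \<theta>" using par(1) \<theta> by (intro mult_right_mono) auto
    then have "\<theta> \<le> 1 + real k * \<theta>" by linarith
    also have "\<dots> \<le> (1 + real k * \<theta>)\<^sup>2" using k\<theta> by (intro self_le_power) auto
    finally show ?thesis .
  qed
  have n\<theta>: "real n * real n * \<theta> \<le> V"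
    unfolding V_def using k\<theta>1 \<theta> by (intro mult_mono) (auto simp: power2_eq_square algebra_simps)
  have nR: "real n * (R * \<theta>) \<le> V"
  proof -
    have "real n * (R * \<theta>) \<le> real n * (real n * \<theta>)"
      using par(6) \<theta> by (intro mult_left_mono mult_right_mono) auto
    then show ?thesis using n\<theta> by (simp add: mult.assoc)
  qed
  have R\<theta>V: "R * \<theta> \<le> real n * (R * \<theta>)" using n2 R\<theta> by (simp add: mult_le_cancel_right1)
  have V0: "1 \<le> V" using nR R\<theta>V R\<theta> by linarith
  have nth: "3 * (real n * \<theta>) \<le> 2 ^ w"
  proof -
    have "real n * \<theta> \<le> real n * (R * \<theta>)"
      using par(5) \<theta> by (intro mult_left_mono) (auto simp: mult_le_cancel_right1)
    then show ?thesis using nR big V0 by linarith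
  qed
  have kk: "(real k)\<^sup>2 * \<theta> \<le> V"
  proof -
    have "(real k)\<^sup>2 * \<theta> \<le> (real k)\<^sup>2 * \<theta>\<^sup>2" using \<theta> by (intro mult_left_mono self_le_power) auto
    also have "\<dots> \<le> (1 + real k * \<theta>)\<^sup>2" by (subst power_mult_distrib[symmetric]) (use \<theta> in \<open>auto intro: power_mono\<close>)
    also have "\<dots> \<le> V" unfolding V_def by (simp add: mult_le_cancel_right1)
    finally show ?thesis .
  qed
  have space: "real (lsh_space A B n gs) \<le> 6000 * (real n * (R * \<theta>))"
  proof -
    have "A \<le> A * B" "B \<le> A * B" "1 \<le> A * B" using AB1 by auto
    from this[THEN of_nat_mono[where 'a = real]]
    have "real A \<le> real A * real B" "real B \<le> real A * real B" "1 \<le> real A * real B"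
      by simp_all
    moreover have "real A * real B * (3 * (real n + 1)) \<le> 1734 * (real n * (R * \<theta>))"
    proof -
      have "real A * real B * (3 * (real n + 1)) \<le> 289 * (R * \<theta>) * (6 * real n)"
        by (rule mult_mono[OF ABR]) (use n2 R\<theta> in auto)
      then show ?thesis by (simp add: mult_ac)
    qed
    moreover have "real (length (encode gs)) \<le> 102 * (R * \<theta>)" using gs(3) by simp
    moreover have "real (lsh_space A B n gs) =
        11 + (real A + real B) + real (length (encode gs)) + real A * real B * (3 * (real n + 1))"
      by (simp add: lsh_space_def)
    ultimately show ?thesis using ABR R\<theta>V by linarith
  qed
  have lt: "m < 2 ^ w" if "real m \<le> 7000 * V" for m :: nat
  proof -
    have "real m < 2 ^ w" using that big V0 by linarith
    then have "real m < real (2 ^ w)" by simp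
    then show ?thesis by (simp only: of_nat_less_iff)
  qed
  have wf: "wf_groups (A + B) gs" using gs(1) by (simp add: design_def)
  interpret L: lsh X H G w dst r2 pts n A B W D gs
  proof
    show "hashes gs < 2 ^ w" by (rule lt) (use gs(2) kk in linarith)
    show "lsh_space A B n gs < 2 ^ w" by (rule lt) (use space nR in linarith)
    show "W < 2 ^ w" by (rule lt) (use W nR R\<theta>V in linarith)
    have "R \<le> R * \<theta>" using par(5) \<theta> by (simp add: mult_le_cancel_left1)
    then show "D < 2 ^ w" by (intro lt) (use D nR R\<theta>V in linarith)
  qed (use H G wf n AB1 ptsX in auto)
  have far: "real A * real B * real n * p2 ^ k \<le> 289 * R"
  proof -
    have "real A * real B * (real n * p2 ^ k) \<le> 289 * \<theta> ^ k * (real n * p2 ^ k)"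
      using AB p by (intro mult_right_mono) auto
    also have "\<dots> \<le> 289 * R" using par(4) by (simp add: algebra_simps)
    finally show ?thesis by (simp add: mult.assoc)
  qed
  \<comment> \<open>Word accidents also cause distance computations, so they must be of order
    \<open>R\<close> without the factor \<open>\<theta>\<close>. By \<open>nth\<close>, words are
    long enough to absorb \<open>n * \<theta>\<close>.\<close>
  have col: "real A * real B * real n / 2 ^ w \<le> 289 * R / 3"
  proof -
    have "real A * real B * real n \<le> 289 * (R * \<theta>) * real n" using ABR by (intro mult_right_mono) auto
    also have "\<dots> = 289 * R / 3 * (3 * (real n * \<theta>))" by simp
    also have "\<dots> \<le> 289 * R / 3 * 2 ^ w" using nth par(5) by (intro mult_left_mono) auto
    finally show ?thesis by (simp add: divide_le_eq)
  qed
  have R1: "R \<le> R * \<theta>" using par(5) \<theta> by (simp add: mult_le_cancel_left1)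
  have "lsh_bounds X dst P r1 r2 p1 p2 H G w L.S"
  proof (rule L.lsh_boundsI[OF enum P(3)])
    fix q assume q: "q \<in> X" and "\<exists>x\<in>P. dst q x \<le> r1"
    then obtain p0 where p0: "p0 < n" "dst q (pts p0) \<le> r1"
      using enum by (force simp: bij_betw_def)
    show "1 / 2 \<le> measure L.seeds {\<omega> \<in> space L.seeds. L.answer \<omega> q < n \<and> dst q (pts (L.answer \<omega> q)) < r2}"
    proof (rule L.success_prob[OF q sens p(1) less_imp_le[OF p(2)] r(2) gs(1)[unfolded \<theta>_def] p0], unfold k12)
      have "8 * (real A * real B * real n * (p2 ^ k + 2 / 2 ^ w)) =
        8 * (real A * real B * real n * p2 ^ k) + 16 * (real A * real B * real n / 2 ^ w)"
        by (simp add: algebra_simps)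
      also have "\<dots> \<le> 8 * (289 * R) + 16 * (289 * R / 3)" using far col by linarith
      also have "\<dots> \<le> D" using D(1) par(5) by linarith
      finally show "8 * (real A * real B * real n * (p2 ^ k + 2 / 2 ^ w)) \<le> D" .
      have "0 < real D" using D(1) par(5) by linarith
      then show "0 < D" by simp
      have "8 * (real A * real B * real n * (p2 ^ k + 3 / 2 ^ w + 1 / n)) =
        8 * (real A * real B * real n * p2 ^ k) + 24 * (real A * real B * real n / 2 ^ w) + 8 * (real A * real B)"
        using n by (simp add: distrib_left)
      also have "\<dots> \<le> 8 * (289 * R) + 24 * (289 * R / 3) + 8 * (289 * (R * \<theta>))" using far col ABR by linarith
      also have "\<dots> \<le> W" using W(1) R1 by linarith
      finally show "8 * (real A * real B * real n * (p2 ^ k + 3 / 2 ^ w + 1 / n)) \<le> W" .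
      have "0 < real W" using W(1) R\<theta> by linarith
      then show "0 < W" by simp
    qed
  next
    show "real (hashes gs) \<le> 200000 * ((lsh_k n p2)\<^sup>2 / p1)"
    proof -
      have "real (hashes gs) \<le> 200000 * ((real k)\<^sup>2 * \<theta>)" using gs(2) \<theta> by simp
      then show ?thesis by (simp add: par(2) \<theta>_def)
    qed
    show "real D \<le> 200000 * n powr lsh_rho p1 p2" using D(2) par(5) by (simp flip: R_def)
    \<comment> \<open>The largest demand on the constant 200000:
      \<open>7 * 102 + 20 * 6937 + 62 * 289 = 157372\<close>; the hash evaluations are paid for by
      the separate term.\<close>
    have "7 * real (length (encode gs)) + 4 * real (hashes gs) + 20 * real W + 62 * (real A * real B) \<le>
      200000 * (R * \<theta> + real (hashes gs))"
      using gs(3) W(2) ABR R\<theta> by simp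
    then show "7 * real (length (encode gs)) + 4 * real (hashes gs) + 20 * real W + 62 * (real A * real B) \<le>
      200000 * (n powr lsh_rho p1 p2 / p1 + real (hashes gs))"
      by (simp add: \<theta>_def flip: R_def)
    have "real (lsh_space A B n gs) \<le> 200000 * (real n * (R * \<theta>))" using space R\<theta>V R\<theta> by linarith
    then show "real (lsh_space A B n gs) \<le> 200000 * (n powr (1 + lsh_rho p1 p2) / p1)"
      using n by (simp add: powr_add \<theta>_def R_def)
  qed
  then show ?thesis by blast
qed

lemma exists_structure: "\<exists>S. lsh_bounds X dst P r1 r2 p1 p2 H G w S"
  using exists_structure_scan exists_structure_lsh n by (cases "n = 1 \<or> p1 \<le> p2") auto

end

text \<open>The program is chosen before the instance: \<open>lsh_query\<close> obtains
  \<open>n\<close>, the table counts, the budgets and all addresses beyond the fixed header from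
  memory, so one program and one pair of constants serve every space, hash family and word
  length.\<close>

theorem theorem2p5:
  shows "\<exists>(Q :: com) (C :: real) (a :: real). C > 0 \<and> a > 0 \<and>
    (\<forall>(X :: 'x set) dst P n r1 r2 p1 p2 (H :: ('x \<Rightarrow> 'r::countable) measure) G w.
       distance_space X dst \<and> P \<subseteq> X \<and> finite P \<and> card P = n \<and> n \<ge> 1 \<and>
       0 < r1 \<and> r1 < r2 \<and> 0 < p1 \<and> 0 < p2 \<and> p2 < 1 \<and>
       hash_family X H \<and> sensitive X dst r1 r2 p1 p2 H \<and>
       sufficient_word_length a n p1 p2 w \<and> pairwise_independent_hash w G \<longrightarrow>
       (\<exists>D. near_neighbor_solution w X dst P r1 r2 H G Q D \<and>
          (\<forall>q\<in>X. \<forall>\<omega>\<in>space (seed_space w H G D).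
             \<exists>e d t out. query_run w n dst r2 Q D q \<omega> e d t out \<and>
               real e \<le> C * ((lsh_k n p2)\<^sup>2 / p1) \<and>
               real d \<le> C * real n powr lsh_rho p1 p2 \<and>
               real t \<le> C * (real n powr lsh_rho p1 p2 / p1 + real e)) \<and>
          real (space_words D) \<le> C * (real n powr (1 + lsh_rho p1 p2) / p1) \<and>
          real (hash_count D) \<le> C * ((lsh_k n p2)\<^sup>2 / p1)))"
proof (rule exI[of _ lsh_query], rule exI[of _ 200000], rule exI[of _ 30], intro conjI allI impI)
  fix X :: "'x set" and dst P n r1 r2 p1 p2 and H :: "('x \<Rightarrow> 'r) measure"
    and G :: "('r \<Rightarrow> nat) measure" and w
  assume "distance_space X dst \<and> P \<subseteq> X \<and> finite P \<and> card P = n \<and> n \<ge> 1 \<and>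
       0 < r1 \<and> r1 < r2 \<and> 0 < p1 \<and> 0 < p2 \<and> p2 < 1 \<and>
       hash_family X H \<and> sensitive X dst r1 r2 p1 p2 H \<and>
       sufficient_word_length 30 n p1 p2 w \<and> pairwise_independent_hash w G"
  then interpret lsh_instance X dst P n r1 r2 p1 p2 H G w
    by unfold_locales auto
  from exists_structure show "\<exists>D. near_neighbor_solution w X dst P r1 r2 H G lsh_query D \<and>
          (\<forall>q\<in>X. \<forall>\<omega>\<in>space (seed_space w H G D).
             \<exists>e d t out. query_run w n dst r2 lsh_query D q \<omega> e d t out \<and>
               real e \<le> 200000 * ((lsh_k n p2)\<^sup>2 / p1) \<and>
               real d \<le> 200000 * real n powr lsh_rho p1 p2 \<and>
               real t \<le> 200000 * (real n powr lsh_rho p1 p2 / p1 + real e)) \<and>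
          real (space_words D) \<le> 200000 * (real n powr (1 + lsh_rho p1 p2) / p1) \<and>
          real (hash_count D) \<le> 200000 * ((lsh_k n p2)\<^sup>2 / p1)"
    unfolding lsh_bounds_def P(3) .
qed simp_all

end
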